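(* Let $(\mathfrak d,\mathfrak g,\mathfrak h)$ be a Manin quasi-triple with group pair $(D,G)$, $S=D/G$, and let $\Gamma$ be the associated quasi-Poisson groupoid $(G\times S\rightrightarrows S,\Pi,\Omega)$. (1) If $(X,\Pi_X)$ is a quasi-hamiltonian space with $G$-action $\Phi$ and momentum map $J:X\to S$, then $(X,\Pi_X)$ is a Hamiltonian $\Gamma$-space with momentum map $J$, where the $\Gamma$-action is $(g,s)\cdot x=\Phi(g,x)$ for $g\in G$, $s\in S$, $x\in X$ with $J(x)=s$. (2) Conversely, if $(X,\Pi_X)$ is a Hamiltonian $\Gamma$-space with momentum map $J:X\to S$, then $(X,\Pi_X)$ is a quasi-hamiltonian space with momentum map $J:X\to S$, where the $G$-action on $X$ is $\Phi(g,x)=(g,J(x))\cdot x$ for $g\in G$, $x\in X$.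
   Context: Manin quasi-triple: $\mathfrak d$ is an even-dimensional real Lie algebra with an invariant nondegenerate symmetric bilinear form, $\mathfrak g\subset\mathfrak d$ a maximal isotropic subalgebra, $\mathfrak h$ an isotropic complement, identified with $\mathfrak g^*$. Let $\{e_i\}$ be a basis of $\mathfrak g$, $\{\epsilon^i\}$ the dual basis of $\mathfrak g^*\cong\mathfrak h$. The quasi-Lie bialgebra $(\mathfrak g,F,\Omega)$ is $F(e_i)=\frac12\sum F_i^{jk}e_j\wedge e_k$, $\Omega=\frac16\sum\Omega^{ijk}e_i\wedge e_j\wedge e_k$, where $[e_i,e_j]_{\mathfrak d}=\sum_kc_{ij}^ke_k$, $[e_i,\epsilon^j]_{\mathfrak d}=\sum_k(-c_{ik}^j\epsilon^k+F_i^{jk}e_k)$, $[\epsilon^i,\epsilon^j]_{\mathfrak d}=\sum_k(F_k^{ij}\epsilon^k+\Omega^{ijk}e_k)$. $D,G$ are connected and simply connected Lie groups with Lie algebras $\mathfrak d,\mathfrak g$, $G$ a closed subgroup of $D$. Brackets of Lie algebras of Lie groups are taken from right-invariant vector fields, $[\overrightarrow\xi,\overrightarrow\eta]=\overrightarrow{[\xi,\eta]}$; for a left action on $X$, $\xi_X(x)=\frac{d}{dt}|_{t=0}\exp(t\xi)\cdot x$ (extended to $\wedge\mathfrak g\to\mathfrak X^\bullet(X)$). $D$ acts on $S=D/G$ by left multiplication, with $v\mapsto v_S$ the infinitesimal action; $G$ acts on $S$ by restriction (dressing action). $\Pi_G$ is the multiplicative bivector field on $G$ with $[\overrightarrow\xi,\Pi_G]=\overrightarrow{F(\xi)}$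 for $\xi\in\mathfrak g$; $(G,\Pi_G,\Omega)$ is a quasi-Poisson Lie group. $\Pi_S$ is the bivector field on $S$ with $\Pi_S(df,dh)=-\sum_i(\epsilon^i)_S(f)(e_i)_S(h)$. $\lambda:T_s^*S\to\mathfrak g$ is given by $\langle\lambda(\theta_s),\eta\rangle=\langle\theta_s,\eta_S(s)\rangle$ for $\eta\in\mathfrak h\cong\mathfrak g^*$. The groupoid: $G\times S\rightrightarrows S$ has source $\alpha(g,s)=g\cdot s$, target $\beta(g,s)=s$, product $(g,h\cdot s)(h,s)=(gh,s)$, Lie algebroid $\mathfrak g\times S$ (with $\Omega$ a constant section of its third exterior power), and bivector field $$\Pi((\theta_g,\theta_s),(\theta'_g,\theta'_s))=\Pi_G(\theta_g,\theta'_g)-\Pi_S(\theta_s,\theta'_s)+\langle\theta'_s,(L_g^*\theta_g)_S\rangle-\langle\theta_s,(L_g^*\theta'_g)_S\rangle,$$ where $L_g^*\theta_g\in\mathfrak g^*\cong\mathfrak h$. Quasi-hamiltonian space: a manifold $X$ with bivector field $\Pi_X$ and a $G$-action $\Phi:G\times X\to X$ which is a quasi-Poisson action, i.e. $\Phi_*(\Pi_G\oplus\Pi_X)=\Pi_X$ and $\frac12[\Pi_X,\Pi_X]=\Omega_X$, together with a $G$-equivariant map $J:X\to S$ (momentum map) satisfying $\Pi_X^\sharp(J^*\theta_s)=-(\lambda(\theta_s))_X$ for all $\theta_s\in T^*_sS$, where $\Pi_X^\sharp(\sigma)=\Pi_X(\sigma,\cdot)$. Hamiltonian $\Gamma$-space: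 for a Lie groupoid $\Gamma\rightrightarrows M$ with source $\alpha$, target $\beta$ (product $gh$ defined iff $\beta(g)=\alpha(h)$), a $\Gamma$-space is a manifold $X$ with a smooth map $J:X\to M$ and a smooth action $\{(g,x):\beta(g)=J(x)\}\to X$, $(g,x)\mapsto g\cdot x$, with $J(g\cdot x)=\alpha(g)$, $(gh)\cdot x=g\cdot(h\cdot x)$ and units acting trivially. If $\Gamma$ has a quasi-Poisson structure $(\Pi,\Omega)$, a Hamiltonian $\Gamma$-space is a $\Gamma$-space $X$ with a bivector field $\Pi_X$ such that the graph $\{(g,x,g\cdot x)\}$ is coisotropic in $\Gamma\times X\times X$ with respect to $\Pi\oplus\Pi_X\oplus(-\Pi_X)$ (this bivector field vanishes on pairs of conormal covectors to the graph) and $\frac12[\Pi_X,\Pi_X]=\widehat\Omega$, where $\widehat{\ }:\Gamma(\wedge^\bullet A)\to\mathfrak X^\bullet(X)$ is induced by the infinitesimal action of the Lie algebroid $A$ of $\Gamma$ on $X$ (here $\widehat\xi=\xi_X$ for constant sections $\xi\in\mathfrak g$). Schouten bracket convention: $[X,f]=X(f)$, $[P,Q]=-(-1)^{(p-1)(q-1)}[Q,P]$, $[P,Q\wedge R]=[P,Q]\wedge R+(-1)^{(p-1)q}Q\wedge[P,R]$. *)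

theory Defs
  imports "HOL-Analysis.Analysis" "HOL-Algebra.Coset"
begin

section \<open>Smooth manifolds\<close>

text \<open>
  \<open>E\<close> is a linear subspace of a Euclidean space and \<open>A\<close> is open in \<open>E\<close>. Letting the model space be
  a subspace makes every dimension available, including \<open>0\<close> (the type class
  \<open>euclidean_space\<close> excludes the zero space).  Derivatives are only determined, and only
  differentiated further, in the directions of \<open>E\<close>.
\<close>

fun Ck_on :: "nat \<Rightarrow> 'e::real_normed_vector set \<Rightarrow> 'e set \<Rightarrow> ('e \<Rightarrow> 'f::real_normed_vector) \<Rightarrow> bool"
where
  "Ck_on 0 E A f \<longleftrightarrow> continuous_on A f"
| "Ck_on (Suc k) E A f \<longleftrightarrow>
     (\<exists>f'. (\<forall>x\<in>A. (f has_derivative f' x) (at x within A)) \<and>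
           (\<forall>v\<in>E. Ck_on k E A (\<lambda>x. f' x v)))"

definition smooth_on :: "'e::real_normed_vector set \<Rightarrow> 'e set \<Rightarrow> ('e \<Rightarrow> 'f::real_normed_vector) \<Rightarrow> bool"
  where "smooth_on E A f \<longleftrightarrow> (\<forall>k. Ck_on k E A f)"

record ('a, 'e) mfd =
  mtop :: "'a topology"
  model :: "'e set"
  atlas :: "('a set \<times> ('a \<Rightarrow> 'e)) set"

abbreviation points :: "('a, 'e, 'z) mfd_scheme \<Rightarrow> 'a set"
  where "points M \<equiv> topspace (mtop M)"

definition manifold :: "('a, 'e::euclidean_space) mfd \<Rightarrow> bool" where
  "manifold M \<longleftrightarrow>
     Hausdorff_space (mtop M) \<and> second_countable (mtop M) \<and> subspace (model M) \<and>
     points M = (\<Union>(U, \<phi>)\<in>atlas M. U) \<and>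
     (\<forall>(U, \<phi>)\<in>atlas M. openin (mtop M) U \<and> openin (top_of_set (model M)) (\<phi> ` U) \<and>
        homeomorphic_map (subtopology (mtop M) U) (top_of_set (\<phi> ` U)) \<phi>) \<and>
     (\<forall>(U, \<phi>)\<in>atlas M. \<forall>(V, \<psi>)\<in>atlas M.
        smooth_on (model M) (\<phi> ` (U \<inter> V)) (\<psi> \<circ> inv_into U \<phi>))"

text \<open>Smooth maps defined on an open subset \<open>W\<close> of \<open>M\<close>; values outside \<open>W\<close> are irrelevant.\<close>

definition smooth_map_on ::
  "'a set \<Rightarrow> ('a, 'e::euclidean_space) mfd \<Rightarrow> ('b, 'f::euclidean_space) mfd \<Rightarrow> ('a \<Rightarrow> 'b) \<Rightarrow> bool"
where
  "smooth_map_on W M N F \<longleftrightarrow>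
     openin (mtop M) W \<and> continuous_map (subtopology (mtop M) W) (mtop N) F \<and>
     (\<forall>(U, \<phi>)\<in>atlas M. \<forall>(V, \<psi>)\<in>atlas N.
        smooth_on (model M) (\<phi> ` {p \<in> U \<inter> W. F p \<in> V}) (\<psi> \<circ> F \<circ> inv_into U \<phi>))"

abbreviation smooth_map ::
  "('a, 'e::euclidean_space) mfd \<Rightarrow> ('b, 'f::euclidean_space) mfd \<Rightarrow> ('a \<Rightarrow> 'b) \<Rightarrow> bool"
where "smooth_map M N F \<equiv> smooth_map_on (points M) M N F"

text \<open>Smoothness of a map on an embedded submanifold \<open>A\<close> of \<open>M\<close>.\<close>

definition smooth_map_on_subset ::
  "'a set \<Rightarrow> ('a, 'e::euclidean_space) mfd \<Rightarrow> ('b, 'f::euclidean_space) mfd \<Rightarrow> ('a \<Rightarrow> 'b) \<Rightarrow> bool"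
where
  "smooth_map_on_subset A M N F \<longleftrightarrow>
     (\<forall>p\<in>A. \<exists>W F'. p \<in> W \<and> smooth_map_on W M N F' \<and> (\<forall>q\<in>W \<inter> A. F' q = F q))"

definition real_mfd :: "(real, real) mfd"
  where "real_mfd = \<lparr>mtop = euclidean, model = UNIV, atlas = {(UNIV, id)}\<rparr>"

definition prod_mfd ::
  "('a, 'e::euclidean_space) mfd \<Rightarrow> ('b, 'f::euclidean_space) mfd \<Rightarrow> ('a \<times> 'b, 'e \<times> 'f) mfd"
  (infixr \<open>\<times>\<^sub>m\<close> 70)
where
  "M \<times>\<^sub>m N = \<lparr>mtop = prod_topology (mtop M) (mtop N), model = model M \<times> model N,
     atlas = {(U \<times> V, map_prod \<phi> \<psi>) | U \<phi> V \<psi>. (U, \<phi>) \<in> atlas M \<and> (V, \<psi>) \<in> atlas N}\<rparr>"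

definition Cinf :: "('a, 'e::euclidean_space) mfd \<Rightarrow> ('a \<Rightarrow> real) set"
  where "Cinf M = {f. smooth_map M real_mfd f}"

subsection \<open>Tangent vectors and covectors\<close>

definition curves_at :: "('a, 'e::euclidean_space) mfd \<Rightarrow> 'a \<Rightarrow> (real \<Rightarrow> 'a) set" where
  "curves_at M p = {\<gamma>. \<gamma> 0 = p \<and> (\<exists>\<epsilon>>0. smooth_map_on {-\<epsilon><..<\<epsilon>} real_mfd M \<gamma>)}"

text \<open>The velocity of a curve at time \<open>0\<close>, as an operator on smooth functions.\<close>

definition velocity :: "('a, 'e::euclidean_space) mfd \<Rightarrow> (real \<Rightarrow> 'a) \<Rightarrow> ('a \<Rightarrow> real) \<Rightarrow> real"
  where "velocity M \<gamma> = (\<lambda>f\<in>Cinf M. deriv (\<lambda>t. f (\<gamma> t)) 0)"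

definition tangent_space :: "('a, 'e::euclidean_space) mfd \<Rightarrow> 'a \<Rightarrow> (('a \<Rightarrow> real) \<Rightarrow> real) set"
  where "tangent_space M p = velocity M ` curves_at M p"

definition tangent_map ::
  "('b, 'f::euclidean_space) mfd \<Rightarrow> ('a \<Rightarrow> 'b) \<Rightarrow> (('a \<Rightarrow> real) \<Rightarrow> real) \<Rightarrow> (('b \<Rightarrow> real) \<Rightarrow> real)"
  where "tangent_map N F v = (\<lambda>f\<in>Cinf N. v (f \<circ> F))"

text \<open>
  Covectors at \<open>p\<close> are represented by smooth functions: \<open>f\<close> stands for the differential \<open>df\<close> at \<open>p\<close>
  (on a manifold every covector arises in this way).  Two functions represent the same covector iff
  they are related by \<open>same_covector\<close>.  The pullback of \<open>df\<close> along \<open>F\<close> is represented by \<open>f \<circ> F\<close>, and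
  the two components of a covector \<open>dF\<close> of a product at \<open>(p, q)\<close> by \<open>F(\<cdot>, q)\<close> and \<open>F(p, \<cdot>)\<close>.
\<close>

definition same_covector :: "('a, 'e::euclidean_space) mfd \<Rightarrow> 'a \<Rightarrow> ('a \<Rightarrow> real) \<Rightarrow> ('a \<Rightarrow> real) \<Rightarrow> bool"
  where "same_covector M p f g \<longleftrightarrow> (\<forall>v\<in>tangent_space M p. v f = v g)"

text \<open>Conormal covectors at \<open>p\<close> of an embedded submanifold \<open>A\<close>, whose tangent vectors are the
  velocities of the curves that run in \<open>A\<close>.\<close>

definition conormal :: "('a, 'e::euclidean_space) mfd \<Rightarrow> 'a set \<Rightarrow> 'a \<Rightarrow> ('a \<Rightarrow> real) set" where
  "conormal M A p = {f \<in> Cinf M. \<forall>\<gamma>\<in>curves_at M p. (\<forall>\<^sub>F t in nhds 0. \<gamma> t \<in> A) \<longrightarrow> velocity M \<gamma> f = 0}"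

subsection \<open>Multivector fields\<close>

text \<open>
  A \<open>k\<close>-vector field assigns to each point an alternating \<open>k\<close>-linear form on covectors; it is given by
  its values on lists of \<open>k\<close> differentials, so \<open>P [f, h] p\<close> is \<open>P(df, dh)\<close> at \<open>p\<close>.
\<close>

type_synonym 'a mv = "('a \<Rightarrow> real) list \<Rightarrow> 'a \<Rightarrow> real"

definition multivector_field :: "nat \<Rightarrow> ('a, 'e::euclidean_space) mfd \<Rightarrow> 'a mv \<Rightarrow> bool" where
  "multivector_field k M P \<longleftrightarrow>
     (\<forall>fs. length fs = k \<and> set fs \<subseteq> Cinf M \<longrightarrow> P fs \<in> Cinf M) \<and>
     (\<forall>fs hs. \<forall>p\<in>points M. length fs = k \<and> length hs = k \<and> set fs \<subseteq> Cinf M \<and> set hs \<subseteq> Cinf M \<and>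
        (\<forall>i<k. same_covector M p (fs ! i) (hs ! i)) \<longrightarrow> P fs p = P hs p) \<and>
     (\<forall>fs f h a b. \<forall>i<k. \<forall>p\<in>points M. length fs = k \<and> set fs \<subseteq> Cinf M \<and> f \<in> Cinf M \<and> h \<in> Cinf M \<longrightarrow>
        P (fs[i := (\<lambda>q. a * f q + b * h q)]) p = a * P (fs[i := f]) p + b * P (fs[i := h]) p) \<and>
     (\<forall>fs i j. \<forall>p\<in>points M. length fs = k \<and> set fs \<subseteq> Cinf M \<and> i < j \<and> j < k \<and> fs ! i = fs ! j \<longrightarrow>
        P fs p = 0)"

abbreviation bivector_field :: "('a, 'e::euclidean_space) mfd \<Rightarrow> 'a mv \<Rightarrow> bool"
  where "bivector_field \<equiv> multivector_field 2"

text \<open>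
  The wedge product of vector fields, normalised by \<open>(X \<and> Y)(f, h) = X f * Y h - X h * Y f\<close>.
  (The type allows fields along a map, used for sections of a Lie algebroid below.)
\<close>

definition wedge :: "(('a \<Rightarrow> real) list \<Rightarrow> 'b \<Rightarrow> real) list \<Rightarrow> ('a \<Rightarrow> real) list \<Rightarrow> 'b \<Rightarrow> real" where
  "wedge Xs fs p =
     (\<Sum>\<pi> | \<pi> permutes {..<length Xs}. of_int (sign \<pi>) * (\<Prod>i<length Xs. (Xs ! i) [fs ! \<pi> i] p))"

text \<open>
  The Schouten bracket of a \<open>p\<close>-vector field and a \<open>q\<close>-vector field.  The sum in \<open>insertion\<close> runs over
  \<open>(q, p - 1)\<close>-shuffles; \<open>I\<close> is the set of positions handed to \<open>Q\<close>, and the power of \<open>-1\<close> is the sign of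
  the shuffle.  The signs are those determined by \<open>[X, f] = X f\<close>,
  \<open>[P, Q] = -(-1)\<^bsup>(p-1)(q-1)\<^esup> [Q, P]\<close> and
  \<open>[P, Q \<and> R] = [P, Q] \<and> R + (-1)\<^bsup>(p-1)q\<^esup> Q \<and> [P, R]\<close>; the exponent \<open>(p + 1) * (q + 1)\<close> has the
  parity of \<open>(p - 1)(q - 1)\<close>.
\<close>

definition insertion :: "nat \<Rightarrow> nat \<Rightarrow> 'a mv \<Rightarrow> 'a mv \<Rightarrow> 'a mv" where
  "insertion p q P Q fs x =
     (\<Sum>I | I \<subseteq> {..<p + q - 1} \<and> card I = q.
        (-1) ^ (\<Sum>I + q * (q - 1) div 2) * P (Q (nths fs I) # nths fs (- I)) x)"

definition schouten :: "nat \<Rightarrow> nat \<Rightarrow> 'a mv \<Rightarrow> 'a mv \<Rightarrow> 'a mv" where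
  "schouten p q P Q fs x =
     (-1) ^ ((p + 1) * (q + 1)) * insertion p q P Q fs x - insertion q p Q P fs x"

definition direct_sum :: "'a mv \<Rightarrow> 'b mv \<Rightarrow> ('a \<times> 'b) mv" (infixr \<open>\<oplus>\<^sub>m\<close> 65) where
  "(P \<oplus>\<^sub>m Q) Fs = (\<lambda>(p, q). P (map (\<lambda>F p'. F (p', q)) Fs) p + Q (map (\<lambda>F q'. F (p, q')) Fs) q)"

text \<open>\<open>F\<^sub>* P = Q\<close> for bivector fields on \<open>M\<close> and \<open>N\<close>.\<close>

definition pushes_to ::
  "('a, 'e::euclidean_space) mfd \<Rightarrow> ('b, 'f::euclidean_space) mfd \<Rightarrow> ('a \<Rightarrow> 'b) \<Rightarrow> 'a mv \<Rightarrow> 'b mv \<Rightarrow> bool"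
where
  "pushes_to M N F P Q \<longleftrightarrow>
     (\<forall>p\<in>points M. \<forall>f\<in>Cinf N. \<forall>h\<in>Cinf N. P [f \<circ> F, h \<circ> F] p = Q [f, h] (F p))"

definition coisotropic :: "('a, 'e::euclidean_space) mfd \<Rightarrow> 'a mv \<Rightarrow> 'a set \<Rightarrow> bool" where
  "coisotropic M P A \<longleftrightarrow> (\<forall>p\<in>A. \<forall>f\<in>conormal M A p. \<forall>h\<in>conormal M A p. P [f, h] p = 0)"

section \<open>Lie groups\<close>

definition lie_group :: "'d monoid \<Rightarrow> ('d, 'e::euclidean_space) mfd \<Rightarrow> bool" where
  "lie_group K M \<longleftrightarrow>
     group K \<and> manifold M \<and> points M = carrier K \<and>
     smooth_map (M \<times>\<^sub>m M) M (\<lambda>(a, b). a \<otimes>\<^bsub>K\<^esub> b) \<and> smooth_map M M (m_inv K)"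

text \<open>The infinitesimal generator \<open>d/dt exp(t v) \<cdot> x\<close> at \<open>t = 0\<close> of a left action, as a vector field.
  With left multiplication as the action this is the right-invariant vector field of \<open>v\<close>.\<close>

definition generator :: "('v::real_vector \<Rightarrow> 'd) \<Rightarrow> ('d \<Rightarrow> 'x \<Rightarrow> 'x) \<Rightarrow> 'v \<Rightarrow> 'x mv" where
  "generator ex act v fs x = deriv (\<lambda>t. (fs ! 0) (act (ex (t *\<^sub>R v)) x)) 0"

abbreviation right_inv :: "'d monoid \<Rightarrow> ('v::real_vector \<Rightarrow> 'd) \<Rightarrow> 'v \<Rightarrow> 'd mv"
  where "right_inv K ex v \<equiv> generator ex (mult K) v"

text \<open>
  \<open>L\<close> with bracket \<open>br\<close> is the Lie algebra of the Lie group \<open>K\<close> with exponential map \<open>ex\<close>: the curves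
  \<open>ex (t v)\<close> are smooth one-parameter subgroups, and their velocities identify \<open>L\<close> linearly with
  the tangent space at the unit, the bracket being that of right-invariant vector fields.
\<close>

definition has_lie_algebra ::
  "'d monoid \<Rightarrow> ('d, 'e::euclidean_space) mfd \<Rightarrow> 'v::real_vector set \<Rightarrow> ('v \<Rightarrow> 'v \<Rightarrow> 'v) \<Rightarrow> ('v \<Rightarrow> 'd) \<Rightarrow> bool"
where
  "has_lie_algebra K M L br ex \<longleftrightarrow>
     subspace L \<and>
     (\<forall>v\<in>L. smooth_map real_mfd M (\<lambda>t. ex (t *\<^sub>R v)) \<and>
        (\<forall>s t. ex ((s + t) *\<^sub>R v) = ex (s *\<^sub>R v) \<otimes>\<^bsub>K\<^esub> ex (t *\<^sub>R v))) \<and>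
     bij_betw (\<lambda>v. velocity M (\<lambda>t. ex (t *\<^sub>R v))) L (tangent_space M \<one>\<^bsub>K\<^esub>) \<and>
     (\<forall>v\<in>L. \<forall>w\<in>L. \<forall>a b. \<forall>f\<in>Cinf M.
        velocity M (\<lambda>t. ex (t *\<^sub>R (a *\<^sub>R v + b *\<^sub>R w))) f =
          a * velocity M (\<lambda>t. ex (t *\<^sub>R v)) f + b * velocity M (\<lambda>t. ex (t *\<^sub>R w)) f) \<and>
     (\<forall>v\<in>L. \<forall>w\<in>L. br v w \<in> L \<and>
        (\<forall>f\<in>Cinf M. \<forall>a\<in>carrier K.
           schouten 1 1 (right_inv K ex v) (right_inv K ex w) [f] a = right_inv K ex (br v w) [f] a))"

definition simply_connected_space :: "'a topology \<Rightarrow> bool" where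
  "simply_connected_space T \<longleftrightarrow>
     (\<forall>p q. pathin T p \<and> p 1 = p 0 \<and> pathin T q \<and> q 1 = q 0 \<longrightarrow>
        homotopic_with (\<lambda>r. r 1 = r 0) (top_of_set {0..1}) T p q)"

definition embedded_submanifold ::
  "('a, 'e::euclidean_space) mfd \<Rightarrow> ('a, 'f::euclidean_space) mfd \<Rightarrow> bool"
where
  "embedded_submanifold N M \<longleftrightarrow>
     manifold N \<and> points N \<subseteq> points M \<and> mtop N = subtopology (mtop M) (points N) \<and>
     smooth_map N M (\<lambda>p. p) \<and>
     (\<forall>p\<in>points N. inj_on (tangent_map M (\<lambda>p. p)) (tangent_space N p))"

definition submersion ::
  "('a, 'e::euclidean_space) mfd \<Rightarrow> ('b, 'f::euclidean_space) mfd \<Rightarrow> ('a \<Rightarrow> 'b) \<Rightarrow> bool"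
where
  "submersion M N F \<longleftrightarrow> smooth_map M N F \<and>
     (\<forall>p\<in>points M. tangent_map N F ` tangent_space M p = tangent_space N (F p))"

definition smooth_action ::
  "'d monoid \<Rightarrow> ('d, 'e::euclidean_space) mfd \<Rightarrow> ('x, 'f::euclidean_space) mfd \<Rightarrow> ('d \<Rightarrow> 'x \<Rightarrow> 'x) \<Rightarrow> bool"
where
  "smooth_action K M X act \<longleftrightarrow>
     smooth_map (M \<times>\<^sub>m X) X (\<lambda>(g, x). act g x) \<and>
     (\<forall>x\<in>points X. act \<one>\<^bsub>K\<^esub> x = x) \<and>
     (\<forall>g\<in>carrier K. \<forall>h\<in>carrier K. \<forall>x\<in>points X. act (g \<otimes>\<^bsub>K\<^esub> h) x = act g (act h x))"

section \<open>Manin quasi-triples and group pairs\<close>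

text \<open>
  The Lie algebra \<open>\<dd>\<close> is the whole type \<open>'v\<close>.  \<open>basis_g i\<close> and \<open>basis_h i\<close> (\<open>i < gdim\<close>) are \<open>e\<^sub>i\<close> and
  \<open>\<epsilon>\<^sup>i\<close>; \<open>c_coeff i j k\<close>, \<open>F_coeff i j k\<close>, \<open>Om_coeff i j k\<close> are \<open>c\<^sub>i\<^sub>j\<^sup>k\<close>, \<open>F\<^sub>i\<^sup>j\<^sup>k\<close>, \<open>\<Omega>\<^sup>i\<^sup>j\<^sup>k\<close>. The manifolds are \<open>D\<close>, its subgroup \<open>G\<close>
  and the set \<open>S = D/G\<close> of left cosets; \<open>expo\<close> is the exponential map of \<open>D\<close>, which restricts to that
  of \<open>G\<close>.
\<close>

record ('v, 'd, 'ed, 'eg, 'es) group_pair =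
  bracket :: "'v \<Rightarrow> 'v \<Rightarrow> 'v"
  form :: "'v \<Rightarrow> 'v \<Rightarrow> real"
  gsub :: "'v set"
  hsub :: "'v set"
  gdim :: nat
  basis_g :: "nat \<Rightarrow> 'v"
  basis_h :: "nat \<Rightarrow> 'v"
  c_coeff :: "nat \<Rightarrow> nat \<Rightarrow> nat \<Rightarrow> real"
  F_coeff :: "nat \<Rightarrow> nat \<Rightarrow> nat \<Rightarrow> real"
  Om_coeff :: "nat \<Rightarrow> nat \<Rightarrow> nat \<Rightarrow> real"
  Dgrp :: "'d monoid"
  Dmfd :: "('d, 'ed) mfd"
  Gmfd :: "('d, 'eg) mfd"
  Smfd :: "('d set, 'es) mfd"
  expo :: "'v \<Rightarrow> 'd"
  PiG :: "'d mv"

definition lie_algebra :: "('v::real_vector \<Rightarrow> 'v \<Rightarrow> 'v) \<Rightarrow> bool" where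
  "lie_algebra br \<longleftrightarrow>
     bilinear br \<and> (\<forall>u. br u u = 0) \<and>
     (\<forall>u v w. br u (br v w) + br v (br w u) + br w (br u v) = 0)"

definition isotropic :: "('v::real_vector \<Rightarrow> 'v \<Rightarrow> real) \<Rightarrow> 'v set \<Rightarrow> bool"
  where "isotropic B W \<longleftrightarrow> (\<forall>u\<in>W. \<forall>v\<in>W. B u v = 0)"

definition manin_quasi_triple ::
  "('v::real_vector \<Rightarrow> 'v \<Rightarrow> 'v) \<Rightarrow> ('v \<Rightarrow> 'v \<Rightarrow> real) \<Rightarrow> 'v set \<Rightarrow> 'v set \<Rightarrow> bool"
where
  "manin_quasi_triple br B g h \<longleftrightarrow>
     (\<exists>b :: 'v set. finite b \<and> span b = UNIV) \<and> even (dim (UNIV :: 'v set)) \<and>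
     lie_algebra br \<and>
     bilinear B \<and> (\<forall>u v. B u v = B v u) \<and> (\<forall>u. (\<forall>v. B u v = 0) \<longrightarrow> u = 0) \<and>
     (\<forall>u v w. B (br u v) w + B v (br u w) = 0) \<and>
     subspace g \<and> (\<forall>u\<in>g. \<forall>v\<in>g. br u v \<in> g) \<and> isotropic B g \<and>
     (\<forall>W. subspace W \<and> isotropic B W \<and> g \<subseteq> W \<longrightarrow> W = g) \<and>
     subspace h \<and> isotropic B h \<and> g \<inter> h = {0} \<and> (\<forall>u. \<exists>v\<in>g. \<exists>w\<in>h. u = v + w)"

text \<open>\<open>\<hh>\<close> is identified with \<open>\<gg>\<^sup>*\<close> by the bilinear form, so \<open>basis_h\<close> is the dual basis of \<open>basis_g\<close>.\<close>

definition quasi_lie_bialgebra_data :: "('v::real_vector, 'd, 'ed, 'eg, 'es) group_pair \<Rightarrow> bool" where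
  "quasi_lie_bialgebra_data Q \<longleftrightarrow>
     (let n = gdim Q; e = basis_g Q; \<epsilon> = basis_h Q; br = bracket Q in
      inj_on e {..<n} \<and> independent (e ` {..<n}) \<and> span (e ` {..<n}) = gsub Q \<and>
      (\<forall>i<n. \<epsilon> i \<in> hsub Q) \<and>
      (\<forall>i<n. \<forall>j<n. form Q (\<epsilon> i) (e j) = (if i = j then 1 else 0)) \<and>
      (\<forall>i<n. \<forall>j<n. br (e i) (e j) = (\<Sum>k<n. c_coeff Q i j k *\<^sub>R e k)) \<and>
      (\<forall>i<n. \<forall>j<n. br (e i) (\<epsilon> j) = (\<Sum>k<n. - c_coeff Q i k j *\<^sub>R \<epsilon> k + F_coeff Q i j k *\<^sub>R e k)) \<and>
      (\<forall>i<n. \<forall>j<n. br (\<epsilon> i) (\<epsilon> j) = (\<Sum>k<n. F_coeff Q k i j *\<^sub>R \<epsilon> k + Om_coeff Q i j k *\<^sub>R e k)))"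

definition Ggrp :: "('v, 'd, 'ed, 'eg, 'es) group_pair \<Rightarrow> 'd monoid"
  where "Ggrp Q = (Dgrp Q)\<lparr>carrier := points (Gmfd Q)\<rparr>"

text \<open>The action of \<open>D\<close> on \<open>S = D/G\<close> by left multiplication; restricted to \<open>G\<close>, the dressing action.\<close>

definition act_S :: "('v, 'd, 'ed, 'eg, 'es) group_pair \<Rightarrow> 'd \<Rightarrow> 'd set \<Rightarrow> 'd set"
  where "act_S Q a s = a <#\<^bsub>Dgrp Q\<^esub> s"

definition coset_proj :: "('v, 'd, 'ed, 'eg, 'es) group_pair \<Rightarrow> 'd \<Rightarrow> 'd set"
  where "coset_proj Q a = a <#\<^bsub>Dgrp Q\<^esub> points (Gmfd Q)"

text \<open>The smooth structure of \<open>D/G\<close> is the one for which the projection from \<open>D\<close> is a submersion.\<close>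

definition is_group_pair ::
  "('v::real_vector, 'd, 'ed::euclidean_space, 'eg::euclidean_space, 'es::euclidean_space) group_pair \<Rightarrow> bool"
where
  "is_group_pair Q \<longleftrightarrow>
     lie_group (Dgrp Q) (Dmfd Q) \<and>
     has_lie_algebra (Dgrp Q) (Dmfd Q) UNIV (bracket Q) (expo Q) \<and>
     connected_space (mtop (Dmfd Q)) \<and> simply_connected_space (mtop (Dmfd Q)) \<and>
     subgroup (points (Gmfd Q)) (Dgrp Q) \<and> closedin (mtop (Dmfd Q)) (points (Gmfd Q)) \<and>
     embedded_submanifold (Gmfd Q) (Dmfd Q) \<and>
     lie_group (Ggrp Q) (Gmfd Q) \<and>
     has_lie_algebra (Ggrp Q) (Gmfd Q) (gsub Q) (bracket Q) (expo Q) \<and>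
     connected_space (mtop (Gmfd Q)) \<and> simply_connected_space (mtop (Gmfd Q)) \<and>
     manifold (Smfd Q) \<and> points (Smfd Q) = coset_proj Q ` carrier (Dgrp Q) \<and>
     submersion (Dmfd Q) (Smfd Q) (coset_proj Q)"

text \<open>The extensions to \<open>\<and>\<^sup>2\<gg>\<close> and \<open>\<and>\<^sup>3\<gg>\<close> of a linear map sending \<open>e\<^sub>i\<close> to the vector field \<open>V i\<close>.\<close>

definition ext2 :: "nat \<Rightarrow> (nat \<Rightarrow> nat \<Rightarrow> real) \<Rightarrow> (nat \<Rightarrow> ('a \<Rightarrow> real) list \<Rightarrow> 'b \<Rightarrow> real) \<Rightarrow>
    ('a \<Rightarrow> real) list \<Rightarrow> 'b \<Rightarrow> real" where
  "ext2 n a V fs x = 1/2 * (\<Sum>j<n. \<Sum>k<n. a j k * wedge [V j, V k] fs x)"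

definition ext3 :: "nat \<Rightarrow> (nat \<Rightarrow> nat \<Rightarrow> nat \<Rightarrow> real) \<Rightarrow> (nat \<Rightarrow> ('a \<Rightarrow> real) list \<Rightarrow> 'b \<Rightarrow> real) \<Rightarrow>
    ('a \<Rightarrow> real) list \<Rightarrow> 'b \<Rightarrow> real" where
  "ext3 n a V fs x = 1/6 * (\<Sum>i<n. \<Sum>j<n. \<Sum>k<n. a i j k * wedge [V i, V j, V k] fs x)"

text \<open>\<open>F(\<xi>)\<close> has coefficients \<open>\<Sum>\<^sub>i \<xi>\<^sup>i F\<^sub>i\<^sup>j\<^sup>k\<close> with \<open>\<xi>\<^sup>i = \<langle>\<epsilon>\<^sup>i, \<xi>\<rangle>\<close>.\<close>

definition is_PiG ::
  "('v::real_vector, 'd, 'ed::euclidean_space, 'eg::euclidean_space, 'es::euclidean_space) group_pair \<Rightarrow> bool"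
where
  "is_PiG Q \<longleftrightarrow>
     bivector_field (Gmfd Q) (PiG Q) \<and>
     pushes_to (Gmfd Q \<times>\<^sub>m Gmfd Q) (Gmfd Q) (\<lambda>(a, b). a \<otimes>\<^bsub>Dgrp Q\<^esub> b) (PiG Q \<oplus>\<^sub>m PiG Q) (PiG Q) \<and>
     (\<forall>\<xi>\<in>gsub Q. \<forall>f1\<in>Cinf (Gmfd Q). \<forall>f2\<in>Cinf (Gmfd Q). \<forall>a\<in>points (Gmfd Q).
        schouten 1 2 (right_inv (Ggrp Q) (expo Q) \<xi>) (PiG Q) [f1, f2] a =
        ext2 (gdim Q) (\<lambda>j k. \<Sum>i<gdim Q. form Q (basis_h Q i) \<xi> * F_coeff Q i j k)
          (\<lambda>i. right_inv (Ggrp Q) (expo Q) (basis_g Q i)) [f1, f2] a)"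

definition PiS :: "('v::real_vector, 'd, 'ed, 'eg, 'es) group_pair \<Rightarrow> 'd set mv" where
  "PiS Q fs s = - (\<Sum>i<gdim Q. generator (expo Q) (act_S Q) (basis_h Q i) [fs ! 0] s *
                               generator (expo Q) (act_S Q) (basis_g Q i) [fs ! 1] s)"

text \<open>\<open>lambda_S Q s a\<close> is \<open>\<lambda>(\<theta>\<^sub>s)\<close> for the covector \<open>\<theta>\<^sub>s\<close> represented by \<open>a\<close>.\<close>

definition lambda_S :: "('v::real_vector, 'd, 'ed, 'eg, 'es) group_pair \<Rightarrow> 'd set \<Rightarrow> ('d set \<Rightarrow> real) \<Rightarrow> 'v" where
  "lambda_S Q s a =
     (THE \<xi>. \<xi> \<in> gsub Q \<and> (\<forall>\<eta>\<in>hsub Q. form Q \<xi> \<eta> = generator (expo Q) (act_S Q) \<eta> [a] s))"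

text \<open>\<open>left_pullback Q g f\<close> is \<open>L\<^sub>g\<^sup>* \<theta>\<^sub>g\<close>, as an element of \<open>\<hh> = \<gg>\<^sup>*\<close>, for the covector \<open>\<theta>\<^sub>g\<close> represented by \<open>f\<close>.\<close>

definition left_pullback :: "('v::real_vector, 'd, 'ed, 'eg, 'es) group_pair \<Rightarrow> 'd \<Rightarrow> ('d \<Rightarrow> real) \<Rightarrow> 'v" where
  "left_pullback Q g f =
     (THE \<eta>. \<eta> \<in> hsub Q \<and>
        (\<forall>\<xi>\<in>gsub Q. form Q \<eta> \<xi> = deriv (\<lambda>t. f (g \<otimes>\<^bsub>Dgrp Q\<^esub> expo Q (t *\<^sub>R \<xi>))) 0))"

section \<open>Quasi-hamiltonian spaces\<close>

definition quasi_poisson_action ::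
  "('v::real_vector, 'd, 'ed::euclidean_space, 'eg::euclidean_space, 'es::euclidean_space) group_pair \<Rightarrow>
   ('x, 'ex::euclidean_space) mfd \<Rightarrow> 'x mv \<Rightarrow> ('d \<Rightarrow> 'x \<Rightarrow> 'x) \<Rightarrow> bool"
where
  "quasi_poisson_action Q X PiX \<Phi> \<longleftrightarrow>
     smooth_action (Ggrp Q) (Gmfd Q) X \<Phi> \<and>
     pushes_to (Gmfd Q \<times>\<^sub>m X) X (\<lambda>(g, x). \<Phi> g x) (PiG Q \<oplus>\<^sub>m PiX) PiX \<and>
     (\<forall>f1\<in>Cinf X. \<forall>f2\<in>Cinf X. \<forall>f3\<in>Cinf X. \<forall>x\<in>points X.
        1/2 * schouten 2 2 PiX PiX [f1, f2, f3] x =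
        ext3 (gdim Q) (Om_coeff Q) (\<lambda>i. generator (expo Q) \<Phi> (basis_g Q i)) [f1, f2, f3] x)"

definition quasi_hamiltonian_space ::
  "('v::real_vector, 'd, 'ed::euclidean_space, 'eg::euclidean_space, 'es::euclidean_space) group_pair \<Rightarrow>
   ('x, 'ex::euclidean_space) mfd \<Rightarrow> 'x mv \<Rightarrow> ('d \<Rightarrow> 'x \<Rightarrow> 'x) \<Rightarrow> ('x \<Rightarrow> 'd set) \<Rightarrow> bool"
where
  "quasi_hamiltonian_space Q X PiX \<Phi> J \<longleftrightarrow>
     manifold X \<and> bivector_field X PiX \<and> quasi_poisson_action Q X PiX \<Phi> \<and>
     smooth_map X (Smfd Q) J \<and>
     (\<forall>g\<in>points (Gmfd Q). \<forall>x\<in>points X. J (\<Phi> g x) = act_S Q g (J x)) \<and>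
     (\<forall>x\<in>points X. \<forall>a\<in>Cinf (Smfd Q). \<forall>f\<in>Cinf X.
        PiX [a \<circ> J, f] x = - generator (expo Q) \<Phi> (lambda_S Q (J x) a) [f] x)"

section \<open>Quasi-Poisson groupoids and Hamiltonian spaces\<close>

text \<open>
  The Lie algebroid at \<open>m\<close> is the tangent space at the unit of \<open>m\<close> of the fibre of \<open>tgt\<close> over \<open>m\<close>.
  Accordingly a section of one of its exterior powers is evaluated on functions on the arrows
  (only their restriction to that fibre being relevant) and a point of the base.
\<close>

record ('c, 'm, 'ec, 'em) qp_groupoid =
  arrows :: "('c, 'ec) mfd"
  base :: "('m, 'em) mfd"
  src :: "'c \<Rightarrow> 'm"
  tgt :: "'c \<Rightarrow> 'm"
  gcomp :: "'c \<Rightarrow> 'c \<Rightarrow> 'c"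
  idn :: "'m \<Rightarrow> 'c"
  biv :: "'c mv"
  Om3 :: "('c \<Rightarrow> real) list \<Rightarrow> 'm \<Rightarrow> real"

definition groupoid_space ::
  "('c, 'm, 'ec::euclidean_space, 'em::euclidean_space) qp_groupoid \<Rightarrow>
   ('x, 'ex::euclidean_space) mfd \<Rightarrow> ('c \<Rightarrow> 'x \<Rightarrow> 'x) \<Rightarrow> ('x \<Rightarrow> 'm) \<Rightarrow> bool"
where
  "groupoid_space \<Gamma> X act J \<longleftrightarrow>
     manifold X \<and> smooth_map X (base \<Gamma>) J \<and>
     smooth_map_on_subset {(c, x). c \<in> points (arrows \<Gamma>) \<and> x \<in> points X \<and> tgt \<Gamma> c = J x}
       (arrows \<Gamma> \<times>\<^sub>m X) X (\<lambda>(c, x). act c x) \<and>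
     (\<forall>c\<in>points (arrows \<Gamma>). \<forall>x\<in>points X. tgt \<Gamma> c = J x \<longrightarrow> J (act c x) = src \<Gamma> c) \<and>
     (\<forall>b\<in>points (arrows \<Gamma>). \<forall>c\<in>points (arrows \<Gamma>). \<forall>x\<in>points X.
        tgt \<Gamma> b = src \<Gamma> c \<and> tgt \<Gamma> c = J x \<longrightarrow> act (gcomp \<Gamma> b c) x = act b (act c x)) \<and>
     (\<forall>x\<in>points X. act (idn \<Gamma> (J x)) x = x)"

definition action_graph ::
  "('c, 'm, 'ec, 'em) qp_groupoid \<Rightarrow> ('x, 'ex) mfd \<Rightarrow> ('c \<Rightarrow> 'x \<Rightarrow> 'x) \<Rightarrow> ('x \<Rightarrow> 'm) \<Rightarrow> ('c \<times> 'x \<times> 'x) set"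
where
  "action_graph \<Gamma> X act J =
     {(c, x, act c x) | c x. c \<in> points (arrows \<Gamma>) \<and> x \<in> points X \<and> tgt \<Gamma> c = J x}"

text \<open>The map from sections of exterior powers of the Lie algebroid to multivector fields on \<open>X\<close>:
  at \<open>x\<close>, push forward along \<open>c \<mapsto> c \<cdot> x\<close>, defined on the fibre of \<open>tgt\<close> over \<open>J x\<close>.\<close>

definition hat :: "('c \<Rightarrow> 'x \<Rightarrow> 'x) \<Rightarrow> ('x \<Rightarrow> 'm) \<Rightarrow> (('c \<Rightarrow> real) list \<Rightarrow> 'm \<Rightarrow> real) \<Rightarrow> 'x mv"
  where "hat act J A fs x = A (map (\<lambda>f c. f (act c x)) fs) (J x)"

definition hamiltonian_groupoid_space ::
  "('c, 'm, 'ec::euclidean_space, 'em::euclidean_space) qp_groupoid \<Rightarrow>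
   ('x, 'ex::euclidean_space) mfd \<Rightarrow> 'x mv \<Rightarrow> ('c \<Rightarrow> 'x \<Rightarrow> 'x) \<Rightarrow> ('x \<Rightarrow> 'm) \<Rightarrow> bool"
where
  "hamiltonian_groupoid_space \<Gamma> X PiX act J \<longleftrightarrow>
     groupoid_space \<Gamma> X act J \<and> bivector_field X PiX \<and>
     coisotropic (arrows \<Gamma> \<times>\<^sub>m X \<times>\<^sub>m X) (biv \<Gamma> \<oplus>\<^sub>m PiX \<oplus>\<^sub>m (\<lambda>fs x. - PiX fs x)) (action_graph \<Gamma> X act J) \<and>
     (\<forall>f1\<in>Cinf X. \<forall>f2\<in>Cinf X. \<forall>f3\<in>Cinf X. \<forall>x\<in>points X.
        1/2 * schouten 2 2 PiX PiX [f1, f2, f3] x = hat act J (Om3 \<Gamma>) [f1, f2, f3] x)"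

subsection \<open>The groupoid of a Manin quasi-triple\<close>

definition Pi_Gamma :: "('v::real_vector, 'd, 'ed, 'eg, 'es) group_pair \<Rightarrow> ('d \<times> 'd set) mv" where
  "Pi_Gamma Q fs = (\<lambda>(g, s).
     let \<theta>g = (\<lambda>g'. (fs ! 0) (g', s)); \<theta>s = (\<lambda>s'. (fs ! 0) (g, s'));
         \<theta>g' = (\<lambda>g'. (fs ! 1) (g', s)); \<theta>s' = (\<lambda>s'. (fs ! 1) (g, s'))
     in PiG Q [\<theta>g, \<theta>g'] g - PiS Q [\<theta>s, \<theta>s'] s
        + generator (expo Q) (act_S Q) (left_pullback Q g \<theta>g) [\<theta>s'] s
        - generator (expo Q) (act_S Q) (left_pullback Q g \<theta>g') [\<theta>s] s)"

text \<open>The section of the Lie algebroid \<open>\<gg> \<times> S\<close> given by a constant \<open>\<xi> \<in> \<gg>\<close>, whose value at \<open>s\<close> is the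
  velocity of \<open>(exp (t \<xi>), s)\<close>.\<close>

definition const_section :: "('v::real_vector, 'd, 'ed, 'eg, 'es) group_pair \<Rightarrow> 'v \<Rightarrow>
    ('d \<times> 'd set \<Rightarrow> real) list \<Rightarrow> 'd set \<Rightarrow> real" where
  "const_section Q \<xi> fs s = deriv (\<lambda>t. (fs ! 0) (expo Q (t *\<^sub>R \<xi>), s)) 0"

definition Gamma_groupoid ::
  "('v::real_vector, 'd, 'ed::euclidean_space, 'eg::euclidean_space, 'es::euclidean_space) group_pair \<Rightarrow>
   ('d \<times> 'd set, 'd set, 'eg \<times> 'es, 'es) qp_groupoid"
where
  "Gamma_groupoid Q =
     \<lparr>arrows = Gmfd Q \<times>\<^sub>m Smfd Q, base = Smfd Q,
      src = (\<lambda>(g, s). act_S Q g s), tgt = snd,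
      gcomp = (\<lambda>(g, s') (h, s). (g \<otimes>\<^bsub>Dgrp Q\<^esub> h, s)), idn = (\<lambda>s. (\<one>\<^bsub>Dgrp Q\<^esub>, s)),
      biv = Pi_Gamma Q, Om3 = ext3 (gdim Q) (Om_coeff Q) (\<lambda>i. const_section Q (basis_g Q i))\<rparr>"

section \<open>The Schouten bracket in the degrees used\<close>

lemma nths3:
  "nths [f1, f2, f3] {0, Suc 0} = [f1, f2]" "nths [f1, f2, f3] (- {0, Suc 0}) = [f3]"
  "nths [f1, f2, f3] {0, 2} = [f1, f3]" "nths [f1, f2, f3] (- {0, 2}) = [f2]"
  "nths [f1, f2, f3] {Suc 0, 2} = [f2, f3]" "nths [f1, f2, f3] (- {Suc 0, 2}) = [f1]"
  by (auto simp: nths_Cons)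

lemma subsets_card_3_2: "{I. I \<subseteq> {..<3::nat} \<and> card I = 2} = {{0, 1}, {0, 2}, {1, 2}}" (is "?L = ?R")
proof
  show "?R \<subseteq> ?L" by auto
  show "?L \<subseteq> ?R"
  proof
    fix I assume "I \<in> ?L"
    then obtain a b where "I = {a, b}" "a \<noteq> b" "a < 3" "b < 3" by (auto simp: card_2_iff)
    then have "a \<in> {0, 1, 2}" "b \<in> {0, 1, 2}" by auto
    with \<open>I = {a, b}\<close> \<open>a \<noteq> b\<close> show "I \<in> ?R" by (auto simp: doubleton_eq_iff)
  qed
qed

lemma schouten_1_0: "schouten 1 0 X (\<lambda>_. f) [] x = X [f] x"
  by (simp add: schouten_def insertion_def conj_commute cong: conj_cong)

lemma subsets_card_1: "{I. I \<subseteq> {..<n::nat} \<and> card I = Suc 0} = (\<lambda>i. {i}) ` {..<n}"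
  by (auto simp: card_1_singleton_iff)

lemma subsets_card_full: "{I. I \<subseteq> {..<n::nat} \<and> card I = n} = {{..<n}}"
  by (auto dest: card_subset_eq[OF finite_lessThan])

lemma schouten_1_1: "schouten 1 1 X Y [f] x = X [Y [f]] x - Y [X [f]] x"
  using subsets_card_full[of 1] by (simp add: schouten_def insertion_def nths_Cons)

lemma schouten_1_2:
  "schouten 1 2 X P [f1, f2] x = X [P [f1, f2]] x - (P [X [f1], f2] x - P [X [f2], f1] x)"
proof -
  have "insertion 1 2 X P [f1, f2] x = X [P [f1, f2]] x"
    unfolding insertion_def using subsets_card_full[of 2]
    by (simp add: nths_Cons lessThan_Suc numeral_2_eq_2)
  moreover have "insertion 2 1 P X [f1, f2] x = P [X [f1], f2] x - P [X [f2], f1] x"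
    unfolding insertion_def using subsets_card_1[of 2]
    by (simp add: nths_Cons lessThan_Suc numeral_2_eq_2)
  ultimately show ?thesis by (simp add: schouten_def)
qed

lemma schouten_2_2:
  "schouten 2 2 P P [f1, f2, f3] x =
     - 2 * (P [P [f1, f2], f3] x - P [P [f1, f3], f2] x + P [P [f2, f3], f1] x)"
proof -
  have "insertion 2 2 P P [f1, f2, f3] x =
      P [P [f1, f2], f3] x - P [P [f1, f3], f2] x + P [P [f2, f3], f1] x"
    unfolding insertion_def using subsets_card_3_2 by (simp add: nths3 doubleton_eq_iff)
  then show ?thesis by (simp add: schouten_def)
qed

end

theory Submission
  imports Defs
begin

text \<open>
  A conormal covector of the graph of \<open>\<Gamma> \<times> X \<rightarrow> X\<close> at \<open>((g, J x), x, \<Phi>(g, x))\<close> has four components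
  \<open>(\<theta>\<^sub>g, \<theta>\<^sub>s, \<sigma>, \<tau>)\<close>.  As \<open>(g, x)\<close> parametrises the graph, \<open>\<theta>\<^sub>s\<close> and \<open>\<tau>\<close> are arbitrary and they
  determine the other two: \<open>\<theta>\<^sub>g = - \<Phi>\<^sub>x\<^sup>* \<tau>\<close> and \<open>\<sigma> = - J\<^sup>* \<theta>\<^sub>s - \<Phi>\<^sub>g\<^sup>* \<tau>\<close>, where \<open>\<Phi>\<^sub>x\<close> is the orbit map
  of \<open>x\<close> and \<open>\<Phi>\<^sub>g\<close> the diffeomorphism given by \<open>g\<close>.  Inserting two such covectors into
  \<open>\<Pi> \<oplus> \<Pi>\<^sub>X \<oplus> (- \<Pi>\<^sub>X)\<close> and expanding bilinearly, the terms fall into three groups, according to how often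
  \<open>\<theta>\<^sub>s\<close> and \<open>\<tau>\<close> occur:

  \<^item> in \<open>\<tau>, \<tau>'\<close>: \<open>\<Pi>\<^sub>G(\<Phi>\<^sub>x\<^sup>*\<tau>, \<Phi>\<^sub>x\<^sup>*\<tau>') + \<Pi>\<^sub>X(\<Phi>\<^sub>g\<^sup>*\<tau>, \<Phi>\<^sub>g\<^sup>*\<tau>') - \<Pi>\<^sub>X(\<tau>, \<tau>')\<close>, which vanishes for
    all \<open>\<tau>, \<tau>'\<close> iff \<open>\<Phi>\<^sub>*(\<Pi>\<^sub>G \<oplus> \<Pi>\<^sub>X) = \<Pi>\<^sub>X\<close>;
  \<^item> in \<open>\<theta>\<^sub>s, \<tau>'\<close>: \<open>\<Pi>\<^sub>X(J\<^sup>*\<theta>\<^sub>s, \<Phi>\<^sub>g\<^sup>*\<tau>')\<close> minus the mixed term \<open>\<langle>\<theta>\<^sub>s, (L\<^sub>g\<^sup>*\<theta>'\<^sub>g)\<^sub>S\<rangle>\<close> of \<open>\<Pi>\<close>.  By the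
    definition of \<open>\<lambda>\<close> the latter is the pairing of \<open>L\<^sub>g\<^sup>*\<theta>'\<^sub>g\<close> with \<open>\<lambda>(\<theta>\<^sub>s)\<close> (lemma \<open>mixed_term\<close>), hence minus
    the derivative of \<open>\<tau>'\<close> along \<open>g exp(t \<lambda>(\<theta>\<^sub>s)) x\<close>.  The two cancel when the momentum map condition holds,
    and at \<open>g = 1\<close> the cancellation is the momentum map condition;
  \<^item> in \<open>\<theta>\<^sub>s, \<theta>'\<^sub>s\<close>: \<open>\<Pi>\<^sub>X(J\<^sup>*\<theta>\<^sub>s, J\<^sup>*\<theta>'\<^sub>s) - \<Pi>\<^sub>S(\<theta>\<^sub>s, \<theta>'\<^sub>s)\<close>, which vanishes by the momentum map condition
    and equivariance of \<open>J\<close>, since \<open>\<Pi>\<^sub>S(\<theta>\<^sub>s, \<theta>'\<^sub>s) = - \<langle>\<theta>'\<^sub>s, \<lambda>(\<theta>\<^sub>s)\<^sub>S\<rangle>\<close> (lemma \<open>PiS_eq\<close>).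

  Read forwards this is \<open>qh_coisotropic\<close>.  For the converse, the functions \<open>f(y) - f(\<Phi>(g, x))\<close> and
  \<open>a(s) - a(J x)\<close> vanish on the graph; inserting two of the first kind isolates the first group
  (\<open>ham_pushes_to\<close>), and one of each kind at a unit isolates the second (\<open>ham_moment\<close>).

  The condition on \<open>[\<Pi>\<^sub>X, \<Pi>\<^sub>X]\<close> is literally the same on both sides, because the infinitesimal action of the
  constant section \<open>\<xi>\<close> is \<open>\<xi>\<^sub>X\<close> (\<open>hat_Om3\<close>).  The remaining axioms of an action translate directly, with
  \<open>(g, x) \<mapsto> ((g, J x), x)\<close> identifying \<open>G \<times> X\<close> with the domain of the groupoid action.

  The calculus behind this consists of the chain rule for smooth maps in charts and the splitting of a
  differential on a product into partial differentials (\<open>deriv_along_Pair\<close>).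
\<close>

section \<open>Functions of class \<open>C\<^sup>k\<close> on an open part of a subspace\<close>

lemma Ck_on_subset: "Ck_on k E A f \<Longrightarrow> B \<subseteq> A \<Longrightarrow> Ck_on k E B f"
proof (induction k arbitrary: f)
  case 0
  then show ?case by (auto intro: continuous_on_subset)
next
  case (Suc k)
  from Suc.prems(1) obtain f' where "\<forall>x\<in>A. (f has_derivative f' x) (at x within A)"
    and "\<forall>v\<in>E. Ck_on k E A (\<lambda>x. f' x v)" by auto
  with Suc show ?case by (auto intro!: exI[of _ f'] intro: has_derivative_subset)
qed

lemma Ck_on_cong:
  assumes "Ck_on k E A f" "\<And>x. x \<in> A \<Longrightarrow> f x = g x"
  shows "Ck_on k E A g"
proof (cases k)
  case 0
  then show ?thesis using assms continuous_on_cong[of A A f g] by auto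
next
  case (Suc m)
  then obtain f' where f': "\<forall>x\<in>A. (f has_derivative f' x) (at x within A)"
    and "\<forall>v\<in>E. Ck_on m E A (\<lambda>x. f' x v)" using assms by auto
  moreover have "(g has_derivative f' x) (at x within A)" if "x \<in> A" for x
    using f' that assms(2) by (intro has_derivative_transform[OF that, of g f]) auto
  ultimately show ?thesis using Suc by auto
qed

lemma Ck_on_const: "Ck_on k E A (\<lambda>_. c)"
  by (induction k arbitrary: c) (auto intro!: exI[of _ "\<lambda>_ _. 0"])

lemma Ck_on_linear: "bounded_linear L \<Longrightarrow> Ck_on k E A L"
  by (cases k) (auto intro!: exI[of _ "\<lambda>_. L"] Ck_on_const
      intro: linear_continuous_on bounded_linear_imp_has_derivative)

lemma Ck_on_linear_compose:
  assumes "bounded_linear L"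
  shows "Ck_on k E A f \<Longrightarrow> Ck_on k E A (\<lambda>x. L (f x))"
proof (induction k arbitrary: f)
  case 0
  then show ?case using bounded_linear.continuous_on[OF assms] by auto
next
  case (Suc k)
  from Suc.prems obtain f' where "\<forall>x\<in>A. (f has_derivative f' x) (at x within A)"
    and "\<forall>v\<in>E. Ck_on k E A (\<lambda>x. f' x v)" by auto
  with Suc.IH show ?case
    by (auto intro!: exI[of _ "\<lambda>x v. L (f' x v)"] bounded_linear.has_derivative[OF assms])
qed

lemma Ck_on_add: "Ck_on k E A f \<Longrightarrow> Ck_on k E A g \<Longrightarrow> Ck_on k E A (\<lambda>x. f x + g x)"
proof (induction k arbitrary: f g)
  case 0
  then show ?case by (auto intro: continuous_on_add)
next
  case (Suc k)
  from Suc.prems obtain f' g' where "\<forall>x\<in>A. (f has_derivative f' x) (at x within A)"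
    "\<forall>v\<in>E. Ck_on k E A (\<lambda>x. f' x v)" "\<forall>x\<in>A. (g has_derivative g' x) (at x within A)"
    "\<forall>v\<in>E. Ck_on k E A (\<lambda>x. g' x v)" by auto
  with Suc.IH show ?case
    by (auto intro!: exI[of _ "\<lambda>x v. f' x v + g' x v"] has_derivative_add)
qed

lemma Ck_on_sum:
  "finite I \<Longrightarrow> (\<And>i. i \<in> I \<Longrightarrow> Ck_on k E A (f i)) \<Longrightarrow> Ck_on k E A (\<lambda>x. \<Sum>i\<in>I. f i x)"
  by (induction I rule: finite_induct) (auto intro: Ck_on_const Ck_on_add)

lemma Ck_on_SucD: "Ck_on (Suc k) E A f \<Longrightarrow> Ck_on k E A f"
proof (induction k arbitrary: f)
  case 0
  then show ?case by (auto simp: continuous_on_eq_continuous_within intro: has_derivative_continuous)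
next
  case (Suc k)
  then show ?case by (subst (asm) Ck_on.simps(2)) (auto simp del: Ck_on.simps(1))
qed

lemma Ck_on_scaleR:
  fixes a :: "'e::real_normed_vector \<Rightarrow> real"
  shows "Ck_on k E A a \<Longrightarrow> Ck_on k E A f \<Longrightarrow> Ck_on k E A (\<lambda>x. a x *\<^sub>R f x)"
proof (induction k arbitrary: a f)
  case 0
  then show ?case by (auto intro: continuous_on_scaleR)
next
  case (Suc k)
  from Suc.prems obtain a' f' where d: "\<forall>x\<in>A. (a has_derivative a' x) (at x within A)"
    "\<forall>v\<in>E. Ck_on k E A (\<lambda>x. a' x v)" "\<forall>x\<in>A. (f has_derivative f' x) (at x within A)"
    "\<forall>v\<in>E. Ck_on k E A (\<lambda>x. f' x v)" by auto
  moreover have "Ck_on k E A a" "Ck_on k E A f" using Suc.prems Ck_on_SucD by blast+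
  ultimately show ?case using Suc.IH
    by (auto intro!: exI[of _ "\<lambda>x v. a x *\<^sub>R f' x v + a' x v *\<^sub>R f x"] has_derivative_scaleR Ck_on_add)
qed

lemma Ck_on_Pair:
  assumes "Ck_on k E A f" "Ck_on k E A g"
  shows "Ck_on k E A (\<lambda>x. (f x, g x))"
proof -
  have "Ck_on k E A (\<lambda>x. (f x, 0) + (0, g x))"
    by (intro Ck_on_add Ck_on_linear_compose[where L = "\<lambda>y. (y, 0)", OF _ assms(1)]
        Ck_on_linear_compose[where L = "\<lambda>y. (0, y)", OF _ assms(2)]
        bounded_linear_Pair bounded_linear_zero bounded_linear_ident)
  then show ?thesis by simp
qed

text \<open>Near a point of \<open>A\<close> the line in a direction \<open>v\<close> of \<open>E\<close> stays in \<open>A\<close>; restricting to it turns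
  the derivative in the direction \<open>v\<close> into the derivative of a function of one real variable.\<close>

lemma line_in_open_part:
  fixes E :: "'e::real_normed_vector set"
  assumes "openin (top_of_set E) A" "subspace E" "x \<in> A" "v \<in> E"
  shows "\<forall>\<^sub>F t in nhds (0::real). x + t *\<^sub>R v \<in> A"
proof -
  obtain T where T: "open T" "A = E \<inter> T" using assms(1) by (auto simp: openin_open)
  have "open ((\<lambda>t::real. x + t *\<^sub>R v) -` T)"
    by (rule open_vimage[OF T(1)]) (intro continuous_intros)
  moreover have "0 \<in> (\<lambda>t::real. x + t *\<^sub>R v) -` T" using T(2) assms(3) by auto
  ultimately have "\<forall>\<^sub>F t in nhds 0. t \<in> (\<lambda>t::real. x + t *\<^sub>R v) -` T"
    by (rule eventually_nhds_in_open)
  then show ?thesis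
  proof eventually_elim
    case (elim t)
    have "x + t *\<^sub>R v \<in> E" using assms T(2) by (intro subspace_add subspace_scale) auto
    with elim T(2) show ?case by simp
  qed
qed

lemma derivative_along_line:
  assumes "(f has_derivative D) (at x within A)"
    and "openin (top_of_set E) A" "subspace E" "x \<in> A" "v \<in> E"
  shows "((\<lambda>t. f (x + t *\<^sub>R v)) has_vector_derivative D v) (at 0)"
proof -
  let ?l = "\<lambda>t::real. x + t *\<^sub>R v"
  let ?T = "?l -` A"
  have "(f has_derivative D) (at (?l 0) within A)" using assms(1) by simp
  moreover have "(?l has_derivative (\<lambda>t. t *\<^sub>R v)) (at 0 within ?T)"
    by (auto intro!: derivative_eq_intros)
  ultimately have "((\<lambda>t. f (?l t)) has_derivative (\<lambda>t. D (t *\<^sub>R v))) (at 0 within ?T)"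
    by (intro has_derivative_in_compose[of ?l "\<lambda>t. t *\<^sub>R v" 0 ?T f D]) (auto intro: has_derivative_subset)
  moreover have "at 0 within ?T = at 0"
  proof -
    obtain U where "open U" "0 \<in> U" "U \<subseteq> ?T"
      using line_in_open_part[OF assms(2-5)] unfolding eventually_nhds by blast
    then show ?thesis by (intro at_within_interior interiorI)
  qed
  moreover have "linear D" using assms(1) has_derivative_linear by blast
  ultimately show ?thesis by (auto simp: has_vector_derivative_def linear_scale)
qed

lemma derivative_unique_direction:
  assumes "(f has_derivative D) (at x within A)" "(f has_derivative D') (at x within A)"
    and "openin (top_of_set E) A" "subspace E" "x \<in> A" "v \<in> E"
  shows "D v = D' v"
  by (rule vector_derivative_unique_at[OF derivative_along_line[OF assms(1,3-6)]
        derivative_along_line[OF assms(2-6)]])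

lemma has_derivative_within_openin:
  assumes "(f has_derivative D) (at x within B)" "openin (top_of_set E) B" "x \<in> B" "A \<subseteq> E"
  shows "(f has_derivative D) (at x within A)"
proof -
  obtain T where T: "open T" "B = E \<inter> T" using assms(2) by (auto simp: openin_open)
  have "(f has_derivative D) (at x within A \<inter> T)"
    using assms(1,4) T by (auto intro: has_derivative_subset)
  moreover have "at x within A \<inter> T = at x within A"
    using T assms(3) by (intro at_within_nhd[of x T]) auto
  ultimately show ?thesis by simp
qed

text \<open>The recursion of \<open>Ck_on\<close> needs one derivative on all of \<open>A\<close>.  Derivatives chosen on the local
  pieces may differ off \<open>E\<close>, but they agree in the directions of \<open>E\<close>, the only ones that are
  differentiated further; so the derivative at \<open>x\<close> may be taken from the piece chosen for \<open>x\<close>.\<close>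

lemma Ck_on_local:
  assumes "subspace E"
  shows "openin (top_of_set E) A \<Longrightarrow>
    (\<And>x. x \<in> A \<Longrightarrow> \<exists>B. openin (top_of_set E) B \<and> x \<in> B \<and> B \<subseteq> A \<and> Ck_on k E B f) \<Longrightarrow> Ck_on k E A f"
proof (induction k arbitrary: f A)
  case 0
  have "continuous (at x within A) f" if x: "x \<in> A" for x
  proof -
    obtain B where B: "openin (top_of_set E) B" "x \<in> B" "B \<subseteq> A" "continuous_on B f"
      using 0(2)[OF x] by auto
    obtain T where T: "open T" "B = E \<inter> T" using B(1) by (auto simp: openin_open)
    have "A \<subseteq> E" using 0(1) openin_imp_subset by blast
    then have "A \<inter> T = B" using T B by auto
    then have "at x within A = at x within B"
      using B(2) T by (intro at_within_nhd[of x T]) auto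
    then show ?thesis using B by (auto simp: continuous_on_eq_continuous_within)
  qed
  then show ?case by (simp add: continuous_on_eq_continuous_within)
next
  case (Suc k)
  have AE: "A \<subseteq> E" using Suc.prems(1) openin_imp_subset by blast
  define Q where "Q x B f' \<longleftrightarrow> openin (top_of_set E) B \<and> x \<in> B \<and> B \<subseteq> A \<and>
     (\<forall>y\<in>B. (f has_derivative f' y) (at y within B)) \<and> (\<forall>v\<in>E. Ck_on k E B (\<lambda>y. f' y v))" for x B f'
  have "\<exists>B f'. Q x B f'" if x: "x \<in> A" for x
  proof -
    obtain B where "openin (top_of_set E) B" "x \<in> B" "B \<subseteq> A" "Ck_on (Suc k) E B f"
      using Suc.prems(2)[OF x] by blast
    then show ?thesis unfolding Q_def Ck_on.simps(2) by blast
  qed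
  then have "\<forall>x\<in>A. \<exists>B. \<exists>f'. Q x B f'" by blast
  from bchoice[OF this] obtain B where "\<forall>x\<in>A. \<exists>f'. Q x (B x) f'" ..
  from bchoice[OF this] obtain f' where Q: "\<forall>x\<in>A. Q x (B x) (f' x)" ..
  have B: "openin (top_of_set E) (B x)" "x \<in> B x" "B x \<subseteq> A" if "x \<in> A" for x
    using Q that by (auto simp: Q_def)
  have f': "(f has_derivative f' x y) (at y within B x)" if "x \<in> A" "y \<in> B x" for x y
    using Q that by (auto simp: Q_def)
  have Ck: "Ck_on k E (B x) (\<lambda>y. f' x y v)" if "x \<in> A" "v \<in> E" for x v
    using Q that by (auto simp: Q_def)
  have d: "(f has_derivative f' x y) (at y within A)" if "x \<in> A" "y \<in> B x" for x y
    by (rule has_derivative_within_openin[OF f'[OF that] B(1)[OF that(1)] that(2) AE])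
  have "Ck_on k E A (\<lambda>y. f' y y v)" if v: "v \<in> E" for v
  proof (rule Suc.IH[OF Suc.prems(1)])
    fix x assume x: "x \<in> A"
    have "f' x y v = f' y y v" if y: "y \<in> B x" for y
    proof -
      have "y \<in> A" using B(3)[OF x] y by auto
      then show ?thesis
        by (intro derivative_unique_direction[OF d[OF x y] d[OF _ B(2)] Suc.prems(1) assms _ v])
    qed
    then have "Ck_on k E (B x) (\<lambda>y. f' y y v)" by (rule Ck_on_cong[OF Ck[OF x v]])
    then show "\<exists>B. openin (top_of_set E) B \<and> x \<in> B \<and> B \<subseteq> A \<and> Ck_on k E B (\<lambda>y. f' y y v)"
      using B x by blast
  qed
  moreover have "\<forall>x\<in>A. (f has_derivative f' x x) (at x within A)" using d[OF _ B(2)] by blast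
  ultimately show ?case unfolding Ck_on.simps(2) by (intro exI[of _ "\<lambda>x. f' x x"] conjI ballI) blast+
qed

text \<open>The difference quotients lie in \<open>E'\<close>, which is closed because it is finite-dimensional.\<close>

lemma derivative_in_subspace:
  fixes f :: "'e::real_normed_vector \<Rightarrow> 'f::euclidean_space"
  assumes "(f has_derivative D) (at x within A)" "openin (top_of_set E) A" "subspace E" "x \<in> A" "v \<in> E"
    and "f ` A \<subseteq> E'" "subspace E'"
  shows "D v \<in> E'"
proof -
  have "((\<lambda>t. f (x + t *\<^sub>R v)) has_vector_derivative D v) (at 0)"
    by (rule derivative_along_line[OF assms(1-5)])
  then have "((\<lambda>t. norm (f (x + t *\<^sub>R v) - f x - t *\<^sub>R D v) / norm t) \<longlongrightarrow> 0) (at 0)"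
    by (simp add: has_vector_derivative_def has_derivative_iff_norm)
  then have "((\<lambda>t. norm ((f (x + t *\<^sub>R v) - f x) /\<^sub>R t - D v)) \<longlongrightarrow> 0) (at 0)"
  proof (rule Lim_transform_eventually)
    have "norm (f (x + t *\<^sub>R v) - f x - t *\<^sub>R D v) / norm t =
        norm ((f (x + t *\<^sub>R v) - f x) /\<^sub>R t - D v)" if "t \<noteq> 0" for t
    proof -
      have "(f (x + t *\<^sub>R v) - f x) /\<^sub>R t - D v = (f (x + t *\<^sub>R v) - f x - t *\<^sub>R D v) /\<^sub>R t"
        using that by (simp add: scaleR_diff_right)
      then show ?thesis by (simp add: divide_inverse mult.commute)
    qed
    then show "\<forall>\<^sub>F t in at 0. norm (f (x + t *\<^sub>R v) - f x - t *\<^sub>R D v) / norm t =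
        norm ((f (x + t *\<^sub>R v) - f x) /\<^sub>R t - D v)"
      by (simp add: eventually_at_filter)
  qed
  then have "((\<lambda>t. (f (x + t *\<^sub>R v) - f x) /\<^sub>R t) \<longlongrightarrow> D v) (at 0)"
    by (simp add: tendsto_norm_zero_iff LIM_zero_iff)
  moreover have "\<forall>\<^sub>F t in at 0. (f (x + t *\<^sub>R v) - f x) /\<^sub>R t \<in> E'"
    unfolding eventually_at_filter using line_in_open_part[OF assms(2-5)]
  proof eventually_elim
    case (elim t)
    then show ?case using assms(4,6,7) by (auto intro!: subspace_scale subspace_diff)
  qed
  ultimately show ?thesis
    by (intro Lim_in_closed_set[OF closed_subspace[OF assms(7)], of _ "at (0::real)"]) auto
qed

text \<open>The chain rule \<open>(g \<circ> f)'(x)(v) = g'(f x)(f'(x)(v))\<close> is not of the form that the recursion of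
  \<open>Ck_on\<close> asks for, as the direction fed to \<open>g'\<close> depends on \<open>x\<close>.  Expanding it in an orthonormal
  basis of the target model space writes the derivative as a sum of products of \<open>C\<^sup>k\<close> functions.\<close>

lemma Ck_on_compose:
  fixes f :: "'e::real_normed_vector \<Rightarrow> 'f::euclidean_space"
  assumes E: "subspace E" "openin (top_of_set E) A" and E': "subspace E'" "B \<subseteq> E'"
  shows "Ck_on k E A f \<Longrightarrow> Ck_on k E' B g \<Longrightarrow> f ` A \<subseteq> B \<Longrightarrow> Ck_on k E A (\<lambda>x. g (f x))"
proof (induction k arbitrary: g)
  case 0
  then show ?case using continuous_on_compose2 by auto
next
  case (Suc k)
  from Suc.prems(1) obtain f' where
    f': "\<forall>x\<in>A. (f has_derivative f' x) (at x within A)" "\<forall>v\<in>E. Ck_on k E A (\<lambda>x. f' x v)" by auto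
  from Suc.prems(2) obtain g' where
    g': "\<forall>y\<in>B. (g has_derivative g' y) (at y within B)" "\<forall>v\<in>E'. Ck_on k E' B (\<lambda>y. g' y v)" by auto
  note f' = bspec[OF f'(1)] bspec[OF f'(2)] and g' = bspec[OF g'(1)] bspec[OF g'(2)]
  obtain Bs where Bs: "Bs \<subseteq> E'" "pairwise orthogonal Bs" "\<And>x. x \<in> Bs \<Longrightarrow> norm x = 1"
    "independent Bs" "span Bs = E'"
    using orthonormal_basis_subspace[OF E'(1)] by metis
  have fin: "finite Bs" using Bs(4) independent_imp_finite by blast
  have expand: "w = (\<Sum>b\<in>Bs. (w \<bullet> b) *\<^sub>R b)" if "w \<in> E'" for w
  proof -
    have 1: "orthogonal (w - (\<Sum>b\<in>Bs. (w \<bullet> b) *\<^sub>R b)) c" if "c \<in> Bs" for c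
    proof -
      have "(\<Sum>b\<in>Bs. (w \<bullet> b) * (b \<bullet> c)) = (\<Sum>b\<in>Bs. if b = c then w \<bullet> c else 0)"
        using Bs(2,3) that by (intro sum.cong) (auto simp: pairwise_def orthogonal_def norm_eq_1)
      then show ?thesis using that fin
        by (simp add: orthogonal_def inner_diff_left inner_sum_left)
    qed
    have "(\<Sum>b\<in>Bs. (w \<bullet> b) *\<^sub>R b) \<in> span Bs"
      by (intro span_sum span_scale span_base)
    then have "w - (\<Sum>b\<in>Bs. (w \<bullet> b) *\<^sub>R b) \<in> span Bs"
      using that Bs(5) span_diff by blast
    then have "orthogonal (w - (\<Sum>b\<in>Bs. (w \<bullet> b) *\<^sub>R b)) (w - (\<Sum>b\<in>Bs. (w \<bullet> b) *\<^sub>R b))"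
      using 1 orthogonal_to_span by blast
    then show ?thesis by (simp add: orthogonal_self)
  qed
  have chain: "((\<lambda>x. g (f x)) has_derivative (\<lambda>v. g' (f x) (f' x v))) (at x within A)" if "x \<in> A" for x
    using has_derivative_in_compose2[OF g'(1) Suc.prems(3) that f'(1)[OF that]] .
  have "Ck_on k E A (\<lambda>x. g' (f x) (f' x v))" if v: "v \<in> E" for v
  proof -
    have "Ck_on k E A (\<lambda>x. \<Sum>b\<in>Bs. (f' x v \<bullet> b) *\<^sub>R g' (f x) b)"
    proof (intro Ck_on_sum[OF fin] Ck_on_scaleR)
      fix b assume b: "b \<in> Bs"
      show "Ck_on k E A (\<lambda>x. f' x v \<bullet> b)"
        by (rule Ck_on_linear_compose[OF bounded_linear_inner_left f'(2)[OF v]])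
      show "Ck_on k E A (\<lambda>x. g' (f x) b)"
        using Suc.IH[OF Ck_on_SucD[OF Suc.prems(1)] g'(2) Suc.prems(3)] b Bs(1) by auto
    qed
    moreover have "(\<Sum>b\<in>Bs. (f' x v \<bullet> b) *\<^sub>R g' (f x) b) = g' (f x) (f' x v)" if x: "x \<in> A" for x
    proof -
      have "linear (g' (f x))" using g'(1) Suc.prems(3) x has_derivative_linear by blast
      moreover have "f' x v \<in> E'"
        using derivative_in_subspace[OF f'(1)[OF x] E(2,1) x v _ E'(1)] Suc.prems(3) E'(2) by auto
      then have "g' (f x) (f' x v) = g' (f x) (\<Sum>b\<in>Bs. (f' x v \<bullet> b) *\<^sub>R b)"
        by (simp only: expand[symmetric])
      ultimately show ?thesis by (simp add: linear_sum linear_scale)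
    qed
    ultimately show ?thesis by (rule Ck_on_cong)
  qed
  with chain show ?case by (auto intro!: exI[of _ "\<lambda>x v. g' (f x) (f' x v)"])
qed

section \<open>Smooth maps\<close>

text \<open>The local part of the definition of a manifold, which passes to products chart by chart.\<close>

definition charted :: "('a, 'e::euclidean_space) mfd \<Rightarrow> bool" where
  "charted M \<longleftrightarrow>
     subspace (model M) \<and> points M = (\<Union>(U, \<phi>)\<in>atlas M. U) \<and>
     (\<forall>(U, \<phi>)\<in>atlas M. openin (mtop M) U \<and> openin (top_of_set (model M)) (\<phi> ` U) \<and>
        homeomorphic_map (subtopology (mtop M) U) (top_of_set (\<phi> ` U)) \<phi>) \<and>
     (\<forall>(U, \<phi>)\<in>atlas M. \<forall>(V, \<psi>)\<in>atlas M.
        smooth_on (model M) (\<phi> ` (U \<inter> V)) (\<psi> \<circ> inv_into U \<phi>))"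

lemma manifold_charted: "manifold M \<Longrightarrow> charted M"
  unfolding manifold_def charted_def by blast

context
  fixes M :: "('a, 'e::euclidean_space) mfd"
  assumes M: "charted M"
begin

lemma subspace_model: "subspace (model M)"
  using M unfolding charted_def by blast

lemma chart_at:
  assumes "p \<in> points M"
  obtains U \<phi> where "(U, \<phi>) \<in> atlas M" "p \<in> U"
  using M assms unfolding charted_def by blast

context
  fixes U \<phi>
  assumes chart: "(U, \<phi>) \<in> atlas M"
begin

lemma chart_open: "openin (mtop M) U"
  and chart_range_open: "openin (top_of_set (model M)) (\<phi> ` U)"
  and chart_homeo: "homeomorphic_map (subtopology (mtop M) U) (top_of_set (\<phi> ` U)) \<phi>"
  using M chart unfolding charted_def by blast+

lemma chart_points: "U \<subseteq> points M"
  using chart_open openin_subset by blast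

lemma chart_inj: "inj_on \<phi> U"
  using homeomorphic_imp_injective_map[OF chart_homeo] chart_points by (simp add: Int_absorb1)

lemma chart_image_open: "openin (mtop M) W \<Longrightarrow> openin (top_of_set (model M)) (\<phi> ` (U \<inter> W))"
proof -
  assume W: "openin (mtop M) W"
  then have "openin (subtopology (mtop M) U) (U \<inter> W)" by (rule openin_subtopology_Int2)
  then have "openin (top_of_set (\<phi> ` U)) (\<phi> ` (U \<inter> W))"
    using homeomorphic_map_openness_eq[OF chart_homeo] by blast
  then show ?thesis using chart_range_open openin_trans by blast
qed

lemma chart_transition:
  "(V, \<psi>) \<in> atlas M \<Longrightarrow> Ck_on k (model M) (\<phi> ` (U \<inter> V)) (\<psi> \<circ> inv_into U \<phi>)"
  using M chart unfolding charted_def smooth_on_def by blast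

end

end

lemma smooth_map_onI:
  assumes W: "openin (mtop M) W" and "\<And>p. p \<in> W \<Longrightarrow> F p \<in> points N"
    and pre: "\<And>O'. openin (mtop N) O' \<Longrightarrow> openin (mtop M) {p \<in> W. F p \<in> O'}"
    and "\<And>U \<phi> V \<psi> k. (U, \<phi>) \<in> atlas M \<Longrightarrow> (V, \<psi>) \<in> atlas N \<Longrightarrow>
      Ck_on k (model M) (\<phi> ` {p \<in> U \<inter> W. F p \<in> V}) (\<psi> \<circ> F \<circ> inv_into U \<phi>)"
  shows "smooth_map_on W M N F"
proof -
  have "topspace (subtopology (mtop M) W) = W" using openin_subset[OF W] by auto
  then have "continuous_map (subtopology (mtop M) W) (mtop N) F"
    unfolding continuous_map_def using assms(2) pre openin_open_subtopology[OF W] by force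
  with assms(1,4) show ?thesis unfolding smooth_map_on_def smooth_on_def by blast
qed

lemma smooth_map_on_open: "smooth_map_on W M N F \<Longrightarrow> openin (mtop M) W"
  by (simp add: smooth_map_on_def)

lemma smooth_map_on_into: "smooth_map_on W M N F \<Longrightarrow> p \<in> W \<Longrightarrow> F p \<in> points N"
  unfolding smooth_map_on_def continuous_map_def
  using openin_subset[of "mtop M" W] by (auto simp: Pi_iff)

lemma smooth_map_on_chart:
  "smooth_map_on W M N F \<Longrightarrow> (U, \<phi>) \<in> atlas M \<Longrightarrow> (V, \<psi>) \<in> atlas N \<Longrightarrow>
   Ck_on k (model M) (\<phi> ` {p \<in> U \<inter> W. F p \<in> V}) (\<psi> \<circ> F \<circ> inv_into U \<phi>)"
  unfolding smooth_map_on_def smooth_on_def by blast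

lemma smooth_map_on_preimage:
  assumes "smooth_map_on W M N F" "openin (mtop N) V"
  shows "openin (mtop M) {p \<in> W. F p \<in> V}"
proof -
  have W: "openin (mtop M) W" and c: "continuous_map (subtopology (mtop M) W) (mtop N) F"
    using assms(1) by (auto simp: smooth_map_on_def)
  have "topspace (subtopology (mtop M) W) = W" using openin_subset[OF W] by auto
  then show ?thesis
    using openin_continuous_map_preimage[OF c assms(2)] openin_open_subtopology[OF W] by auto
qed

lemma smooth_map_on_restrict:
  assumes "smooth_map_on W M N F" "openin (mtop M) V" "V \<subseteq> W"
  shows "smooth_map_on V M N F"
proof (rule smooth_map_onI)
  fix O' assume "openin (mtop N) O'"
  then have "openin (mtop M) ({p \<in> W. F p \<in> O'} \<inter> V)"
    using smooth_map_on_preimage[OF assms(1)] assms(2) by blast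
  moreover have "{p \<in> W. F p \<in> O'} \<inter> V = {p \<in> V. F p \<in> O'}" using assms(3) by auto
  ultimately show "openin (mtop M) {p \<in> V. F p \<in> O'}" by simp
next
  fix U \<phi> U' \<psi> k assume "(U, \<phi>) \<in> atlas M" "(U', \<psi>) \<in> atlas N"
  then show "Ck_on k (model M) (\<phi> ` {p \<in> U \<inter> V. F p \<in> U'}) (\<psi> \<circ> F \<circ> inv_into U \<phi>)"
    using assms(3) by (intro Ck_on_subset[OF smooth_map_on_chart[OF assms(1)]]) auto
qed (use assms smooth_map_on_into[OF assms(1)] in auto)

lemma smooth_map_on_local:
  assumes M: "charted M" and N: "charted N" and W: "openin (mtop M) W"
    and loc: "\<And>p. p \<in> W \<Longrightarrow> \<exists>V F'. p \<in> V \<and> smooth_map_on V M N F' \<and> (\<forall>q\<in>V \<inter> W. F' q = F q)"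
  shows "smooth_map_on W M N F"
proof -
  have pre: "openin (mtop M) {p \<in> W. F p \<in> O'}" if O': "openin (mtop N) O'" for O'
  proof (subst openin_subopen, intro ballI)
    fix p assume "p \<in> {p \<in> W. F p \<in> O'}"
    then have p: "p \<in> W" "F p \<in> O'" by auto
    obtain V F' where V: "p \<in> V" "smooth_map_on V M N F'" "\<forall>q\<in>V \<inter> W. F' q = F q"
      using loc[OF p(1)] by blast
    have "openin (mtop M) ({q \<in> V. F' q \<in> O'} \<inter> W)"
      using smooth_map_on_preimage[OF V(2) O'] W by blast
    then show "\<exists>T. openin (mtop M) T \<and> p \<in> T \<and> T \<subseteq> {p \<in> W. F p \<in> O'}"
      using p V by (intro exI[of _ "{q \<in> V. F' q \<in> O'} \<inter> W"]) auto
  qed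
  have into: "F p \<in> points N" if "p \<in> W" for p
    using loc[OF that] smooth_map_on_into that by (metis IntI)
  have "Ck_on k (model M) (\<phi> ` {p \<in> U \<inter> W. F p \<in> V}) (\<psi> \<circ> F \<circ> inv_into U \<phi>)"
    if U: "(U, \<phi>) \<in> atlas M" and V: "(V, \<psi>) \<in> atlas N" for U \<phi> V \<psi> k
  proof (rule Ck_on_local[OF subspace_model[OF M]])
    have "{p \<in> U \<inter> W. F p \<in> V} = U \<inter> {p \<in> W. F p \<in> V}" by auto
    then show "openin (top_of_set (model M)) (\<phi> ` {p \<in> U \<inter> W. F p \<in> V})"
      using chart_image_open[OF M U pre[OF chart_open[OF N V]]] by simp
  next
    fix y assume "y \<in> \<phi> ` {p \<in> U \<inter> W. F p \<in> V}"
    then obtain p where p: "y = \<phi> p" "p \<in> U" "p \<in> W" "F p \<in> V" by auto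
    obtain V' F' where V': "p \<in> V'" "smooth_map_on V' M N F'" "\<forall>q\<in>V' \<inter> W. F' q = F q"
      using loc[OF p(3)] by blast
    let ?B = "U \<inter> ({q \<in> V'. F' q \<in> V} \<inter> W)"
    have "openin (top_of_set (model M)) (\<phi> ` ?B)"
      using chart_image_open[OF M U] smooth_map_on_preimage[OF V'(2) chart_open[OF N V]] W by blast
    moreover have "Ck_on k (model M) (\<phi> ` ?B) (\<psi> \<circ> F \<circ> inv_into U \<phi>)"
    proof (rule Ck_on_cong)
      show "Ck_on k (model M) (\<phi> ` ?B) (\<psi> \<circ> F' \<circ> inv_into U \<phi>)"
        by (rule Ck_on_subset[OF smooth_map_on_chart[OF V'(2) U V]]) auto
    next
      fix z assume "z \<in> \<phi> ` ?B"
      then show "(\<psi> \<circ> F' \<circ> inv_into U \<phi>) z = (\<psi> \<circ> F \<circ> inv_into U \<phi>) z"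
        using V'(3) inv_into_f_f[OF chart_inj[OF M U]] by auto
    qed
    moreover have "y \<in> \<phi> ` ?B" "\<phi> ` ?B \<subseteq> \<phi> ` {p \<in> U \<inter> W. F p \<in> V}"
      using p V' by auto
    ultimately show "\<exists>B. openin (top_of_set (model M)) B \<and> y \<in> B \<and>
        B \<subseteq> \<phi> ` {p \<in> U \<inter> W. F p \<in> V} \<and> Ck_on k (model M) B (\<psi> \<circ> F \<circ> inv_into U \<phi>)" by blast
  qed
  with W into pre show ?thesis by (rule smooth_map_onI)
qed

lemma smooth_map_on_compose:
  assumes M: "charted M" and N: "charted N" and P: "charted P"
    and F: "smooth_map_on W M N F" and G: "smooth_map_on V N P G" and FW: "F ` W \<subseteq> V"
  shows "smooth_map_on W M P (\<lambda>x. G (F x))"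
proof -
  have W: "openin (mtop M) W" using F by (rule smooth_map_on_open)
  have pre: "openin (mtop M) {p \<in> W. G (F p) \<in> O'}" if "openin (mtop P) O'" for O'
  proof -
    have "{p \<in> W. G (F p) \<in> O'} = {p \<in> W. F p \<in> {q \<in> V. G q \<in> O'}}" using FW by auto
    then show ?thesis
      using smooth_map_on_preimage[OF F smooth_map_on_preimage[OF G that]] by simp
  qed
  have into: "G (F p) \<in> points P" if "p \<in> W" for p
    using smooth_map_on_into[OF G] FW that by blast
  have "Ck_on k (model M) (\<phi> ` {p \<in> U \<inter> W. G (F p) \<in> V'}) (\<psi> \<circ> (\<lambda>x. G (F x)) \<circ> inv_into U \<phi>)"
    if U: "(U, \<phi>) \<in> atlas M" and V': "(V', \<psi>) \<in> atlas P" for U \<phi> V' \<psi> k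
  proof (rule Ck_on_local[OF subspace_model[OF M]])
    have "{p \<in> U \<inter> W. G (F p) \<in> V'} = U \<inter> {p \<in> W. G (F p) \<in> V'}" by auto
    then show "openin (top_of_set (model M)) (\<phi> ` {p \<in> U \<inter> W. G (F p) \<in> V'})"
      using chart_image_open[OF M U pre[OF chart_open[OF P V']]] by simp
  next
    fix y assume "y \<in> \<phi> ` {p \<in> U \<inter> W. G (F p) \<in> V'}"
    then obtain p where p: "y = \<phi> p" "p \<in> U" "p \<in> W" "G (F p) \<in> V'" by auto
    obtain N0 \<kappa> where N0: "(N0, \<kappa>) \<in> atlas N" "F p \<in> N0"
      using chart_at[OF N smooth_map_on_into[OF F p(3)]] .
    let ?C = "{q \<in> W. F q \<in> N0} \<inter> {q \<in> W. G (F q) \<in> V'}"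
    let ?D = "\<kappa> ` {q \<in> N0 \<inter> V. G q \<in> V'}"
    have B: "openin (top_of_set (model M)) (\<phi> ` (U \<inter> ?C))"
      using chart_image_open[OF M U] smooth_map_on_preimage[OF F chart_open[OF N N0(1)]]
        pre[OF chart_open[OF P V']] by blast
    have D: "?D \<subseteq> model N"
      using openin_imp_subset[OF chart_range_open[OF N N0(1)]] by auto
    have "Ck_on k (model M) (\<phi> ` (U \<inter> ?C))
        (\<lambda>z. (\<psi> \<circ> G \<circ> inv_into N0 \<kappa>) ((\<kappa> \<circ> F \<circ> inv_into U \<phi>) z))"
    proof (rule Ck_on_compose[OF subspace_model[OF M] B subspace_model[OF N] D])
      show "Ck_on k (model M) (\<phi> ` (U \<inter> ?C)) (\<kappa> \<circ> F \<circ> inv_into U \<phi>)"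
        by (rule Ck_on_subset[OF smooth_map_on_chart[OF F U N0(1)]]) auto
      show "Ck_on k (model N) ?D (\<psi> \<circ> G \<circ> inv_into N0 \<kappa>)"
        by (rule smooth_map_on_chart[OF G N0(1) V'])
      show "(\<kappa> \<circ> F \<circ> inv_into U \<phi>) ` (\<phi> ` (U \<inter> ?C)) \<subseteq> ?D"
        using FW inv_into_f_f[OF chart_inj[OF M U]] by auto
    qed
    then have "Ck_on k (model M) (\<phi> ` (U \<inter> ?C)) (\<psi> \<circ> (\<lambda>x. G (F x)) \<circ> inv_into U \<phi>)"
    proof (rule Ck_on_cong)
      fix z assume "z \<in> \<phi> ` (U \<inter> ?C)"
      then obtain q where "z = \<phi> q" "q \<in> U" "F q \<in> N0" by auto
      then show "(\<psi> \<circ> G \<circ> inv_into N0 \<kappa>) ((\<kappa> \<circ> F \<circ> inv_into U \<phi>) z) =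
          (\<psi> \<circ> (\<lambda>x. G (F x)) \<circ> inv_into U \<phi>) z"
        by (simp add: inv_into_f_f[OF chart_inj[OF M U]] inv_into_f_f[OF chart_inj[OF N N0(1)]])
    qed
    moreover have "y \<in> \<phi> ` (U \<inter> ?C)" "\<phi> ` (U \<inter> ?C) \<subseteq> \<phi> ` {p \<in> U \<inter> W. G (F p) \<in> V'}"
      using p N0 by auto
    ultimately show "\<exists>B. openin (top_of_set (model M)) B \<and> y \<in> B \<and>
        B \<subseteq> \<phi> ` {p \<in> U \<inter> W. G (F p) \<in> V'} \<and>
        Ck_on k (model M) B (\<psi> \<circ> (\<lambda>x. G (F x)) \<circ> inv_into U \<phi>)" using B by blast
  qed
  with W into pre show ?thesis by (rule smooth_map_onI)
qed

lemma smooth_map_on_const: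
  "openin (mtop M) W \<Longrightarrow> c \<in> points N \<Longrightarrow> smooth_map_on W M N (\<lambda>_. c)"
  unfolding smooth_map_on_def smooth_on_def
  by (auto simp: o_def intro: Ck_on_const)

lemma smooth_map_on_id:
  assumes "charted M" "openin (mtop M) W"
  shows "smooth_map_on W M M (\<lambda>x. x)"
proof (rule smooth_map_onI)
  fix U \<phi> V \<psi> k assume c: "(U, \<phi>) \<in> atlas M" "(V, \<psi>) \<in> atlas M"
  show "Ck_on k (model M) (\<phi> ` {p \<in> U \<inter> W. p \<in> V}) (\<psi> \<circ> (\<lambda>x. x) \<circ> inv_into U \<phi>)"
  proof -
    have "Ck_on k (model M) (\<phi> ` {p \<in> U \<inter> W. p \<in> V}) (\<psi> \<circ> inv_into U \<phi>)"
      by (rule Ck_on_subset[OF chart_transition[OF assms(1) c]]) auto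
    then show ?thesis by (simp add: comp_def)
  qed
next
  fix O' assume "openin (mtop M) O'"
  moreover have "{p \<in> W. p \<in> O'} = W \<inter> O'" by auto
  ultimately show "openin (mtop M) {p \<in> W. p \<in> O'}" using assms(2) by auto
qed (use assms(2) openin_subset in auto)

subsection \<open>Products\<close>

lemma points_prod [simp]: "points (M \<times>\<^sub>m N) = points M \<times> points N"
  by (simp add: prod_mfd_def)

lemma model_prod [simp]: "model (M \<times>\<^sub>m N) = model M \<times> model N"
  by (simp add: prod_mfd_def)

lemma smooth_map_on_Pair:
  assumes "smooth_map_on W M N F" "smooth_map_on W M P G"
  shows "smooth_map_on W M (N \<times>\<^sub>m P) (\<lambda>x. (F x, G x))"
proof -
  have "Ck_on k (model M) (\<phi> ` {p \<in> U \<inter> W. (F p, G p) \<in> V \<times> V'})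
      (map_prod \<psi> \<psi>' \<circ> (\<lambda>x. (F x, G x)) \<circ> inv_into U \<phi>)"
    if "(U, \<phi>) \<in> atlas M" "(V, \<psi>) \<in> atlas N" "(V', \<psi>') \<in> atlas P" for k U \<phi> V \<psi> V' \<psi>'
  proof -
    have "Ck_on k (model M) (\<phi> ` {p \<in> U \<inter> W. (F p, G p) \<in> V \<times> V'})
        (\<lambda>x. ((\<psi> \<circ> F \<circ> inv_into U \<phi>) x, (\<psi>' \<circ> G \<circ> inv_into U \<phi>) x))"
      using that by (intro Ck_on_Pair Ck_on_subset[OF smooth_map_on_chart[OF assms(1)]]
          Ck_on_subset[OF smooth_map_on_chart[OF assms(2)]]) auto
    then show ?thesis by (simp add: comp_def)
  qed
  moreover have "continuous_map (subtopology (mtop M) W) (mtop (N \<times>\<^sub>m P)) (\<lambda>x. (F x, G x))"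
    using assms by (auto simp: smooth_map_on_def prod_mfd_def intro: continuous_map_pairedI)
  ultimately show ?thesis
    using smooth_map_on_open[OF assms(1)] unfolding smooth_map_on_def smooth_on_def
    by (auto simp: prod_mfd_def)
qed

lemma inv_into_map_prod:
  assumes "inj_on \<phi> U" "inj_on \<psi> V" "p \<in> U" "q \<in> V"
  shows "inv_into (U \<times> V) (map_prod \<phi> \<psi>) (\<phi> p, \<psi> q) = (p, q)"
  using assms by (intro inv_into_f_eq map_prod_inj_on) auto

lemma Ck_on_compose_fst:
  fixes E :: "'e::euclidean_space set" and E' :: "'f::euclidean_space set"
  assumes "subspace E" "subspace E'" "openin (top_of_set E) A" "openin (top_of_set E') B"
  shows "Ck_on k E A f \<Longrightarrow> Ck_on k (E \<times> E') (A \<times> B) (\<lambda>z. f (fst z))"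
    and Ck_on_compose_snd: "Ck_on k E' B g \<Longrightarrow> Ck_on k (E \<times> E') (A \<times> B) (\<lambda>z. g (snd z))"
proof -
  have 1: "subspace (E \<times> E')" "openin (top_of_set (E \<times> E')) (A \<times> B)"
    using assms by (auto intro: subspace_Times openin_Times)
  show "Ck_on k (E \<times> E') (A \<times> B) (\<lambda>z. f (fst z))" if "Ck_on k E A f"
    by (rule Ck_on_compose[OF 1 assms(1) openin_imp_subset[OF assms(3)] _ that])
      (auto intro: Ck_on_linear bounded_linear_fst)
  show "Ck_on k (E \<times> E') (A \<times> B) (\<lambda>z. g (snd z))" if "Ck_on k E' B g"
    by (rule Ck_on_compose[OF 1 assms(2) openin_imp_subset[OF assms(4)] _ that])
      (auto intro: Ck_on_linear bounded_linear_snd)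
qed

context
  fixes M :: "('a, 'e::euclidean_space) mfd" and N :: "('b, 'f::euclidean_space) mfd"
  assumes M: "charted M" and N: "charted N"
begin

lemma charted_prod: "charted (M \<times>\<^sub>m N)"
  unfolding charted_def
proof (intro conjI, goal_cases)
  case 1
  then show ?case by (simp add: prod_mfd_def subspace_Times subspace_model[OF M] subspace_model[OF N])
next
  case 2
  have "p \<in> (\<Union>(U, \<phi>)\<in>atlas (M \<times>\<^sub>m N). U)" if p: "p \<in> points (M \<times>\<^sub>m N)" for p
  proof -
    obtain U \<phi> where "(U, \<phi>) \<in> atlas M" "fst p \<in> U"
      by (rule chart_at[OF M, of "fst p"]) (use p in auto)
    moreover obtain V \<psi> where "(V, \<psi>) \<in> atlas N" "snd p \<in> V"
      by (rule chart_at[OF N, of "snd p"]) (use p in auto)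
    ultimately have "(U \<times> V, map_prod \<phi> \<psi>) \<in> atlas (M \<times>\<^sub>m N)" "p \<in> U \<times> V"
      unfolding prod_mfd_def by (auto simp: mem_Times_iff)
    then show ?thesis by blast
  qed
  moreover have "(\<Union>(U, \<phi>)\<in>atlas (M \<times>\<^sub>m N). U) \<subseteq> points (M \<times>\<^sub>m N)"
    using chart_points[OF M] chart_points[OF N] by (fastforce simp: prod_mfd_def)
  ultimately show ?case by blast
next
  case 3
  show ?case
  proof (intro ballI, clarify)
    fix W \<kappa> assume "(W, \<kappa>) \<in> atlas (M \<times>\<^sub>m N)"
    then obtain U \<phi> V \<psi> where W: "W = U \<times> V" "\<kappa> = map_prod \<phi> \<psi>"
      and U: "(U, \<phi>) \<in> atlas M" and V: "(V, \<psi>) \<in> atlas N" by (auto simp: prod_mfd_def)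
    have im: "\<kappa> ` W = \<phi> ` U \<times> \<psi> ` V" using W by (auto simp: map_prod_surj_on)
    obtain \<phi>' where "homeomorphic_maps (subtopology (mtop M) U) (top_of_set (\<phi> ` U)) \<phi> \<phi>'"
      using chart_homeo[OF M U] by (auto simp: homeomorphic_map_maps)
    moreover obtain \<psi>' where "homeomorphic_maps (subtopology (mtop N) V) (top_of_set (\<psi> ` V)) \<psi> \<psi>'"
      using chart_homeo[OF N V] by (auto simp: homeomorphic_map_maps)
    ultimately have "homeomorphic_map (prod_topology (subtopology (mtop M) U) (subtopology (mtop N) V))
        (prod_topology (top_of_set (\<phi> ` U)) (top_of_set (\<psi> ` V))) (\<lambda>(x, y). (\<phi> x, \<psi> y))"
      unfolding homeomorphic_map_maps
      by (intro exI[of _ "\<lambda>(x, y). (\<phi>' x, \<psi>' y)"], unfold homeomorphic_maps_prod) blast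
    then have "homeomorphic_map (subtopology (mtop (M \<times>\<^sub>m N)) W) (top_of_set (\<kappa> ` W)) \<kappa>"
      unfolding im by (simp add: W prod_mfd_def subtopology_Times map_prod_def)
    moreover have "openin (mtop (M \<times>\<^sub>m N)) W"
      using chart_open[OF M U] chart_open[OF N V] by (simp add: W prod_mfd_def openin_prod_Times_iff)
    moreover have "openin (top_of_set (model (M \<times>\<^sub>m N))) (\<kappa> ` W)"
      using chart_range_open[OF M U] chart_range_open[OF N V]
      by (simp add: im prod_mfd_def openin_Times)
    ultimately show "openin (mtop (M \<times>\<^sub>m N)) W \<and> openin (top_of_set (model (M \<times>\<^sub>m N))) (\<kappa> ` W) \<and>
        homeomorphic_map (subtopology (mtop (M \<times>\<^sub>m N)) W) (top_of_set (\<kappa> ` W)) \<kappa>" by blast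
  qed
next
  case 4
  show ?case
  proof (intro ballI, clarify)
    fix W \<kappa> W' \<kappa>' assume "(W, \<kappa>) \<in> atlas (M \<times>\<^sub>m N)" "(W', \<kappa>') \<in> atlas (M \<times>\<^sub>m N)"
    then obtain U \<phi> V \<psi> U' \<phi>' V' \<psi>' where
      W: "W = U \<times> V" "\<kappa> = map_prod \<phi> \<psi>" "W' = U' \<times> V'" "\<kappa>' = map_prod \<phi>' \<psi>'"
      and U: "(U, \<phi>) \<in> atlas M" and V: "(V, \<psi>) \<in> atlas N"
      and U': "(U', \<phi>') \<in> atlas M" and V': "(V', \<psi>') \<in> atlas N" by (auto simp: prod_mfd_def)
    have im: "\<kappa> ` (W \<inter> W') = \<phi> ` (U \<inter> U') \<times> \<psi> ` (V \<inter> V')"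
      unfolding W by (simp add: Times_Int_Times map_prod_surj_on)
    show "smooth_on (model (M \<times>\<^sub>m N)) (\<kappa> ` (W \<inter> W')) (\<kappa>' \<circ> inv_into W \<kappa>)"
      unfolding smooth_on_def
    proof
      fix k
      have "Ck_on k (model M \<times> model N) (\<phi> ` (U \<inter> U') \<times> \<psi> ` (V \<inter> V'))
          (\<lambda>z. ((\<phi>' \<circ> inv_into U \<phi>) (fst z), (\<psi>' \<circ> inv_into V \<psi>) (snd z)))"
        by (intro Ck_on_Pair Ck_on_compose_fst Ck_on_compose_snd subspace_model[OF M] subspace_model[OF N]
            chart_transition[OF M U U'] chart_transition[OF N V V']
            chart_image_open[OF M U chart_open[OF M U']] chart_image_open[OF N V chart_open[OF N V']])
      then show "Ck_on k (model (M \<times>\<^sub>m N)) (\<kappa> ` (W \<inter> W')) (\<kappa>' \<circ> inv_into W \<kappa>)"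
        unfolding im model_prod
        by (rule Ck_on_cong)
          (auto simp: W inv_into_map_prod chart_inj[OF M U] chart_inj[OF N V])
    qed
  qed
qed

lemma smooth_map_fst: "smooth_map (M \<times>\<^sub>m N) M fst"
proof -
  have "Ck_on k (model M \<times> model N) (map_prod \<phi> \<psi> ` {p \<in> (U \<times> V) \<inter> points (M \<times>\<^sub>m N). fst p \<in> U'})
      (\<phi>' \<circ> fst \<circ> inv_into (U \<times> V) (map_prod \<phi> \<psi>))"
    if U: "(U, \<phi>) \<in> atlas M" and V: "(V, \<psi>) \<in> atlas N" and U': "(U', \<phi>') \<in> atlas M"
    for k U \<phi> V \<psi> U' \<phi>'
  proof -
    have "{p \<in> (U \<times> V) \<inter> points (M \<times>\<^sub>m N). fst p \<in> U'} = (U \<inter> U') \<times> V"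
      using chart_points[OF M U] chart_points[OF N V] by auto
    moreover have "Ck_on k (model M \<times> model N) (\<phi> ` (U \<inter> U') \<times> \<psi> ` V) (\<lambda>z. (\<phi>' \<circ> inv_into U \<phi>) (fst z))"
      by (intro Ck_on_compose_fst subspace_model[OF M] subspace_model[OF N] chart_transition[OF M U U']
          chart_image_open[OF M U chart_open[OF M U']] chart_range_open[OF N V])
    ultimately show ?thesis
      by (simp only: map_prod_surj_on[OF refl refl])
        (erule Ck_on_cong, auto simp: inv_into_map_prod chart_inj[OF M U] chart_inj[OF N V])
  qed
  moreover have "continuous_map (mtop (M \<times>\<^sub>m N)) (mtop M) fst"
    by (simp add: prod_mfd_def continuous_map_fst)
  ultimately show ?thesis
    unfolding smooth_map_on_def smooth_on_def subtopology_topspace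
    by (auto simp: prod_mfd_def simp del: topspace_prod_topology)
qed

lemma smooth_map_snd: "smooth_map (M \<times>\<^sub>m N) N snd"
proof -
  have "Ck_on k (model M \<times> model N) (map_prod \<phi> \<psi> ` {p \<in> (U \<times> V) \<inter> points (M \<times>\<^sub>m N). snd p \<in> V'})
      (\<psi>' \<circ> snd \<circ> inv_into (U \<times> V) (map_prod \<phi> \<psi>))"
    if U: "(U, \<phi>) \<in> atlas M" and V: "(V, \<psi>) \<in> atlas N" and V': "(V', \<psi>') \<in> atlas N"
    for k U \<phi> V \<psi> V' \<psi>'
  proof -
    have "{p \<in> (U \<times> V) \<inter> points (M \<times>\<^sub>m N). snd p \<in> V'} = U \<times> (V \<inter> V')"
      using chart_points[OF M U] chart_points[OF N V] by auto
    moreover have "Ck_on k (model M \<times> model N) (\<phi> ` U \<times> \<psi> ` (V \<inter> V')) (\<lambda>z. (\<psi>' \<circ> inv_into V \<psi>) (snd z))"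
      by (intro Ck_on_compose_snd subspace_model[OF M] subspace_model[OF N] chart_transition[OF N V V']
          chart_image_open[OF N V chart_open[OF N V']] chart_range_open[OF M U])
    ultimately show ?thesis
      by (simp only: map_prod_surj_on[OF refl refl])
        (erule Ck_on_cong, auto simp: inv_into_map_prod chart_inj[OF M U] chart_inj[OF N V])
  qed
  moreover have "continuous_map (mtop (M \<times>\<^sub>m N)) (mtop N) snd"
    by (simp add: prod_mfd_def continuous_map_snd)
  ultimately show ?thesis
    unfolding smooth_map_on_def smooth_on_def subtopology_topspace
    by (auto simp: prod_mfd_def simp del: topspace_prod_topology)
qed

end

lemma smooth_map_compose2:
  assumes "charted M" "charted N" "charted P" "charted R"
    and H: "smooth_map (N \<times>\<^sub>m P) R (\<lambda>(a, b). H a b)"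
    and F: "smooth_map_on W M N F" and G: "smooth_map_on W M P G"
  shows "smooth_map_on W M R (\<lambda>x. H (F x) (G x))"
proof -
  have "smooth_map_on W M R (\<lambda>x. (\<lambda>(a, b). H a b) (F x, G x))"
    using smooth_map_on_into[OF F] smooth_map_on_into[OF G]
    by (intro smooth_map_on_compose[OF _ _ _ smooth_map_on_Pair[OF F G] H] charted_prod assms) auto
  then show ?thesis by simp
qed

subsection \<open>Smooth functions\<close>

lemma real_mfd_simps [simp]: "mtop real_mfd = euclidean" "model real_mfd = UNIV" "atlas real_mfd = {(UNIV, id)}"
  by (simp_all add: real_mfd_def)

lemma charted_real: "charted real_mfd"
proof -
  have "Ck_on k UNIV UNIV (id :: real \<Rightarrow> real)" for k
    by (rule Ck_on_linear) (simp add: id_def bounded_linear_ident)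
  then show ?thesis unfolding charted_def smooth_on_def by (auto simp: inv_id homeomorphic_map_id)
qed

lemma Cinf_iff:
  "f \<in> Cinf M \<longleftrightarrow> continuous_map (mtop M) euclidean f \<and>
     (\<forall>(U, \<phi>)\<in>atlas M. \<forall>k. Ck_on k (model M) (\<phi> ` (U \<inter> points M)) (f \<circ> inv_into U \<phi>))"
  by (auto simp: Cinf_def smooth_map_on_def smooth_on_def Int_def)

lemma Cinf_lincomb:
  assumes "f \<in> Cinf M" "h \<in> Cinf M"
  shows "(\<lambda>x. a * f x + b * h x) \<in> Cinf M"
  unfolding Cinf_iff
proof (intro conjI ballI, goal_cases)
  case 1
  then show ?case using assms by (auto simp: Cinf_iff intro!: continuous_map_add continuous_map_real_mult)
next
  case (2 c)
  obtain U \<phi> where c: "c = (U, \<phi>)" by fastforce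
  have "Ck_on k (model M) (\<phi> ` (U \<inter> points M))
      (\<lambda>z. a *\<^sub>R (f \<circ> inv_into U \<phi>) z + b *\<^sub>R (h \<circ> inv_into U \<phi>) z)" for k
  proof -
    have "Ck_on k (model M) (\<phi> ` (U \<inter> points M)) (f \<circ> inv_into U \<phi>)"
      "Ck_on k (model M) (\<phi> ` (U \<inter> points M)) (h \<circ> inv_into U \<phi>)"
      using assms 2 unfolding c Cinf_iff by blast+
    then show ?thesis by (intro Ck_on_add Ck_on_scaleR Ck_on_const)
  qed
  then show ?case by (simp add: c comp_def)
qed

lemma Cinf_const: "(\<lambda>_. c) \<in> Cinf M"
  by (simp add: Cinf_def smooth_map_on_const)

lemma Cinf_diff: "f \<in> Cinf M \<Longrightarrow> h \<in> Cinf M \<Longrightarrow> (\<lambda>x. f x - h x) \<in> Cinf M"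
  using Cinf_lincomb[of f M h 1 "-1"] by simp

lemma Cinf_minus: "f \<in> Cinf M \<Longrightarrow> (\<lambda>x. - f x) \<in> Cinf M"
  using Cinf_lincomb[of f M f 0 "-1"] by simp

lemma Cinf_compose:
  "charted M \<Longrightarrow> charted N \<Longrightarrow> smooth_map M N F \<Longrightarrow> f \<in> Cinf N \<Longrightarrow> (\<lambda>x. f (F x)) \<in> Cinf M"
  unfolding Cinf_def using smooth_map_on_into[of "points M" M N F]
  by (auto intro: smooth_map_on_compose charted_real)

section \<open>Curves and differentials\<close>

lemma curves_atE:
  assumes "\<gamma> \<in> curves_at M p"
  obtains \<epsilon> where "\<gamma> 0 = p" "\<epsilon> > 0" "smooth_map_on {-\<epsilon><..<\<epsilon>} real_mfd M \<gamma>"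
  using assms unfolding curves_at_def by blast

lemma curves_atI:
  "\<gamma> 0 = p \<Longrightarrow> \<epsilon> > 0 \<Longrightarrow> smooth_map_on {-\<epsilon><..<\<epsilon>} real_mfd M \<gamma> \<Longrightarrow> \<gamma> \<in> curves_at M p"
  unfolding curves_at_def by blast

lemma curves_at_zero: "\<gamma> \<in> curves_at M p \<Longrightarrow> \<gamma> 0 = p"
  by (simp add: curves_at_def)

lemma curves_at_points: "\<gamma> \<in> curves_at M p \<Longrightarrow> \<forall>\<^sub>F t in nhds 0. \<gamma> t \<in> points M"
proof (elim curves_atE)
  fix \<epsilon> :: real assume \<epsilon>: "\<epsilon> > 0" "smooth_map_on {-\<epsilon><..<\<epsilon>} real_mfd M \<gamma>"
  then have "\<forall>\<^sub>F t in nhds 0. t \<in> {-\<epsilon><..<\<epsilon>}" by (intro eventually_nhds_in_open) auto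
  then show ?thesis by eventually_elim (rule smooth_map_on_into[OF \<epsilon>(2)])
qed

lemma curves_at_const: "p \<in> points M \<Longrightarrow> (\<lambda>_. p) \<in> curves_at M p"
  by (rule curves_atI[of _ _ 1]) (auto intro: smooth_map_on_const)

lemma curves_at_map:
  assumes "charted M" "charted N" "smooth_map M N F" "\<gamma> \<in> curves_at M p"
  shows "(\<lambda>t. F (\<gamma> t)) \<in> curves_at N (F p)"
proof -
  obtain \<epsilon> where \<epsilon>: "\<gamma> 0 = p" "\<epsilon> > 0" "smooth_map_on {-\<epsilon><..<\<epsilon>} real_mfd M \<gamma>"
    using assms(4) by (rule curves_atE)
  have "smooth_map_on {-\<epsilon><..<\<epsilon>} real_mfd N (\<lambda>t. F (\<gamma> t))"
    using smooth_map_on_into[OF \<epsilon>(3)]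
    by (intro smooth_map_on_compose[OF charted_real assms(1,2) \<epsilon>(3) assms(3)]) auto
  with \<epsilon> show ?thesis by (intro curves_atI) auto
qed

lemma curves_at_Pair:
  assumes "\<gamma> \<in> curves_at M p" "\<delta> \<in> curves_at N q"
  shows "(\<lambda>t. (\<gamma> t, \<delta> t)) \<in> curves_at (M \<times>\<^sub>m N) (p, q)"
proof -
  obtain \<epsilon> where \<epsilon>: "\<gamma> 0 = p" "\<epsilon> > 0" "smooth_map_on {-\<epsilon><..<\<epsilon>} real_mfd M \<gamma>"
    using assms(1) by (rule curves_atE)
  obtain \<epsilon>' where \<epsilon>': "\<delta> 0 = q" "\<epsilon>' > 0" "smooth_map_on {-\<epsilon>'<..<\<epsilon>'} real_mfd N \<delta>"
    using assms(2) by (rule curves_atE)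
  let ?I = "{- min \<epsilon> \<epsilon>'<..<min \<epsilon> \<epsilon>'}"
  have "smooth_map_on ?I real_mfd (M \<times>\<^sub>m N) (\<lambda>t. (\<gamma> t, \<delta> t))"
    by (intro smooth_map_on_Pair smooth_map_on_restrict[OF \<epsilon>(3)] smooth_map_on_restrict[OF \<epsilon>'(3)]) auto
  with \<epsilon> \<epsilon>' show ?thesis by (intro curves_atI[of _ _ "min \<epsilon> \<epsilon>'"]) auto
qed

lemma curve_in_chart:
  assumes M: "charted M" and \<gamma>: "\<gamma> \<in> curves_at M p" and U: "(U, \<phi>) \<in> atlas M" "p \<in> U"
  obtains T u where "open T" "0 \<in> T" "\<gamma> ` T \<subseteq> U" "((\<lambda>t. \<phi> (\<gamma> t)) has_vector_derivative u) (at 0)"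
proof -
  obtain \<epsilon> where \<epsilon>: "\<gamma> 0 = p" "\<epsilon> > 0" "smooth_map_on {-\<epsilon><..<\<epsilon>} real_mfd M \<gamma>"
    using \<gamma> by (rule curves_atE)
  let ?T = "{t \<in> {-\<epsilon><..<\<epsilon>}. \<gamma> t \<in> U}"
  have T: "open ?T" "0 \<in> ?T"
    using smooth_map_on_preimage[OF \<epsilon>(3) chart_open[OF M U(1)]] \<epsilon> U by auto
  have "Ck_on 1 UNIV ?T (\<lambda>t. \<phi> (\<gamma> t))"
    using smooth_map_on_chart[OF \<epsilon>(3), of UNIV id U \<phi> 1] U(1) by (simp add: comp_def inv_id)
  then obtain F' where "\<forall>x\<in>?T. ((\<lambda>t. \<phi> (\<gamma> t)) has_derivative F' x) (at x within ?T)"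
    unfolding One_nat_def Ck_on.simps(2) by blast
  with T(2) obtain f' where "((\<lambda>t. \<phi> (\<gamma> t)) has_derivative f') (at 0 within ?T)" by blast
  then have f': "((\<lambda>t. \<phi> (\<gamma> t)) has_derivative f') (at 0)" using at_within_open[OF T(2,1)] by simp
  have "f' = (\<lambda>t. t *\<^sub>R f' 1)"
  proof
    show "f' t = t *\<^sub>R f' 1" for t
      using linear_scale[OF has_derivative_linear[OF f'], of t 1] by (simp only: real_scaleR_def mult_1_right)
  qed
  with f' have "((\<lambda>t. \<phi> (\<gamma> t)) has_vector_derivative f' 1) (at 0)"
    unfolding has_vector_derivative_def by simp
  with T show thesis by (intro that[of ?T]) auto
qed

text \<open>One linear \<open>D\<close>, the differential of \<open>f\<close> in the chart, serves all curves through \<open>p\<close>; this is what allows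
  derivatives along different curves to be compared.\<close>

lemma differential_in_chart:
  assumes M: "charted M" and f: "f \<in> Cinf M" and U: "(U, \<phi>) \<in> atlas M" "p \<in> U"
  obtains D where "linear D" "\<And>\<gamma> u. \<gamma> \<in> curves_at M p \<Longrightarrow>
    ((\<lambda>t. \<phi> (\<gamma> t)) has_vector_derivative u) (at 0) \<Longrightarrow> ((\<lambda>t. f (\<gamma> t)) has_real_derivative D u) (at 0)"
proof -
  have "Ck_on 1 (model M) (\<phi> ` (U \<inter> points M)) (f \<circ> inv_into U \<phi>)"
    using f U(1) unfolding Cinf_iff by blast
  then have "Ck_on 1 (model M) (\<phi> ` U) (f \<circ> inv_into U \<phi>)"
    using chart_points[OF M U(1)] by (simp add: Int_absorb2)
  then obtain D where D: "((f \<circ> inv_into U \<phi>) has_derivative D) (at (\<phi> p) within \<phi> ` U)"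
    using U(2) by auto
  have lin: "linear D" using D by (rule has_derivative_linear)
  moreover have "((\<lambda>t. f (\<gamma> t)) has_real_derivative D u) (at 0)"
    if \<gamma>: "\<gamma> \<in> curves_at M p" and u: "((\<lambda>t. \<phi> (\<gamma> t)) has_vector_derivative u) (at 0)" for \<gamma> u
  proof -
    obtain T where T: "open T" "0 \<in> T" "\<gamma> ` T \<subseteq> U" using curve_in_chart[OF M \<gamma> U] by metis
    have "((\<lambda>t. \<phi> (\<gamma> t)) has_derivative (\<lambda>t. t *\<^sub>R u)) (at 0 within T)"
      using u unfolding has_vector_derivative_def by (rule has_derivative_at_withinI)
    moreover have "((f \<circ> inv_into U \<phi>) has_derivative D) (at (\<phi> (\<gamma> 0)) within (\<lambda>t. \<phi> (\<gamma> t)) ` T)"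
      unfolding curves_at_zero[OF \<gamma>] by (rule has_derivative_subset[OF D]) (use T in auto)
    ultimately have "((\<lambda>t. (f \<circ> inv_into U \<phi>) (\<phi> (\<gamma> t))) has_derivative (\<lambda>t. D (t *\<^sub>R u))) (at 0 within T)"
      by (rule has_derivative_in_compose)
    then have "((\<lambda>t. (f \<circ> inv_into U \<phi>) (\<phi> (\<gamma> t))) has_derivative (\<lambda>t. D (t *\<^sub>R u))) (at 0)"
      using at_within_open[OF T(2,1)] by simp
    then have "((\<lambda>t. f (\<gamma> t)) has_derivative (\<lambda>t. D (t *\<^sub>R u))) (at 0)"
      by (rule has_derivative_transform_within_open[OF _ T(1,2)])
        (use T inv_into_f_f[OF chart_inj[OF M U(1)]] in auto)
    moreover have "(\<lambda>t. D (t *\<^sub>R u)) = (\<lambda>t. D u * t)"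
      using linear_scale[OF lin] by (simp add: mult.commute)
    ultimately show ?thesis unfolding has_field_derivative_def by simp
  qed
  ultimately show thesis by (rule that)
qed

lemma has_derivative_along_curve:
  assumes M: "charted M" and f: "f \<in> Cinf M" and \<gamma>: "\<gamma> \<in> curves_at M p"
  shows "((\<lambda>t. f (\<gamma> t)) has_real_derivative deriv (\<lambda>t. f (\<gamma> t)) 0) (at 0)"
proof -
  have "p \<in> points M"
    using \<gamma> smooth_map_on_into by (elim curves_atE) fastforce
  then obtain U \<phi> where U: "(U, \<phi>) \<in> atlas M" "p \<in> U" using chart_at[OF M] by blast
  obtain T u where u: "((\<lambda>t. \<phi> (\<gamma> t)) has_vector_derivative u) (at 0)"
    using curve_in_chart[OF M \<gamma> U] by metis
  obtain D where "((\<lambda>t. f (\<gamma> t)) has_real_derivative D u) (at 0)"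
    using differential_in_chart[OF M f U] \<gamma> u by metis
  then show ?thesis by (simp add: DERIV_imp_deriv)
qed

text \<open>The velocity of a pair of curves is the sum of two velocities with one component zero, and the
  differential is linear.  This takes covectors of \<open>\<Gamma> \<times> X \<times> X\<close> apart into their components.\<close>

lemma deriv_along_Pair:
  assumes M: "charted M" and N: "charted N" and F: "F \<in> Cinf (M \<times>\<^sub>m N)"
    and \<gamma>: "\<gamma> \<in> curves_at M p" and \<delta>: "\<delta> \<in> curves_at N q"
  shows "deriv (\<lambda>t. F (\<gamma> t, \<delta> t)) 0 = deriv (\<lambda>t. F (\<gamma> t, q)) 0 + deriv (\<lambda>t. F (p, \<delta> t)) 0"
proof -
  have p: "p \<in> points M" using \<gamma> smooth_map_on_into by (elim curves_atE) fastforce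
  have q: "q \<in> points N" using \<delta> smooth_map_on_into by (elim curves_atE) fastforce
  obtain U \<phi> where U: "(U, \<phi>) \<in> atlas M" "p \<in> U" using chart_at[OF M p] by blast
  obtain V \<psi> where V: "(V, \<psi>) \<in> atlas N" "q \<in> V" using chart_at[OF N q] by blast
  have UV: "(U \<times> V, map_prod \<phi> \<psi>) \<in> atlas (M \<times>\<^sub>m N)" "(p, q) \<in> U \<times> V"
    using U V unfolding prod_mfd_def by auto
  obtain u where u: "((\<lambda>t. \<phi> (\<gamma> t)) has_vector_derivative u) (at 0)"
    using curve_in_chart[OF M \<gamma> U] by metis
  obtain w where w: "((\<lambda>t. \<psi> (\<delta> t)) has_vector_derivative w) (at 0)"
    using curve_in_chart[OF N \<delta> V] by metis
  obtain D where "linear D" and D: "\<And>\<gamma> u. \<gamma> \<in> curves_at (M \<times>\<^sub>m N) (p, q) \<Longrightarrow>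
    ((\<lambda>t. map_prod \<phi> \<psi> (\<gamma> t)) has_vector_derivative u) (at 0) \<Longrightarrow>
    ((\<lambda>t. F (\<gamma> t)) has_real_derivative D u) (at 0)"
    using differential_in_chart[OF charted_prod[OF M N] F UV] by metis
  have "((\<lambda>t. F (\<gamma> t, \<delta> t)) has_real_derivative D (u, w)) (at 0)"
    by (rule D[OF curves_at_Pair[OF \<gamma> \<delta>]]) (simp add: has_vector_derivative_Pair u w)
  moreover have "((\<lambda>t. F (\<gamma> t, q)) has_real_derivative D (u, 0)) (at 0)"
    by (rule D[OF curves_at_Pair[OF \<gamma> curves_at_const[OF q]]]) (simp add: has_vector_derivative_Pair u)
  moreover have "((\<lambda>t. F (p, \<delta> t)) has_real_derivative D (0, w)) (at 0)"
    by (rule D[OF curves_at_Pair[OF curves_at_const[OF p] \<delta>]]) (simp add: has_vector_derivative_Pair w)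
  moreover have "D (u, w) = D (u, 0) + D (0, w)"
    using linear_add[OF \<open>linear D\<close>, of "(u, 0)" "(0, w)"] by simp
  ultimately show ?thesis by (simp add: DERIV_imp_deriv)
qed

lemma deriv_lincomb_along_curve:
  assumes "charted M" "f \<in> Cinf M" "h \<in> Cinf M" "\<gamma> \<in> curves_at M p"
  shows "deriv (\<lambda>t. a * f (\<gamma> t) + b * h (\<gamma> t)) 0 =
    a * deriv (\<lambda>t. f (\<gamma> t)) 0 + b * deriv (\<lambda>t. h (\<gamma> t)) 0"
  by (intro DERIV_imp_deriv DERIV_add DERIV_cmult has_derivative_along_curve[OF assms(1,2,4)]
      has_derivative_along_curve[OF assms(1,3,4)])

lemma same_covectorI:
  assumes "f \<in> Cinf M" "h \<in> Cinf M"
    and "\<And>\<gamma>. \<gamma> \<in> curves_at M p \<Longrightarrow> deriv (\<lambda>t. f (\<gamma> t)) 0 = deriv (\<lambda>t. h (\<gamma> t)) 0"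
  shows "same_covector M p f h"
  using assms unfolding same_covector_def tangent_space_def velocity_def by auto

lemma conormalI:
  assumes "f \<in> Cinf M" "\<And>q. q \<in> A \<Longrightarrow> f q = 0"
  shows "f \<in> conormal M A p"
proof -
  have "deriv (\<lambda>t. f (\<gamma> t)) 0 = 0" if "\<forall>\<^sub>F t in nhds 0. \<gamma> t \<in> A" for \<gamma>
  proof -
    have "\<forall>\<^sub>F t in nhds 0. f (\<gamma> t) = 0" using that by eventually_elim (rule assms(2))
    then have "deriv (\<lambda>t. f (\<gamma> t)) 0 = deriv (\<lambda>_. 0) 0" by (intro deriv_cong_ev) auto
    then show ?thesis by simp
  qed
  with assms(1) show ?thesis unfolding conormal_def velocity_def by auto
qed

lemma conormalD:
  assumes "f \<in> conormal M A p"
  shows "f \<in> Cinf M"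
    and "\<gamma> \<in> curves_at M p \<Longrightarrow> \<forall>\<^sub>F t in nhds 0. \<gamma> t \<in> A \<Longrightarrow> deriv (\<lambda>t. f (\<gamma> t)) 0 = 0"
  using assms unfolding conormal_def velocity_def by auto

lemma deriv_minus_const: "deriv (\<lambda>t. f t - c) x = deriv (f :: real \<Rightarrow> real) x"
proof -
  have "((\<lambda>t. f t - c) has_real_derivative D) (at x) \<longleftrightarrow> (f has_real_derivative D) (at x)" for D
    using DERIV_diff[of f D x UNIV "\<lambda>_. c" 0] DERIV_add[of "\<lambda>t. f t - c" D x UNIV "\<lambda>_. c" 0] by auto
  then show ?thesis by (simp add: deriv_def)
qed

section \<open>Bivector fields\<close>

context
  fixes M :: "('a, 'e::euclidean_space) mfd" and P :: "'a mv"
  assumes P: "bivector_field M P"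
begin

lemma bivector_cong:
  assumes "p \<in> points M" "f \<in> Cinf M" "f' \<in> Cinf M" "h \<in> Cinf M" "h' \<in> Cinf M"
    and "same_covector M p f f'" "same_covector M p h h'"
  shows "P [f, h] p = P [f', h'] p"
proof -
  have *: "\<forall>fs hs. \<forall>p\<in>points M. length fs = 2 \<and> length hs = 2 \<and> set fs \<subseteq> Cinf M \<and> set hs \<subseteq> Cinf M \<and>
      (\<forall>i<2. same_covector M p (fs ! i) (hs ! i)) \<longrightarrow> P fs p = P hs p"
    using P unfolding multivector_field_def by (elim conjE)
  have "\<forall>i<2. same_covector M p ([f, h] ! i) ([f', h'] ! i)"
    using assms by (simp add: less_2_cases_iff)
  then show ?thesis
    using assms(1-5) by (intro *[rule_format, where fs = "[f, h]" and hs = "[f', h']"]) simp_all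
qed

lemma bivector_lincomb_at:
  assumes "p \<in> points M" "f \<in> Cinf M" "h \<in> Cinf M" "set fs \<subseteq> Cinf M" "length fs = 2" "i < 2"
  shows "P (fs[i := (\<lambda>q. a * f q + b * h q)]) p = a * P (fs[i := f]) p + b * P (fs[i := h]) p"
proof -
  have "\<forall>fs f h a b. \<forall>i<2. \<forall>p\<in>points M. length fs = 2 \<and> set fs \<subseteq> Cinf M \<and> f \<in> Cinf M \<and> h \<in> Cinf M \<longrightarrow>
      P (fs[i := (\<lambda>q. a * f q + b * h q)]) p = a * P (fs[i := f]) p + b * P (fs[i := h]) p"
    using P unfolding multivector_field_def by (elim conjE)
  then show ?thesis using assms by blast
qed

lemma bivector_lincomb_left:
  assumes "p \<in> points M" "f \<in> Cinf M" "f' \<in> Cinf M" "h \<in> Cinf M"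
  shows "P [\<lambda>q. a * f q + b * f' q, h] p = a * P [f, h] p + b * P [f', h] p"
  using bivector_lincomb_at[OF assms(1-3), of "[f, h]" 0] assms by simp

lemma bivector_lincomb_right:
  assumes "p \<in> points M" "f \<in> Cinf M" "h \<in> Cinf M" "h' \<in> Cinf M"
  shows "P [f, \<lambda>q. a * h q + b * h' q] p = a * P [f, h] p + b * P [f, h'] p"
  using bivector_lincomb_at[OF assms(1,3,4), of "[f, h]" 1] assms by simp

lemma bivector_alternating:
  assumes "p \<in> points M" "f \<in> Cinf M"
  shows "P [f, f] p = 0"
proof -
  have *: "\<forall>fs i j. \<forall>p\<in>points M. length fs = 2 \<and> set fs \<subseteq> Cinf M \<and> i < j \<and> j < 2 \<and> fs ! i = fs ! j \<longrightarrow>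
      P fs p = 0"
    using P unfolding multivector_field_def by (elim conjE)
  show ?thesis
    by (rule *[rule_format, where fs = "[f, f]" and i = 0 and j = 1]) (use assms in simp_all)
qed

lemma bivector_skew:
  assumes p: "p \<in> points M" and f: "f \<in> Cinf M" and h: "h \<in> Cinf M"
  shows "P [f, h] p = - P [h, f] p"
proof -
  have fh: "(\<lambda>q. 1 * f q + 1 * h q) \<in> Cinf M" by (rule Cinf_lincomb[OF f h])
  have "0 = P [\<lambda>q. 1 * f q + 1 * h q, \<lambda>q. 1 * f q + 1 * h q] p"
    by (rule bivector_alternating[OF p fh, symmetric])
  also have "\<dots> = P [f, h] p + P [h, f] p"
    unfolding bivector_lincomb_left[OF p f h fh] bivector_lincomb_right[OF p f f h]
      bivector_lincomb_right[OF p h f h]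
    using bivector_alternating[OF p f] bivector_alternating[OF p h] by simp
  finally show ?thesis by simp
qed

lemma bivector_const_left: "p \<in> points M \<Longrightarrow> h \<in> Cinf M \<Longrightarrow> P [\<lambda>_. c, h] p = 0"
proof -
  assume p: "p \<in> points M" and h: "h \<in> Cinf M"
  have "P [\<lambda>_. c, h] p = P [\<lambda>_. 0, h] p"
    by (rule bivector_cong[OF p Cinf_const Cinf_const h h]) (auto intro!: same_covectorI Cinf_const h)
  also have "\<dots> = 0" using bivector_lincomb_left[OF p h h h, of 0 0] by simp
  finally show ?thesis .
qed

end

text \<open>Additive constants drop out because a bivector field only sees differentials.\<close>

lemma bivector_affine:
  assumes P: "bivector_field M P" and p: "p \<in> points M" and f: "f \<in> Cinf M" and h: "h \<in> Cinf M"
  shows "P [\<lambda>q. a * f q + c, \<lambda>q. b * h q + d] p = a * b * P [f, h] p"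
proof -
  have left: "P [\<lambda>q. a * f q + c, h] p = a * P [f, h] p" if "f \<in> Cinf M" "h \<in> Cinf M" for f h a c
    using bivector_lincomb_left[OF P p that(1) Cinf_const that(2), of a 1 c]
      bivector_const_left[OF P p that(2)] by simp
  have hd: "(\<lambda>q. b * h q + d) \<in> Cinf M"
    using Cinf_lincomb[OF h Cinf_const[of 1], of b d] by simp
  have "P [\<lambda>q. a * f q + c, \<lambda>q. b * h q + d] p = a * P [f, \<lambda>q. b * h q + d] p"
    by (rule left[OF f hd])
  also have "\<dots> = - (a * P [\<lambda>q. b * h q + d, f] p)"
    using bivector_skew[OF P p f hd] by simp
  also have "\<dots> = - (a * b * P [h, f] p)" using left[OF h f] by simp
  also have "\<dots> = a * b * P [f, h] p" using bivector_skew[OF P p f h] by simp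
  finally show ?thesis .
qed

section \<open>Translations and generators\<close>

lemma smooth_left_mult:
  assumes "lie_group K M" "a \<in> carrier K"
  shows "smooth_map M M (\<lambda>b. a \<otimes>\<^bsub>K\<^esub> b)" and smooth_right_mult: "smooth_map M M (\<lambda>b. b \<otimes>\<^bsub>K\<^esub> a)"
proof -
  have M: "charted M" "points M = carrier K" "smooth_map (M \<times>\<^sub>m M) M (\<lambda>(a, b). a \<otimes>\<^bsub>K\<^esub> b)"
    using assms(1) by (auto simp: lie_group_def manifold_charted)
  show "smooth_map M M (\<lambda>b. a \<otimes>\<^bsub>K\<^esub> b)" "smooth_map M M (\<lambda>b. b \<otimes>\<^bsub>K\<^esub> a)"
    by (intro smooth_map_compose2[OF M(1) M(1) M(1) M(1) M(3)] smooth_map_on_const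
        smooth_map_on_id M(1) openin_topspace, simp add: assms(2) M(2))+
qed

lemma generator_eq: "generator ex act v [f] x = deriv (\<lambda>t. f (act (ex (t *\<^sub>R v)) x)) 0"
  by (simp add: generator_def)

section \<open>The pairing of \<open>\<gg>\<close> and \<open>\<hh>\<close>\<close>

text \<open>The functionals on a subspace that occur below are derivatives along one-parameter subgroups;
  they are linear only on the subspace on which these subgroups are defined.\<close>

definition linear_functional_on :: "'v::real_vector set \<Rightarrow> ('v \<Rightarrow> real) \<Rightarrow> bool" where
  "linear_functional_on V L \<longleftrightarrow>
     subspace V \<and> (\<forall>v\<in>V. \<forall>w\<in>V. \<forall>a b. L (a *\<^sub>R v + b *\<^sub>R w) = a * L v + b * L w)"

lemma linear_functional_on_sum:
  fixes n :: nat
  assumes L: "linear_functional_on V L" and v: "\<And>i. i < n \<Longrightarrow> v i \<in> V"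
  shows "L (\<Sum>i<n. c i *\<^sub>R v i) = (\<Sum>i<n. c i * L (v i))"
  using v
proof (induction n)
  case 0
  have "0 \<in> V" using L by (simp add: linear_functional_on_def subspace_0)
  then have "L (0 *\<^sub>R 0 + 0 *\<^sub>R 0) = 0 * L 0 + 0 * L 0" using L unfolding linear_functional_on_def by blast
  then show ?case by simp
next
  case (Suc n)
  have V: "subspace V" using L by (simp add: linear_functional_on_def)
  have "(\<Sum>i<n. c i *\<^sub>R v i) \<in> V" using Suc.prems by (intro subspace_sum[OF V] subspace_scale[OF V]) auto
  then have "L (1 *\<^sub>R (\<Sum>i<n. c i *\<^sub>R v i) + c n *\<^sub>R v n) = 1 * L (\<Sum>i<n. c i *\<^sub>R v i) + c n * L (v n)"
    using L Suc.prems[of n] unfolding linear_functional_on_def by blast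
  then show ?case using Suc by simp
qed

text \<open>Families \<open>x\<close>, \<open>y\<close> that expand each other through \<open>B\<close> are dual bases, so \<open>\<Sum>\<^sub>i L (y i) x i\<close> pairs with
  each \<open>y i\<close> as \<open>L\<close> prescribes.  With \<open>\<gg>\<close> and \<open>\<hh>\<close> in either order this evaluates the descriptions that
  define \<open>\<lambda>\<close> and \<open>L\<^sub>g\<^sup>*\<close>.\<close>

lemma dual_vector:
  fixes n :: nat
  assumes B: "bilinear B" and L: "linear_functional_on A' L" and A: "subspace A"
    and x: "\<And>i. i < n \<Longrightarrow> x i \<in> A" and y: "\<And>i. i < n \<Longrightarrow> y i \<in> A'"
    and expand: "\<And>a. a \<in> A \<Longrightarrow> a = (\<Sum>i<n. B a (y i) *\<^sub>R x i)"
    and expand': "\<And>b. b \<in> A' \<Longrightarrow> b = (\<Sum>i<n. B (x i) b *\<^sub>R y i)"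
  shows "(THE \<xi>. \<xi> \<in> A \<and> (\<forall>b\<in>A'. B \<xi> b = L b)) = (\<Sum>i<n. L (y i) *\<^sub>R x i)"
    and "(\<Sum>i<n. L (y i) *\<^sub>R x i) \<in> A"
    and "b \<in> A' \<Longrightarrow> B (\<Sum>i<n. L (y i) *\<^sub>R x i) b = L b"
proof -
  let ?\<xi> = "\<Sum>i<n. L (y i) *\<^sub>R x i"
  show in_A: "?\<xi> \<in> A" using x by (intro subspace_sum[OF A] subspace_scale[OF A]) auto
  have pair: "B ?\<xi> b = L b" if b: "b \<in> A'" for b
  proof -
    have "B ?\<xi> b = (\<Sum>i<n. L (y i) * B (x i) b)"
      using B by (simp add: bilinear_def linear_sum[of "\<lambda>z. B z b"] linear_scale[of "\<lambda>z. B z b"])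
    also have "\<dots> = L (\<Sum>i<n. B (x i) b *\<^sub>R y i)"
      using linear_functional_on_sum[OF L y, where c = "\<lambda>i. B (x i) b"] by (simp add: mult.commute)
    also have "\<dots> = L b" using expand'[OF b] by (rule arg_cong[OF sym])
    finally show ?thesis .
  qed
  show "b \<in> A' \<Longrightarrow> B ?\<xi> b = L b" by (rule pair)
  show "(THE \<xi>. \<xi> \<in> A \<and> (\<forall>b\<in>A'. B \<xi> b = L b)) = ?\<xi>"
  proof (rule the_equality)
    fix \<xi> assume \<xi>: "\<xi> \<in> A \<and> (\<forall>b\<in>A'. B \<xi> b = L b)"
    then have "\<xi> = (\<Sum>i<n. B \<xi> (y i) *\<^sub>R x i)" using expand by blast
    also have "\<dots> = ?\<xi>" using \<xi> y by (intro sum.cong) auto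
    finally show "\<xi> = ?\<xi>" .
  qed (use in_A pair in blast)
qed

locale quasi_triple_group_pair =
  fixes Q :: "('v::real_vector, 'd, 'ed::euclidean_space, 'eg::euclidean_space, 'es::euclidean_space) group_pair"
  assumes quasi_triple: "manin_quasi_triple (bracket Q) (form Q) (gsub Q) (hsub Q)"
    and data: "quasi_lie_bialgebra_data Q"
    and group_pair: "is_group_pair Q"
    and PiG: "is_PiG Q"
begin

abbreviation "G \<equiv> Gmfd Q"
abbreviation "S \<equiv> Smfd Q"
abbreviation mult_D (infixl \<open>\<cdot>\<close> 70) where "a \<cdot> b \<equiv> a \<otimes>\<^bsub>Dgrp Q\<^esub> b"
abbreviation "\<ee> \<equiv> basis_g Q"
abbreviation "\<epsilon> \<equiv> basis_h Q"

lemma form_bilinear: "bilinear (form Q)"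
  and form_sym: "form Q u v = form Q v u"
  and form_nondegenerate: "(\<And>v. form Q u v = 0) \<Longrightarrow> u = 0"
  and subspace_g: "subspace (gsub Q)"
  and subspace_h: "subspace (hsub Q)"
  and isotropic_h: "u \<in> hsub Q \<Longrightarrow> v \<in> hsub Q \<Longrightarrow> form Q u v = 0"
  and decompose: "\<exists>v\<in>gsub Q. \<exists>w\<in>hsub Q. u = v + w"
proof -
  show "bilinear (form Q)" "subspace (gsub Q)" "subspace (hsub Q)"
    using quasi_triple unfolding manin_quasi_triple_def by - (elim conjE, assumption)+
  have "\<forall>u v. form Q u v = form Q v u" and nd: "\<forall>u. (\<forall>v. form Q u v = 0) \<longrightarrow> u = 0"
    and h: "isotropic (form Q) (hsub Q)" and dec: "\<forall>u. \<exists>v\<in>gsub Q. \<exists>w\<in>hsub Q. u = v + w"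
    using quasi_triple unfolding manin_quasi_triple_def by - (elim conjE, assumption)+
  then show "form Q u v = form Q v u" by (elim allE)
  show "(\<And>v. form Q u v = 0) \<Longrightarrow> u = 0" using nd by simp
  show "u \<in> hsub Q \<Longrightarrow> v \<in> hsub Q \<Longrightarrow> form Q u v = 0" using h by (simp add: isotropic_def)
  show "\<exists>v\<in>gsub Q. \<exists>w\<in>hsub Q. u = v + w" by (rule spec[OF dec])
qed

lemma span_e: "span (\<ee> ` {..<gdim Q}) = gsub Q"
  and \<epsilon>_in_h: "i < gdim Q \<Longrightarrow> \<epsilon> i \<in> hsub Q"
  and form_\<epsilon>_e: "i < gdim Q \<Longrightarrow> j < gdim Q \<Longrightarrow> form Q (\<epsilon> i) (\<ee> j) = (if i = j then 1 else 0)"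
proof -
  show "span (\<ee> ` {..<gdim Q}) = gsub Q"
    using data unfolding quasi_lie_bialgebra_data_def Let_def by (elim conjE)
  have "\<forall>i<gdim Q. \<epsilon> i \<in> hsub Q"
    "\<forall>i<gdim Q. \<forall>j<gdim Q. form Q (\<epsilon> i) (\<ee> j) = (if i = j then 1 else 0)"
    using data unfolding quasi_lie_bialgebra_data_def Let_def by - (elim conjE, assumption)+
  then show "i < gdim Q \<Longrightarrow> \<epsilon> i \<in> hsub Q"
    "i < gdim Q \<Longrightarrow> j < gdim Q \<Longrightarrow> form Q (\<epsilon> i) (\<ee> j) = (if i = j then 1 else 0)" by simp_all
qed

lemma e_in_g: "i < gdim Q \<Longrightarrow> \<ee> i \<in> gsub Q"
  unfolding span_e[symmetric] by (intro span_base) auto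

lemma form_linear_left: "linear (\<lambda>u. form Q u v)" and form_linear_right: "linear (form Q u)"
  using form_bilinear by (auto simp: bilinear_def)

lemma expand_g:
  assumes "\<xi> \<in> gsub Q"
  shows "\<xi> = (\<Sum>i<gdim Q. form Q \<xi> (\<epsilon> i) *\<^sub>R \<ee> i)"
proof (rule linear_eq_on[where f = "\<lambda>\<xi>. \<xi>" and B = "\<ee> ` {..<gdim Q}"])
  show "linear (\<lambda>\<xi>. \<Sum>i<gdim Q. form Q \<xi> (\<epsilon> i) *\<^sub>R \<ee> i)"
    by (rule linearI) (simp_all add: linear_add[OF form_linear_left] linear_scale[OF form_linear_left]
        scaleR_add_left sum.distrib scaleR_sum_right)
  show "\<xi> \<in> span (\<ee> ` {..<gdim Q})" using assms span_e by simp
next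
  fix b assume "b \<in> \<ee> ` {..<gdim Q}"
  then obtain j where j: "j < gdim Q" "b = \<ee> j" by auto
  have "(\<Sum>i<gdim Q. form Q b (\<epsilon> i) *\<^sub>R \<ee> i) = (\<Sum>i<gdim Q. if i = j then \<ee> j else 0)"
    using j form_\<epsilon>_e form_sym[of b] by (intro sum.cong) auto
  then show "b = (\<Sum>i<gdim Q. form Q b (\<epsilon> i) *\<^sub>R \<ee> i)" using j by simp
qed (rule linear_ident)

lemma expand_h:
  assumes \<eta>: "\<eta> \<in> hsub Q"
  shows "\<eta> = (\<Sum>i<gdim Q. form Q \<eta> (\<ee> i) *\<^sub>R \<epsilon> i)"
proof -
  let ?r = "\<eta> - (\<Sum>i<gdim Q. form Q \<eta> (\<ee> i) *\<^sub>R \<epsilon> i)"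
  have r: "?r \<in> hsub Q"
    using \<eta> \<epsilon>_in_h by (intro subspace_diff[OF subspace_h] subspace_sum[OF subspace_h]
        subspace_scale[OF subspace_h]) auto
  have "form Q ?r (\<ee> j) = 0" if j: "j < gdim Q" for j
  proof -
    have "(\<Sum>i<gdim Q. form Q \<eta> (\<ee> i) * form Q (\<epsilon> i) (\<ee> j)) =
        (\<Sum>i<gdim Q. if i = j then form Q \<eta> (\<ee> j) else 0)"
      using form_\<epsilon>_e j by (intro sum.cong) auto
    then show ?thesis using j
      by (simp add: linear_diff[OF form_linear_left] linear_sum[OF form_linear_left]
          linear_scale[OF form_linear_left])
  qed
  then have e: "form Q ?r b = 0" if "b \<in> \<ee> ` {..<gdim Q}" for b using that by blast
  have g: "form Q ?r v = 0" if "v \<in> gsub Q" for v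
    using linear_eq_0_on_span[OF form_linear_right e] that span_e by blast
  have "form Q ?r u = 0" for u
  proof -
    obtain v w where "v \<in> gsub Q" "w \<in> hsub Q" "u = v + w" using decompose by blast
    then show ?thesis using g isotropic_h[OF r] by (simp add: linear_add[OF form_linear_right])
  qed
  then have "?r = 0" by (rule form_nondegenerate)
  then show ?thesis by simp
qed

section \<open>One-parameter subgroups and the dressing action\<close>

lemma lie_group_D: "lie_group (Dgrp Q) (Dmfd Q)"
  and lie_algebra_D: "has_lie_algebra (Dgrp Q) (Dmfd Q) UNIV (bracket Q) (expo Q)"
  and subgroup_G: "subgroup (points G) (Dgrp Q)"
  and lie_group_G: "lie_group (Ggrp Q) G"
  and lie_algebra_G: "has_lie_algebra (Ggrp Q) G (gsub Q) (bracket Q) (expo Q)"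
  and manifold_S: "manifold S"
  and points_S: "points S = coset_proj Q ` carrier (Dgrp Q)"
  and submersion_coset: "submersion (Dmfd Q) S (coset_proj Q)"
  using group_pair unfolding is_group_pair_def by blast+

lemma charted_D: "charted (Dmfd Q)" and charted_G: "charted G" and charted_S: "charted S"
  using lie_group_D lie_group_G manifold_S by (auto simp: lie_group_def manifold_charted)

lemma points_D: "points (Dmfd Q) = carrier (Dgrp Q)" and group_D: "group (Dgrp Q)"
  using lie_group_D by (auto simp: lie_group_def)

lemma G_subset_D: "points G \<subseteq> carrier (Dgrp Q)"
  using subgroup.subset[OF subgroup_G] .

lemma Ggrp_simps [simp]:
  "carrier (Ggrp Q) = points G" "mult (Ggrp Q) = mult (Dgrp Q)" "one (Ggrp Q) = one (Dgrp Q)"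
  by (simp_all add: Ggrp_def)

lemma expo_curve:
  assumes "has_lie_algebra K M V br (expo Q)" "v \<in> V"
  shows "smooth_map real_mfd M (\<lambda>t. expo Q (t *\<^sub>R v))"
    and "expo Q (t *\<^sub>R v) \<in> points M"
proof -
  show *: "smooth_map real_mfd M (\<lambda>t. expo Q (t *\<^sub>R v))"
    using assms unfolding has_lie_algebra_def by blast
  show "expo Q (t *\<^sub>R v) \<in> points M" using smooth_map_on_into[OF *] by simp
qed

lemmas expo_in_D = expo_curve(2)[OF lie_algebra_D UNIV_I, unfolded points_D]
lemmas expo_in_G = expo_curve(2)[OF lie_algebra_G]

lemma expo_zero: "expo Q 0 = \<one>\<^bsub>Dgrp Q\<^esub>"
proof -
  have "expo Q ((s + t) *\<^sub>R v) = expo Q (s *\<^sub>R v) \<cdot> expo Q (t *\<^sub>R v)" for s t v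
    using lie_algebra_D unfolding has_lie_algebra_def by blast
  from this[of 0 0 0] have "expo Q 0 = expo Q 0 \<cdot> expo Q 0" by simp
  moreover have "expo Q 0 \<in> carrier (Dgrp Q)" using expo_in_D[of 0 0] by simp
  ultimately show ?thesis using group.l_cancel_one'[OF group_D] by metis
qed

lemma linear_functional_expo:
  assumes "has_lie_algebra K M V br (expo Q)" "f \<in> Cinf M"
  shows "linear_functional_on V (\<lambda>v. deriv (\<lambda>t. f (expo Q (t *\<^sub>R v))) 0)"
  unfolding linear_functional_on_def
proof (intro conjI ballI allI)
  show "subspace V" using assms(1) unfolding has_lie_algebra_def by blast
  fix v w a b assume "v \<in> V" "w \<in> V"
  then have "velocity M (\<lambda>t. expo Q (t *\<^sub>R (a *\<^sub>R v + b *\<^sub>R w))) f =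
      a * velocity M (\<lambda>t. expo Q (t *\<^sub>R v)) f + b * velocity M (\<lambda>t. expo Q (t *\<^sub>R w)) f"
    using assms unfolding has_lie_algebra_def by blast
  then show "deriv (\<lambda>t. f (expo Q (t *\<^sub>R (a *\<^sub>R v + b *\<^sub>R w)))) 0 =
      a * deriv (\<lambda>t. f (expo Q (t *\<^sub>R v))) 0 + b * deriv (\<lambda>t. f (expo Q (t *\<^sub>R w))) 0"
    using assms(2) by (simp add: velocity_def)
qed

lemma linear_functional_on_mono:
  "linear_functional_on V L \<Longrightarrow> W \<subseteq> V \<Longrightarrow> subspace W \<Longrightarrow> linear_functional_on W L"
  unfolding linear_functional_on_def by blast

text \<open>With \<open>s = d G\<close>, the curve \<open>exp (t v) s\<close> is the image of \<open>exp (t v)\<close> under the smooth map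
  \<open>d' \<mapsto> d' d G\<close> from \<open>D\<close>, which reduces the claim to the unit of \<open>D\<close>.\<close>

lemma linear_functional_act_S:
  assumes s: "s \<in> points S" and a: "a \<in> Cinf S"
  shows "linear_functional_on UNIV (\<lambda>v. generator (expo Q) (act_S Q) v [a] s)"
proof -
  obtain d where d: "d \<in> carrier (Dgrp Q)" "s = coset_proj Q d" using s points_S by blast
  have "smooth_map (Dmfd Q) S (coset_proj Q)" using submersion_coset by (simp add: submersion_def)
  then have "(\<lambda>x. a (coset_proj Q x)) \<in> Cinf (Dmfd Q)"
    using a by (rule Cinf_compose[OF charted_D charted_S])
  then have f: "(\<lambda>x. a (coset_proj Q (x \<cdot> d))) \<in> Cinf (Dmfd Q)"
    by (rule Cinf_compose[OF charted_D charted_D smooth_right_mult[OF lie_group_D d(1)]])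
  have "act_S Q x s = coset_proj Q (x \<cdot> d)" if "x \<in> carrier (Dgrp Q)" for x
    using that d group.lcos_m_assoc[OF group_D G_subset_D] by (simp add: act_S_def coset_proj_def)
  then show ?thesis
    using linear_functional_expo[OF lie_algebra_D f] by (simp add: generator_eq expo_in_D)
qed

lemma linear_functional_left:
  assumes g: "g \<in> points G" and f: "f \<in> Cinf G"
  shows "linear_functional_on (gsub Q) (\<lambda>\<xi>. deriv (\<lambda>t. f (g \<cdot> expo Q (t *\<^sub>R \<xi>))) 0)"
proof -
  have "(\<lambda>x. f (g \<cdot> x)) \<in> Cinf G"
    using Cinf_compose[OF charted_G charted_G smooth_left_mult(1)[OF lie_group_G] f] g by simp
  then show ?thesis by (rule linear_functional_expo[OF lie_algebra_G])
qed

lemma lambda_S: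
  assumes s: "s \<in> points S" and a: "a \<in> Cinf S"
  shows "lambda_S Q s a = (\<Sum>i<gdim Q. generator (expo Q) (act_S Q) (\<epsilon> i) [a] s *\<^sub>R \<ee> i)"
    and "lambda_S Q s a \<in> gsub Q"
    and "\<eta> \<in> hsub Q \<Longrightarrow> form Q (lambda_S Q s a) \<eta> = generator (expo Q) (act_S Q) \<eta> [a] s"
proof -
  have L: "linear_functional_on (hsub Q) (\<lambda>v. generator (expo Q) (act_S Q) v [a] s)"
    by (rule linear_functional_on_mono[OF linear_functional_act_S[OF s a] subset_UNIV subspace_h])
  have h: "\<eta> = (\<Sum>i<gdim Q. form Q (\<ee> i) \<eta> *\<^sub>R \<epsilon> i)" if "\<eta> \<in> hsub Q" for \<eta>
    using expand_h[OF that] by (subst form_sym)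
  note * = dual_vector[OF form_bilinear L subspace_g, of "gdim Q" \<ee> \<epsilon>, OF e_in_g \<epsilon>_in_h expand_g h]
  show "lambda_S Q s a = (\<Sum>i<gdim Q. generator (expo Q) (act_S Q) (\<epsilon> i) [a] s *\<^sub>R \<ee> i)"
    unfolding lambda_S_def by (rule *(1))
  then show "lambda_S Q s a \<in> gsub Q"
    "\<eta> \<in> hsub Q \<Longrightarrow> form Q (lambda_S Q s a) \<eta> = generator (expo Q) (act_S Q) \<eta> [a] s"
    using *(2,3) by simp_all
qed

lemma left_pullback:
  assumes g: "g \<in> points G" and f: "f \<in> Cinf G"
  shows "left_pullback Q g f \<in> hsub Q"
    and "\<xi> \<in> gsub Q \<Longrightarrow> form Q (left_pullback Q g f) \<xi> = deriv (\<lambda>t. f (g \<cdot> expo Q (t *\<^sub>R \<xi>))) 0"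
proof -
  have gx: "\<xi> = (\<Sum>i<gdim Q. form Q (\<epsilon> i) \<xi> *\<^sub>R \<ee> i)" if "\<xi> \<in> gsub Q" for \<xi>
    using expand_g[OF that] by (subst form_sym)
  note * = dual_vector[OF form_bilinear linear_functional_left[OF g f] subspace_h, of "gdim Q" \<epsilon> \<ee>,
      OF \<epsilon>_in_h e_in_g expand_h gx]
  have "left_pullback Q g f = (\<Sum>i<gdim Q. deriv (\<lambda>t. f (g \<cdot> expo Q (t *\<^sub>R \<ee> i))) 0 *\<^sub>R \<epsilon> i)"
    unfolding left_pullback_def by (rule *(1))
  then show "left_pullback Q g f \<in> hsub Q"
    "\<xi> \<in> gsub Q \<Longrightarrow> form Q (left_pullback Q g f) \<xi> = deriv (\<lambda>t. f (g \<cdot> expo Q (t *\<^sub>R \<xi>))) 0"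
    using *(2,3) by simp_all
qed

text \<open>Both sides are the pairing of \<open>L\<^sub>g\<^sup>* \<theta>\<^sub>g \<in> \<hh>\<close> with \<open>\<lambda>(\<theta>\<^sub>s) \<in> \<gg>\<close>.  This
  converts the mixed terms of the bivector field of the groupoid into derivatives along the group.\<close>

lemma mixed_term:
  assumes "g \<in> points G" "f \<in> Cinf G" "s \<in> points S" "a \<in> Cinf S"
  shows "generator (expo Q) (act_S Q) (left_pullback Q g f) [a] s =
    deriv (\<lambda>t. f (g \<cdot> expo Q (t *\<^sub>R lambda_S Q s a))) 0"
  using lambda_S(3)[OF assms(3,4) left_pullback(1)[OF assms(1,2)]]
    left_pullback(2)[OF assms(1,2) lambda_S(2)[OF assms(3,4)]] form_sym by metis

lemma PiS_eq:
  assumes s: "s \<in> points S" and a: "a \<in> Cinf S" and b: "b \<in> Cinf S"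
  shows "PiS Q [a, b] s = - generator (expo Q) (act_S Q) (lambda_S Q s a) [b] s"
  unfolding lambda_S(1)[OF s a] linear_functional_on_sum[OF linear_functional_act_S[OF s b], OF UNIV_I]
  by (simp add: PiS_def)

section \<open>Bivector field on \<open>\<Gamma> \<times> X \<times> X\<close> and trivector field\<close>

lemma Gamma_simps [simp]:
  "arrows (Gamma_groupoid Q) = G \<times>\<^sub>m S" "base (Gamma_groupoid Q) = S" "tgt (Gamma_groupoid Q) = snd"
  "src (Gamma_groupoid Q) (g, s) = act_S Q g s" "idn (Gamma_groupoid Q) s = (\<one>\<^bsub>Dgrp Q\<^esub>, s)"
  "gcomp (Gamma_groupoid Q) (g, s') (h, s) = (g \<cdot> h, s)"
  by (simp_all add: Gamma_groupoid_def)

definition triple_bivector :: "'x mv \<Rightarrow> (('d \<times> 'd set) \<times> 'x \<times> 'x) mv" where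
  "triple_bivector PiX = biv (Gamma_groupoid Q) \<oplus>\<^sub>m PiX \<oplus>\<^sub>m (\<lambda>fs x. - PiX fs x)"

lemma triple_bivector_eq:
  "triple_bivector PiX [F, H] ((g, s), x, y) =
     PiG Q [\<lambda>g'. F ((g', s), x, y), \<lambda>g'. H ((g', s), x, y)] g
     - PiS Q [\<lambda>s'. F ((g, s'), x, y), \<lambda>s'. H ((g, s'), x, y)] s
     + generator (expo Q) (act_S Q) (left_pullback Q g (\<lambda>g'. F ((g', s), x, y))) [\<lambda>s'. H ((g, s'), x, y)] s
     - generator (expo Q) (act_S Q) (left_pullback Q g (\<lambda>g'. H ((g', s), x, y))) [\<lambda>s'. F ((g, s'), x, y)] s
     + PiX [\<lambda>x'. F ((g, s), x', y), \<lambda>x'. H ((g, s), x', y)] x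
     - PiX [\<lambda>y'. F ((g, s), x, y'), \<lambda>y'. H ((g, s), x, y')] y"
  by (simp add: triple_bivector_def direct_sum_def Gamma_groupoid_def Pi_Gamma_def Let_def)

lemma hat_const_section_wedge:
  assumes "length fs = length \<xi>s"
  shows "wedge (map (const_section Q) \<xi>s) (map (\<lambda>f c. f (act c x)) fs) (J x) =
    wedge (map (generator (expo Q) (\<lambda>g x. act (g, J x) x)) \<xi>s) fs x"
proof -
  have "(\<Prod>i<length \<xi>s. (map (const_section Q) \<xi>s ! i) [map (\<lambda>f c. f (act c x)) fs ! \<pi> i] (J x)) =
      (\<Prod>i<length \<xi>s. (map (generator (expo Q) (\<lambda>g x. act (g, J x) x)) \<xi>s ! i) [fs ! \<pi> i] x)"
    if \<pi>: "\<pi> permutes {..<length \<xi>s}" for \<pi>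
  proof (intro prod.cong refl)
    fix i assume i: "i \<in> {..<length \<xi>s}"
    then have "\<pi> i < length fs" using permutes_in_image[OF \<pi>, of i] assms by auto
    then show "(map (const_section Q) \<xi>s ! i) [map (\<lambda>f c. f (act c x)) fs ! \<pi> i] (J x) =
        (map (generator (expo Q) (\<lambda>g x. act (g, J x) x)) \<xi>s ! i) [fs ! \<pi> i] x"
      using i by (simp add: const_section_def generator_eq)
  qed
  then show ?thesis unfolding wedge_def length_map by (intro sum.cong refl) simp
qed

text \<open>The curve \<open>(exp (t \<xi>), J x)\<close> in the fibre of the target map over \<open>J x\<close> moves \<open>x\<close> along \<open>exp (t \<xi>) x\<close>;
  so the vector field on \<open>X\<close> induced by the constant section \<open>\<xi>\<close> is \<open>\<xi>\<^sub>X\<close>.\<close>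

lemma hat_Om3:
  "hat act J (Om3 (Gamma_groupoid Q)) [f1, f2, f3] x =
     ext3 (gdim Q) (Om_coeff Q) (\<lambda>i. generator (expo Q) (\<lambda>g x. act (g, J x) x) (\<ee> i)) [f1, f2, f3] x"
proof -
  have "wedge [const_section Q (\<ee> i), const_section Q (\<ee> j), const_section Q (\<ee> k)]
        [\<lambda>c. f1 (act c x), \<lambda>c. f2 (act c x), \<lambda>c. f3 (act c x)] (J x) =
      wedge [generator (expo Q) (\<lambda>g x. act (g, J x) x) (\<ee> i),
        generator (expo Q) (\<lambda>g x. act (g, J x) x) (\<ee> j),
        generator (expo Q) (\<lambda>g x. act (g, J x) x) (\<ee> k)] [f1, f2, f3] x" for i j k
    using hat_const_section_wedge[of "[f1, f2, f3]" "[\<ee> i, \<ee> j, \<ee> k]" act x J] by simp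
  then show ?thesis by (simp add: hat_def Gamma_groupoid_def ext3_def)
qed

lemma bivector_PiG: "bivector_field G (PiG Q)"
  using PiG by (simp add: is_PiG_def)

lemma one_in_G: "\<one>\<^bsub>Dgrp Q\<^esub> \<in> points G"
  using subgroup.one_closed[OF subgroup_G] .

lemma one_mult: "g \<in> points G \<Longrightarrow> \<one>\<^bsub>Dgrp Q\<^esub> \<cdot> g = g" and mult_one: "g \<in> points G \<Longrightarrow> g \<cdot> \<one>\<^bsub>Dgrp Q\<^esub> = g"
  using G_subset_D monoid.l_one[OF group.is_monoid[OF group_D]] monoid.r_one[OF group.is_monoid[OF group_D]]
  by blast+

lemma left_translated_curve:
  assumes "g \<in> points G" "\<xi> \<in> gsub Q"
  shows "(\<lambda>t. g \<cdot> expo Q (t *\<^sub>R \<xi>)) \<in> curves_at G g"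
proof -
  have "smooth_map_on {-1<..<1} real_mfd G (\<lambda>t. expo Q (t *\<^sub>R \<xi>))"
    by (rule smooth_map_on_restrict[OF expo_curve(1)[OF lie_algebra_G assms(2)]]) auto
  then have "(\<lambda>t. expo Q (t *\<^sub>R \<xi>)) \<in> curves_at G \<one>\<^bsub>Dgrp Q\<^esub>"
    by (intro curves_atI[of _ _ 1]) (simp_all add: expo_zero)
  from curves_at_map[OF charted_G charted_G smooth_left_mult(1)[OF lie_group_G] this, of g]
  show ?thesis using assms(1) by (simp add: mult_one)
qed

section \<open>From quasi-hamiltonian spaces to Hamiltonian spaces\<close>

context
  fixes X :: "('x, 'ex::euclidean_space) mfd" and PiX :: "'x mv"
    and \<Phi> :: "'d \<Rightarrow> 'x \<Rightarrow> 'x" and J :: "'x \<Rightarrow> 'd set"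
  assumes qh: "quasi_hamiltonian_space Q X PiX \<Phi> J"
begin

lemma qh_manifold: "manifold X" "charted X" and qh_bivector: "bivector_field X PiX"
  and qh_J: "smooth_map X S J"
  and qh_action: "smooth_action (Ggrp Q) G X \<Phi>"
  and qh_push: "pushes_to (G \<times>\<^sub>m X) X (\<lambda>(g, x). \<Phi> g x) (PiG Q \<oplus>\<^sub>m PiX) PiX"
  using qh by (auto simp: quasi_hamiltonian_space_def quasi_poisson_action_def manifold_charted)

lemma qh_equivariant: "g \<in> points G \<Longrightarrow> x \<in> points X \<Longrightarrow> J (\<Phi> g x) = act_S Q g (J x)"
  and qh_moment: "x \<in> points X \<Longrightarrow> a \<in> Cinf S \<Longrightarrow> f \<in> Cinf X \<Longrightarrow>
    PiX [\<lambda>x. a (J x), f] x = - generator (expo Q) \<Phi> (lambda_S Q (J x) a) [f] x"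
  using qh by (simp_all add: quasi_hamiltonian_space_def comp_def)

lemma qh_\<Phi>_smooth: "smooth_map (G \<times>\<^sub>m X) X (\<lambda>(g, x). \<Phi> g x)"
  and qh_\<Phi>_one: "x \<in> points X \<Longrightarrow> \<Phi> \<one>\<^bsub>Dgrp Q\<^esub> x = x"
  and qh_\<Phi>_mult: "g \<in> points G \<Longrightarrow> h \<in> points G \<Longrightarrow> x \<in> points X \<Longrightarrow> \<Phi> (g \<cdot> h) x = \<Phi> g (\<Phi> h x)"
  using qh_action by (auto simp: smooth_action_def)

lemma qh_\<Phi>_in_X: "g \<in> points G \<Longrightarrow> x \<in> points X \<Longrightarrow> \<Phi> g x \<in> points X"
  using smooth_map_on_into[OF qh_\<Phi>_smooth, of "(g, x)"] by simp

lemma qh_J_in_S: "x \<in> points X \<Longrightarrow> J x \<in> points S"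
  by (rule smooth_map_on_into[OF qh_J])

lemma qh_orbit_map: "x \<in> points X \<Longrightarrow> smooth_map G X (\<lambda>g. \<Phi> g x)"
  and qh_diffeo: "g \<in> points G \<Longrightarrow> smooth_map X X (\<Phi> g)"
  by (intro smooth_map_compose2[OF charted_G charted_G qh_manifold(2) qh_manifold(2) qh_\<Phi>_smooth]
        smooth_map_compose2[OF qh_manifold(2) charted_G qh_manifold(2) qh_manifold(2) qh_\<Phi>_smooth]
        smooth_map_on_id smooth_map_on_const charted_G qh_manifold openin_topspace, assumption)+

abbreviation "qh_act \<equiv> \<lambda>(g, s) x. \<Phi> g x"
abbreviation "qh_graph \<equiv> action_graph (Gamma_groupoid Q) X qh_act J"

lemma qh_groupoid_space: "groupoid_space (Gamma_groupoid Q) X qh_act J"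
proof -
  let ?M = "(G \<times>\<^sub>m S) \<times>\<^sub>m X"
  have c: "charted (G \<times>\<^sub>m S)" "charted ?M"
    by (intro charted_prod charted_G charted_S qh_manifold)+
  have fst_fst: "smooth_map ?M G (\<lambda>p. fst (fst p))"
    using smooth_map_on_into[OF smooth_map_fst[OF c(1) qh_manifold(2)]]
    by (intro smooth_map_on_compose[OF c(2) c(1) charted_G smooth_map_fst[OF c(1) qh_manifold(2)]
          smooth_map_fst[OF charted_G charted_S]]) blast
  have "smooth_map ?M X (\<lambda>p. \<Phi> (fst (fst p)) (snd p))"
    by (rule smooth_map_compose2[OF c(2) charted_G qh_manifold(2) qh_manifold(2) qh_\<Phi>_smooth fst_fst
          smooth_map_snd[OF c(1) qh_manifold(2)]])
  then have "smooth_map_on_subset {(c, x). c \<in> points (G \<times>\<^sub>m S) \<and> x \<in> points X \<and> snd c = J x}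
      ?M X (\<lambda>(c, x). qh_act c x)"
    unfolding smooth_map_on_subset_def
    by (intro ballI exI[of _ "points ?M"] exI[of _ "\<lambda>p. \<Phi> (fst (fst p)) (snd p)"]) auto
  then show ?thesis
    unfolding groupoid_space_def using qh_manifold(1) qh_J qh_equivariant qh_\<Phi>_mult qh_\<Phi>_one
    by auto
qed

text \<open>A conormal covector of the graph is determined by its components \<open>\<theta>\<^sub>s\<close> and \<open>\<tau>\<close> (on the last
  factor): since the graph is parametrised by \<open>(g, x)\<close>, vanishing on its tangent vectors means
  \<open>\<theta>\<^sub>g = - \<Phi>\<^sub>x\<^sup>* \<tau>\<close> and \<open>\<sigma> = - J\<^sup>* \<theta>\<^sub>s - \<Phi>\<^sub>g\<^sup>* \<tau>\<close>.\<close>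

lemma qh_conormal:
  assumes g: "g \<in> points G" and x: "x \<in> points X"
    and F: "F \<in> conormal ((G \<times>\<^sub>m S) \<times>\<^sub>m X \<times>\<^sub>m X) qh_graph ((g, J x), x, \<Phi> g x)"
  shows "(\<lambda>g'. F ((g', J x), x, \<Phi> g x)) \<in> Cinf G" "(\<lambda>s. F ((g, s), x, \<Phi> g x)) \<in> Cinf S"
    and "(\<lambda>x'. F ((g, J x), x', \<Phi> g x)) \<in> Cinf X" "(\<lambda>y. F ((g, J x), x, y)) \<in> Cinf X"
    and "\<gamma> \<in> curves_at G g \<Longrightarrow> deriv (\<lambda>t. F ((\<gamma> t, J x), x, \<Phi> g x)) 0 =
      - deriv (\<lambda>t. F ((g, J x), x, \<Phi> (\<gamma> t) x)) 0"
    and "\<delta> \<in> curves_at X x \<Longrightarrow> deriv (\<lambda>t. F ((g, J x), \<delta> t, \<Phi> g x)) 0 =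
      - deriv (\<lambda>t. F ((g, J (\<delta> t)), x, \<Phi> g x)) 0 - deriv (\<lambda>t. F ((g, J x), x, \<Phi> g (\<delta> t))) 0"
proof -
  let ?s = "J x" and ?y = "\<Phi> g x"
  note X = qh_manifold(2)
  have GS: "charted (G \<times>\<^sub>m S)" and XX: "charted (X \<times>\<^sub>m X)" and M: "charted ((G \<times>\<^sub>m S) \<times>\<^sub>m X \<times>\<^sub>m X)"
    by (intro charted_prod charted_G charted_S X)+
  have s: "?s \<in> points S" and y: "?y \<in> points X" using g x qh_J_in_S qh_\<Phi>_in_X by auto
  have FC: "F \<in> Cinf ((G \<times>\<^sub>m S) \<times>\<^sub>m X \<times>\<^sub>m X)" using F by (rule conormalD)
  note intros = smooth_map_on_Pair smooth_map_on_id smooth_map_on_const openin_topspace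
    charted_G charted_S X g s x y
  show "(\<lambda>g'. F ((g', ?s), x, ?y)) \<in> Cinf G" by (rule Cinf_compose[OF charted_G M _ FC]) (intro intros)
  show "(\<lambda>s'. F ((g, s'), x, ?y)) \<in> Cinf S" by (rule Cinf_compose[OF charted_S M _ FC]) (intro intros)
  show "(\<lambda>x'. F ((g, ?s), x', ?y)) \<in> Cinf X" by (rule Cinf_compose[OF X M _ FC]) (intro intros)
  show "(\<lambda>y'. F ((g, ?s), x, y')) \<in> Cinf X" by (rule Cinf_compose[OF X M _ FC]) (intro intros)
  have XXF: "(\<lambda>z. F ((g, ?s), z)) \<in> Cinf (X \<times>\<^sub>m X)"
    by (rule Cinf_compose[OF XX M _ FC])
      (intro smooth_map_on_Pair[of _ _ "G \<times>\<^sub>m S"] intros XX)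
  show "deriv (\<lambda>t. F ((\<gamma> t, ?s), x, ?y)) 0 = - deriv (\<lambda>t. F ((g, ?s), x, \<Phi> (\<gamma> t) x)) 0"
    if \<gamma>: "\<gamma> \<in> curves_at G g"
  proof -
    have 1: "(\<lambda>t. (\<gamma> t, ?s)) \<in> curves_at (G \<times>\<^sub>m S) (g, ?s)"
      by (intro curves_at_Pair \<gamma> curves_at_const s)
    have 2: "(\<lambda>t. (x, \<Phi> (\<gamma> t) x)) \<in> curves_at (X \<times>\<^sub>m X) (x, ?y)"
      by (intro curves_at_Pair curves_at_const x curves_at_map[OF charted_G X qh_orbit_map[OF x] \<gamma>])
    have "\<forall>\<^sub>F t in nhds 0. ((\<gamma> t, ?s), x, \<Phi> (\<gamma> t) x) \<in> qh_graph"
      using curves_at_points[OF \<gamma>] by eventually_elim (use s x in \<open>auto simp: action_graph_def\<close>)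
    then have "deriv (\<lambda>t. F ((\<gamma> t, ?s), x, \<Phi> (\<gamma> t) x)) 0 = 0"
      by (rule conormalD(2)[OF F curves_at_Pair[OF 1 2]])
    then show ?thesis using deriv_along_Pair[OF GS XX FC 1 2] by simp
  qed
  show "deriv (\<lambda>t. F ((g, ?s), \<delta> t, ?y)) 0 =
      - deriv (\<lambda>t. F ((g, J (\<delta> t)), x, ?y)) 0 - deriv (\<lambda>t. F ((g, ?s), x, \<Phi> g (\<delta> t))) 0"
    if \<delta>: "\<delta> \<in> curves_at X x"
  proof -
    have 1: "(\<lambda>t. (g, J (\<delta> t))) \<in> curves_at (G \<times>\<^sub>m S) (g, ?s)"
      by (intro curves_at_Pair curves_at_const g curves_at_map[OF X charted_S qh_J \<delta>])
    have 2: "(\<lambda>t. \<Phi> g (\<delta> t)) \<in> curves_at X ?y"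
      by (rule curves_at_map[OF X X qh_diffeo[OF g] \<delta>])
    have "\<forall>\<^sub>F t in nhds 0. ((g, J (\<delta> t)), \<delta> t, \<Phi> g (\<delta> t)) \<in> qh_graph"
      using curves_at_points[OF \<delta>] by eventually_elim (use g qh_J_in_S in \<open>auto simp: action_graph_def\<close>)
    then have "deriv (\<lambda>t. F ((g, J (\<delta> t)), \<delta> t, \<Phi> g (\<delta> t))) 0 = 0"
      by (rule conormalD(2)[OF F curves_at_Pair[OF 1 curves_at_Pair[OF \<delta> 2]]])
    then show ?thesis
      using deriv_along_Pair[OF GS XX FC 1 curves_at_Pair[OF \<delta> 2]] deriv_along_Pair[OF X X XXF \<delta> 2]
      by simp
  qed
qed

lemma qh_coisotropic: "coisotropic ((G \<times>\<^sub>m S) \<times>\<^sub>m X \<times>\<^sub>m X) (triple_bivector PiX) qh_graph"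
  unfolding coisotropic_def
proof (intro ballI)
  fix p F H assume "p \<in> qh_graph"
    and F: "F \<in> conormal ((G \<times>\<^sub>m S) \<times>\<^sub>m X \<times>\<^sub>m X) qh_graph p"
    and H: "H \<in> conormal ((G \<times>\<^sub>m S) \<times>\<^sub>m X \<times>\<^sub>m X) qh_graph p"
  then obtain g x where p: "p = ((g, J x), x, \<Phi> g x)" and g: "g \<in> points G" and x: "x \<in> points X"
    by (auto simp: action_graph_def)
  note X = qh_manifold(2)
  let ?s = "J x" and ?y = "\<Phi> g x"
  have s: "?s \<in> points S" and y: "?y \<in> points X" using g x qh_J_in_S qh_\<Phi>_in_X by auto
  note F = qh_conormal[OF g x F[unfolded p]] and H = qh_conormal[OF g x H[unfolded p]]
  define \<theta>g \<theta>s \<sigma> \<tau> where F_parts: "\<theta>g = (\<lambda>g'. F ((g', ?s), x, ?y))" "\<theta>s = (\<lambda>s. F ((g, s), x, ?y))"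
    "\<sigma> = (\<lambda>x'. F ((g, ?s), x', ?y))" "\<tau> = (\<lambda>y'. F ((g, ?s), x, y'))"
  define \<theta>g' \<theta>s' \<sigma>' \<tau>' where H_parts: "\<theta>g' = (\<lambda>g'. H ((g', ?s), x, ?y))" "\<theta>s' = (\<lambda>s. H ((g, s), x, ?y))"
    "\<sigma>' = (\<lambda>x'. H ((g, ?s), x', ?y))" "\<tau>' = (\<lambda>y'. H ((g, ?s), x, y'))"
  note smooth = F(1-4)[folded F_parts] H(1-4)[folded H_parts]
  have pull: "(\<lambda>g'. f (\<Phi> g' x)) \<in> Cinf G" "(\<lambda>x. f (\<Phi> g x)) \<in> Cinf X" if "f \<in> Cinf X" for f
    using Cinf_compose[OF charted_G X qh_orbit_map[OF x] that] Cinf_compose[OF X X qh_diffeo[OF g] that] .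
  have pullJ: "(\<lambda>x. a (J x)) \<in> Cinf X" if "a \<in> Cinf S" for a
    using Cinf_compose[OF X charted_S qh_J that] .
  have curve_g: "deriv (\<lambda>t. \<theta>g (\<gamma> t)) 0 = - deriv (\<lambda>t. \<tau> (\<Phi> (\<gamma> t) x)) 0"
    "deriv (\<lambda>t. \<theta>g' (\<gamma> t)) 0 = - deriv (\<lambda>t. \<tau>' (\<Phi> (\<gamma> t) x)) 0" if "\<gamma> \<in> curves_at G g" for \<gamma>
    using F(5)[OF that] H(5)[OF that] by (simp_all add: F_parts H_parts)

  have G_part: "PiG Q [\<theta>g, \<theta>g'] g = PiG Q [\<lambda>g'. \<tau> (\<Phi> g' x), \<lambda>g'. \<tau>' (\<Phi> g' x)] g"
  proof -
    have cov: "same_covector G g \<theta> (\<lambda>g'. - 1 * f (\<Phi> g' x) + 0)"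
      if "\<theta> \<in> Cinf G" "f \<in> Cinf X"
        "\<And>\<gamma>. \<gamma> \<in> curves_at G g \<Longrightarrow> deriv (\<lambda>t. \<theta> (\<gamma> t)) 0 = - deriv (\<lambda>t. f (\<Phi> (\<gamma> t) x)) 0" for \<theta> f
    proof (rule same_covectorI[OF that(1)])
      show "(\<lambda>g'. - 1 * f (\<Phi> g' x) + 0) \<in> Cinf G" using Cinf_minus[OF pull(1)[OF that(2)]] by simp
      fix \<gamma> assume \<gamma>: "\<gamma> \<in> curves_at G g"
      then show "deriv (\<lambda>t. \<theta> (\<gamma> t)) 0 = deriv (\<lambda>t. - 1 * f (\<Phi> (\<gamma> t) x) + 0) 0"
        using deriv_lincomb_along_curve[OF charted_G pull(1)[OF that(2)] pull(1)[OF that(2)] \<gamma>, of "-1" 0]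
        by (simp add: that(3))
    qed
    have "PiG Q [\<theta>g, \<theta>g'] g = PiG Q [\<lambda>g'. - 1 * \<tau> (\<Phi> g' x) + 0, \<lambda>g'. - 1 * \<tau>' (\<Phi> g' x) + 0] g"
      using Cinf_minus[OF pull(1)] smooth
      by (intro bivector_cong[OF bivector_PiG g] cov curve_g) auto
    also have "\<dots> = PiG Q [\<lambda>g'. \<tau> (\<Phi> g' x), \<lambda>g'. \<tau>' (\<Phi> g' x)] g"
      using bivector_affine[OF bivector_PiG g pull(1) pull(1), of \<tau> \<tau>' "-1" 0 "-1" 0] smooth by simp
    finally show ?thesis .
  qed

  \<comment> \<open>\<open>?A\<close> and \<open>?T\<close> represent the pullbacks \<open>J\<^sup>*\<theta>\<^sub>s\<close> and \<open>\<Phi>\<^sub>g\<^sup>*\<tau>\<close>.\<close>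
  let ?A = "\<lambda>x. \<theta>s (J x)" and ?A' = "\<lambda>x. \<theta>s' (J x)"
    and ?T = "\<lambda>x. \<tau> (\<Phi> g x)" and ?T' = "\<lambda>x. \<tau>' (\<Phi> g x)"
  have AT: "?A \<in> Cinf X" "?A' \<in> Cinf X" "?T \<in> Cinf X" "?T' \<in> Cinf X"
    using smooth pull(2) pullJ by auto
  have X_part: "PiX [\<sigma>, \<sigma>'] x = PiX [?A, ?A'] x + PiX [?A, ?T'] x - PiX [?A', ?T] x + PiX [?T, ?T'] x"
  proof -
    have cov: "same_covector X x \<sigma> (\<lambda>x'. - 1 * a x' + - 1 * b x')"
      if "\<sigma> \<in> Cinf X" "a \<in> Cinf X" "b \<in> Cinf X"
        "\<And>\<delta>. \<delta> \<in> curves_at X x \<Longrightarrow> deriv (\<lambda>t. \<sigma> (\<delta> t)) 0 = - deriv (\<lambda>t. a (\<delta> t)) 0 - deriv (\<lambda>t. b (\<delta> t)) 0"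
      for \<sigma> a b
    proof (rule same_covectorI[OF that(1) Cinf_lincomb[OF that(2,3)]])
      fix \<delta> assume \<delta>: "\<delta> \<in> curves_at X x"
      show "deriv (\<lambda>t. \<sigma> (\<delta> t)) 0 = deriv (\<lambda>t. - 1 * a (\<delta> t) + - 1 * b (\<delta> t)) 0"
        unfolding deriv_lincomb_along_curve[OF X that(2,3) \<delta>] that(4)[OF \<delta>] by simp
    qed
    have c: "same_covector X x \<sigma> (\<lambda>x'. - 1 * ?A x' + - 1 * ?T x')"
      using F(6) by (intro cov smooth AT) (simp add: F_parts)
    have c': "same_covector X x \<sigma>' (\<lambda>x'. - 1 * ?A' x' + - 1 * ?T' x')"
      using H(6) by (intro cov smooth AT) (simp add: H_parts)
    note C = Cinf_lincomb[OF AT(1,3), of "-1" "-1"] and C' = Cinf_lincomb[OF AT(2,4), of "-1" "-1"]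
    have "PiX [\<sigma>, \<sigma>'] x = PiX [\<lambda>x'. - 1 * ?A x' + - 1 * ?T x', \<lambda>x'. - 1 * ?A' x' + - 1 * ?T' x'] x"
      by (rule bivector_cong[OF qh_bivector x smooth(3) C smooth(7) C' c c'])
    also have "\<dots> = PiX [?A, ?A'] x + PiX [?A, ?T'] x + PiX [?T, ?A'] x + PiX [?T, ?T'] x"
      unfolding bivector_lincomb_left[OF qh_bivector x AT(1,3) C']
        bivector_lincomb_right[OF qh_bivector x AT(1) AT(2,4)]
        bivector_lincomb_right[OF qh_bivector x AT(3) AT(2,4)] by simp
    finally show ?thesis using bivector_skew[OF qh_bivector x AT(3,2)] by simp
  qed

  \<comment> \<open>The action pushes \<open>\<Pi>\<^sub>G \<oplus> \<Pi>\<^sub>X\<close> to \<open>\<Pi>\<^sub>X\<close>.\<close>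
  have Y_part: "PiX [\<tau>, \<tau>'] ?y = PiG Q [\<lambda>g'. \<tau> (\<Phi> g' x), \<lambda>g'. \<tau>' (\<Phi> g' x)] g + PiX [?T, ?T'] x"
    using qh_push g x smooth(4,8) by (force simp: pushes_to_def direct_sum_def)

  \<comment> \<open>By equivariance \<open>J\<close> carries the vector field of \<open>\<lambda>(\<theta>\<^sub>s)\<close> on \<open>X\<close> to the one on \<open>S\<close>.\<close>
  have S_part: "PiX [?A, ?A'] x = PiS Q [\<theta>s, \<theta>s'] ?s"
  proof -
    have "expo Q (t *\<^sub>R lambda_S Q ?s \<theta>s) \<in> points G" for t
      by (rule expo_in_G[OF lambda_S(2)[OF s smooth(2)]])
    then show ?thesis
      unfolding PiS_eq[OF s smooth(2,6)] qh_moment[OF x smooth(2) AT(2)] generator_eq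
      by (simp add: qh_equivariant x)
  qed

  \<comment> \<open>The momentum map condition moves \<open>x\<close> along \<open>exp (t \<lambda>)\<close>; applying \<open>\<Phi>\<^sub>g\<close> turns this into the orbit
    map along \<open>g exp (t \<lambda>)\<close>, where \<open>f \<circ> \<Phi>\<^sub>x\<close> has the differential \<open>- \<theta>\<close>.\<close>
  have mixed: "PiX [\<lambda>x. a (J x), \<lambda>x. f (\<Phi> g x)] x =
      generator (expo Q) (act_S Q) (left_pullback Q g \<theta>) [a] ?s"
    if "a \<in> Cinf S" "f \<in> Cinf X" "\<theta> \<in> Cinf G"
      "\<And>\<gamma>. \<gamma> \<in> curves_at G g \<Longrightarrow> deriv (\<lambda>t. \<theta> (\<gamma> t)) 0 = - deriv (\<lambda>t. f (\<Phi> (\<gamma> t) x)) 0" for a f \<theta>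
  proof -
    let ?\<xi> = "lambda_S Q ?s a"
    have \<xi>: "?\<xi> \<in> gsub Q" by (rule lambda_S(2)[OF s that(1)])
    have "PiX [\<lambda>x. a (J x), \<lambda>x. f (\<Phi> g x)] x = - deriv (\<lambda>t. f (\<Phi> (g \<cdot> expo Q (t *\<^sub>R ?\<xi>)) x)) 0"
      unfolding qh_moment[OF x that(1) pull(2)[OF that(2)]] generator_eq
      by (simp add: qh_\<Phi>_mult g x expo_in_G[OF \<xi>])
    also have "\<dots> = deriv (\<lambda>t. \<theta> (g \<cdot> expo Q (t *\<^sub>R ?\<xi>))) 0"
      using that(4)[OF left_translated_curve[OF g \<xi>]] by simp
    also have "\<dots> = generator (expo Q) (act_S Q) (left_pullback Q g \<theta>) [a] ?s"
      by (rule mixed_term[OF g that(3) s that(1), symmetric])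
    finally show ?thesis .
  qed
  have "PiX [?A, ?T'] x = generator (expo Q) (act_S Q) (left_pullback Q g \<theta>g') [\<theta>s] ?s"
    by (rule mixed[OF smooth(2,8,5) curve_g(2)])
  moreover have "PiX [?A', ?T] x = generator (expo Q) (act_S Q) (left_pullback Q g \<theta>g) [\<theta>s'] ?s"
    by (rule mixed[OF smooth(6,4,1) curve_g(1)])
  ultimately show "triple_bivector PiX [F, H] p = 0"
    unfolding p triple_bivector_eq F_parts[symmetric] H_parts[symmetric] G_part X_part Y_part S_part
    by simp
qed

lemma quasi_hamiltonian_imp_hamiltonian:
  "hamiltonian_groupoid_space (Gamma_groupoid Q) X PiX qh_act J"
  unfolding hamiltonian_groupoid_space_def
proof (intro conjI ballI)
  show "groupoid_space (Gamma_groupoid Q) X qh_act J" by (rule qh_groupoid_space)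
  show "bivector_field X PiX" by (rule qh_bivector)
  show "coisotropic (arrows (Gamma_groupoid Q) \<times>\<^sub>m X \<times>\<^sub>m X)
      (biv (Gamma_groupoid Q) \<oplus>\<^sub>m PiX \<oplus>\<^sub>m (\<lambda>fs x. - PiX fs x)) qh_graph"
    using qh_coisotropic by (simp add: triple_bivector_def)
  fix f1 f2 f3 x assume "f1 \<in> Cinf X" "f2 \<in> Cinf X" "f3 \<in> Cinf X" "x \<in> points X"
  then have "1/2 * schouten 2 2 PiX PiX [f1, f2, f3] x =
      ext3 (gdim Q) (Om_coeff Q) (\<lambda>i. generator (expo Q) \<Phi> (\<ee> i)) [f1, f2, f3] x"
    using qh by (simp add: quasi_hamiltonian_space_def quasi_poisson_action_def)
  then show "1/2 * schouten 2 2 PiX PiX [f1, f2, f3] x = hat qh_act J (Om3 (Gamma_groupoid Q)) [f1, f2, f3] x"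
    by (simp add: hat_Om3)
qed

end

section \<open>From Hamiltonian spaces to quasi-hamiltonian spaces\<close>

context
  fixes X :: "('x, 'ex::euclidean_space) mfd" and PiX :: "'x mv"
    and act :: "'d \<times> 'd set \<Rightarrow> 'x \<Rightarrow> 'x" and J :: "'x \<Rightarrow> 'd set"
  assumes ham: "hamiltonian_groupoid_space (Gamma_groupoid Q) X PiX act J"
begin

abbreviation "ham_action \<equiv> \<lambda>g x. act (g, J x) x"
abbreviation "ham_graph \<equiv> action_graph (Gamma_groupoid Q) X act J"

lemma ham_space: "groupoid_space (Gamma_groupoid Q) X act J"
  and ham_bivector: "bivector_field X PiX"
  and ham_coisotropic: "coisotropic ((G \<times>\<^sub>m S) \<times>\<^sub>m X \<times>\<^sub>m X) (triple_bivector PiX) ham_graph"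
  using ham by (simp_all add: hamiltonian_groupoid_space_def triple_bivector_def)

lemma ham_manifold: "manifold X" "charted X" and ham_J: "smooth_map X S J"
  using ham_space by (auto simp: groupoid_space_def manifold_charted)

lemma ham_J_in_S: "x \<in> points X \<Longrightarrow> J x \<in> points S"
  by (rule smooth_map_on_into[OF ham_J])

lemma ham_equivariant: "g \<in> points G \<Longrightarrow> x \<in> points X \<Longrightarrow> J (ham_action g x) = act_S Q g (J x)"
  and ham_one: "x \<in> points X \<Longrightarrow> ham_action \<one>\<^bsub>Dgrp Q\<^esub> x = x"
proof -
  have "\<forall>c\<in>points (arrows (Gamma_groupoid Q)). \<forall>x\<in>points X. tgt (Gamma_groupoid Q) c = J x \<longrightarrow>
      J (act c x) = src (Gamma_groupoid Q) c"
    and one: "\<forall>x\<in>points X. act (idn (Gamma_groupoid Q) (J x)) x = x"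
    using ham_space unfolding groupoid_space_def by - (elim conjE, assumption)+
  from this(1)[rule_format, of "(g, J x)" x]
  show "g \<in> points G \<Longrightarrow> x \<in> points X \<Longrightarrow> J (ham_action g x) = act_S Q g (J x)"
    using ham_J_in_S[of x] by simp
  show "x \<in> points X \<Longrightarrow> ham_action \<one>\<^bsub>Dgrp Q\<^esub> x = x" using one by simp
qed

text \<open>The action of \<open>\<Gamma>\<close> is smooth on a submanifold, that is, near each of its points it extends to a
  smooth map.  Precomposing the extensions with \<open>(g, x) \<mapsto> ((g, J x), x)\<close> shows smoothness on \<open>G \<times> X\<close>.\<close>

lemma ham_smooth: "smooth_map (G \<times>\<^sub>m X) X (\<lambda>(g, x). ham_action g x)"
proof (rule smooth_map_on_local)
  note X = ham_manifold(2)
  let ?M = "(G \<times>\<^sub>m S) \<times>\<^sub>m X" and ?\<iota> = "\<lambda>p. ((fst p, J (snd p)), snd p)"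
  have GX: "charted (G \<times>\<^sub>m X)" and M: "charted ?M" by (intro charted_prod charted_G charted_S X)+
  show "charted (G \<times>\<^sub>m X)" "charted X" by (fact GX, fact X)
  show "openin (mtop (G \<times>\<^sub>m X)) (points (G \<times>\<^sub>m X))" by (rule openin_topspace)
  fix p assume p: "p \<in> points (G \<times>\<^sub>m X)"
  have snd: "smooth_map (G \<times>\<^sub>m X) X snd" by (rule smooth_map_snd[OF charted_G X])
  have "smooth_map (G \<times>\<^sub>m X) S (\<lambda>p. J (snd p))"
    using smooth_map_on_into[OF snd] by (intro smooth_map_on_compose[OF GX X charted_S snd ham_J]) blast
  then have \<iota>: "smooth_map (G \<times>\<^sub>m X) ?M ?\<iota>"
    by (intro smooth_map_on_Pair snd smooth_map_fst[OF charted_G X])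
  let ?A = "{(c, x). c \<in> points (G \<times>\<^sub>m S) \<and> x \<in> points X \<and> snd c = J x}"
  have "smooth_map_on_subset ?A ?M X (\<lambda>(c, x). act c x)"
    using ham_space by (simp add: groupoid_space_def)
  moreover have \<iota>A: "?\<iota> q \<in> ?A" if "q \<in> points (G \<times>\<^sub>m X)" for q using that ham_J_in_S by auto
  note \<iota>A[OF p]
  ultimately have "\<exists>W F. ?\<iota> p \<in> W \<and> smooth_map_on W ?M X F \<and>
      (\<forall>q\<in>W \<inter> ?A. F q = (\<lambda>(c, x). act c x) q)"
    unfolding smooth_map_on_subset_def by (rule bspec)
  then obtain W F where W: "?\<iota> p \<in> W" "smooth_map_on W ?M X F"
    and F: "\<forall>q\<in>W \<inter> ?A. F q = (\<lambda>(c, x). act c x) q" by (elim exE conjE)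
  let ?V = "{q \<in> points (G \<times>\<^sub>m X). ?\<iota> q \<in> W}"
  have V: "openin (mtop (G \<times>\<^sub>m X)) ?V"
    by (rule smooth_map_on_preimage[OF \<iota> smooth_map_on_open[OF W(2)]])
  have "smooth_map_on ?V (G \<times>\<^sub>m X) X (\<lambda>q. F (?\<iota> q))"
    by (rule smooth_map_on_compose[OF GX M X smooth_map_on_restrict[OF \<iota> V] W(2)]) auto
  moreover have "F (?\<iota> q) = (\<lambda>(g, x). ham_action g x) q" if "q \<in> ?V" for q
  proof -
    have "?\<iota> q \<in> W" "?\<iota> q \<in> ?A" using that \<iota>A[of q] by simp_all
    then have "F (?\<iota> q) = (\<lambda>(c, x). act c x) (?\<iota> q)" by (intro bspec[OF F] IntI)
    then show ?thesis by (simp add: case_prod_beta)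
  qed
  ultimately show "\<exists>V F'. p \<in> V \<and> smooth_map_on V (G \<times>\<^sub>m X) X F' \<and>
      (\<forall>q\<in>V \<inter> points (G \<times>\<^sub>m X). F' q = (\<lambda>(g, x). ham_action g x) q)"
    using p W(1) by (intro exI[of _ ?V] exI[of _ "\<lambda>q. F (?\<iota> q)"] conjI ballI) (blast, assumption, blast)
qed

lemma ham_in_X: "g \<in> points G \<Longrightarrow> x \<in> points X \<Longrightarrow> ham_action g x \<in> points X"
  using smooth_map_on_into[OF ham_smooth, of "(g, x)"] by simp

lemma ham_mult:
  assumes "g \<in> points G" "h \<in> points G" "x \<in> points X"
  shows "ham_action (g \<cdot> h) x = ham_action g (ham_action h x)"
proof -
  have "act_S Q h (J x) \<in> points S"
    using ham_J_in_S[OF ham_in_X[OF assms(2,3)]] ham_equivariant[OF assms(2,3)] by simp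
  moreover have "\<forall>b\<in>points (arrows (Gamma_groupoid Q)). \<forall>c\<in>points (arrows (Gamma_groupoid Q)). \<forall>x\<in>points X.
      tgt (Gamma_groupoid Q) b = src (Gamma_groupoid Q) c \<and> tgt (Gamma_groupoid Q) c = J x \<longrightarrow>
      act (gcomp (Gamma_groupoid Q) b c) x = act b (act c x)"
    using ham_space unfolding groupoid_space_def by (elim conjE)
  note this[rule_format, of "(g, act_S Q h (J x))" "(h, J x)" x]
  ultimately show ?thesis
    using assms ham_J_in_S[OF assms(3)] ham_equivariant[OF assms(2,3)] by simp
qed

lemma ham_smooth_action: "smooth_action (Ggrp Q) G X ham_action"
  unfolding smooth_action_def using ham_smooth ham_one ham_mult by simp

lemma ham_orbit_map: "x \<in> points X \<Longrightarrow> smooth_map G X (\<lambda>g. ham_action g x)"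
  and ham_diffeo: "g \<in> points G \<Longrightarrow> smooth_map X X (ham_action g)"
  by (intro smooth_map_compose2[OF charted_G charted_G ham_manifold(2) ham_manifold(2) ham_smooth]
        smooth_map_compose2[OF ham_manifold(2) charted_G ham_manifold(2) ham_manifold(2) ham_smooth]
        smooth_map_on_id smooth_map_on_const charted_G ham_manifold openin_topspace, assumption)+

text \<open>Functions that vanish on the graph provide conormal covectors.  The graph is cut out by
  \<open>y = \<Phi>(g, x)\<close> and \<open>s = J x\<close>, which suggests the following two kinds.\<close>

lemma conormal_of_function:
  assumes "f \<in> Cinf X"
  shows "(\<lambda>((g, s), x, y). f y - f (ham_action g x)) \<in> conormal ((G \<times>\<^sub>m S) \<times>\<^sub>m X \<times>\<^sub>m X) ham_graph p"
    and conormal_of_momentum: "a \<in> Cinf S \<Longrightarrow>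
      (\<lambda>((g, s), x, y). a s - a (J x)) \<in> conormal ((G \<times>\<^sub>m S) \<times>\<^sub>m X \<times>\<^sub>m X) ham_graph p"
proof -
  note X = ham_manifold(2)
  let ?M = "(G \<times>\<^sub>m S) \<times>\<^sub>m X \<times>\<^sub>m X"
  have GS: "charted (G \<times>\<^sub>m S)" and XX: "charted (X \<times>\<^sub>m X)" and M: "charted ?M" and GX: "charted (G \<times>\<^sub>m X)"
    by (intro charted_prod charted_G charted_S X)+
  have fst: "smooth_map ?M (G \<times>\<^sub>m S) fst" and snd: "smooth_map ?M (X \<times>\<^sub>m X) snd"
    by (rule smooth_map_fst[OF GS XX], rule smooth_map_snd[OF GS XX])
  have g: "smooth_map ?M G (\<lambda>p. fst (fst p))" and s: "smooth_map ?M S (\<lambda>p. snd (fst p))"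
    using smooth_map_on_into[OF fst]
    by (intro smooth_map_on_compose[OF M GS charted_G fst smooth_map_fst[OF charted_G charted_S]]
        smooth_map_on_compose[OF M GS charted_S fst smooth_map_snd[OF charted_G charted_S]]; blast)+
  have x: "smooth_map ?M X (\<lambda>p. fst (snd p))" and y: "smooth_map ?M X (\<lambda>p. snd (snd p))"
    using smooth_map_on_into[OF snd]
    by (intro smooth_map_on_compose[OF M XX X snd smooth_map_fst[OF X X]]
        smooth_map_on_compose[OF M XX X snd smooth_map_snd[OF X X]]; blast)+
  have gx: "smooth_map ?M X (\<lambda>p. ham_action (fst (fst p)) (fst (snd p)))"
    by (rule smooth_map_compose2[OF M charted_G X X ham_smooth g x])
  show "(\<lambda>((g, s), x, y). f y - f (ham_action g x)) \<in> conormal ?M ham_graph p"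
  proof (rule conormalI)
    have eq: "(\<lambda>((g, s), x, y). f y - f (ham_action g x)) =
        (\<lambda>p. f (snd (snd p)) - f (ham_action (fst (fst p)) (fst (snd p))))"
      by (rule ext) (simp add: case_prod_beta)
    show "(\<lambda>((g, s), x, y). f y - f (ham_action g x)) \<in> Cinf ?M"
      unfolding eq by (rule Cinf_diff[OF Cinf_compose[OF M X y assms] Cinf_compose[OF M X gx assms]])
  qed (auto simp: action_graph_def)
  assume a: "a \<in> Cinf S"
  show "(\<lambda>((g, s), x, y). a s - a (J x)) \<in> conormal ?M ham_graph p"
  proof (rule conormalI)
    have eq: "(\<lambda>((g, s), x, y). a s - a (J x)) = (\<lambda>p. a (snd (fst p)) - a (J (fst (snd p))))"
      by (rule ext) (simp add: case_prod_beta)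
    show "(\<lambda>((g, s), x, y). a s - a (J x)) \<in> Cinf ?M"
      unfolding eq by (rule Cinf_diff[OF Cinf_compose[OF M charted_S s a]
          Cinf_compose[OF M X x Cinf_compose[OF X charted_S ham_J a]]])
  qed (auto simp: action_graph_def)
qed

lemma ham_pull:
  assumes "f \<in> Cinf X"
  shows "x \<in> points X \<Longrightarrow> (\<lambda>g. f (ham_action g x)) \<in> Cinf G"
    and "g \<in> points G \<Longrightarrow> (\<lambda>x. f (ham_action g x)) \<in> Cinf X"
  by (rule Cinf_compose[OF charted_G ham_manifold(2) ham_orbit_map assms], assumption)
    (rule Cinf_compose[OF ham_manifold(2) ham_manifold(2) ham_diffeo assms])

lemma ham_graph_point:
  "g \<in> points G \<Longrightarrow> x \<in> points X \<Longrightarrow> ((g, J x), x, ham_action g x) \<in> ham_graph"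
  using ham_J_in_S by (auto simp: action_graph_def)

text \<open>Two covectors of the kind \<open>y = \<Phi>(g, x)\<close> have no component on \<open>S\<close>.  On them \<open>\<Pi>\<^sub>S\<close> and the mixed
  terms vanish, and coisotropy compares \<open>\<Pi>\<^sub>G\<close> and \<open>\<Pi>\<^sub>X\<close> at \<open>(g, x)\<close> with \<open>\<Pi>\<^sub>X\<close> at \<open>\<Phi>(g, x)\<close>.\<close>

lemma ham_pushes_to: "pushes_to (G \<times>\<^sub>m X) X (\<lambda>(g, x). ham_action g x) (PiG Q \<oplus>\<^sub>m PiX) PiX"
  unfolding pushes_to_def
proof (intro ballI)
  fix p f h assume p: "p \<in> points (G \<times>\<^sub>m X)" and f: "f \<in> Cinf X" and h: "h \<in> Cinf X"
  obtain g x where gx: "p = (g, x)" "g \<in> points G" "x \<in> points X" using p by auto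
  let ?y = "ham_action g x"
  have "triple_bivector PiX [\<lambda>((g, s), x, y). f y - f (ham_action g x),
      \<lambda>((g, s), x, y). h y - h (ham_action g x)] ((g, J x), x, ?y) = 0"
    using ham_coisotropic ham_graph_point[OF gx(2,3)] conormal_of_function[OF f] conormal_of_function[OF h]
    unfolding coisotropic_def by blast
  then have "0 = PiG Q [\<lambda>g'. f ?y - f (ham_action g' x), \<lambda>g'. h ?y - h (ham_action g' x)] g
      + PiX [\<lambda>x'. f ?y - f (ham_action g x'), \<lambda>x'. h ?y - h (ham_action g x')] x
      - PiX [\<lambda>y'. f y' - f ?y, \<lambda>y'. h y' - h ?y] ?y"
    unfolding triple_bivector_eq by (simp add: PiS_def generator_eq)
  moreover have "PiG Q [\<lambda>g'. f ?y - f (ham_action g' x), \<lambda>g'. h ?y - h (ham_action g' x)] g =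
      PiG Q [\<lambda>g'. f (ham_action g' x), \<lambda>g'. h (ham_action g' x)] g"
    using bivector_affine[OF bivector_PiG gx(2) ham_pull(1)[OF f gx(3)] ham_pull(1)[OF h gx(3)],
        of "-1" "f ?y" "-1" "h ?y"] by simp
  moreover have "PiX [\<lambda>x'. f ?y - f (ham_action g x'), \<lambda>x'. h ?y - h (ham_action g x')] x =
      PiX [\<lambda>x'. f (ham_action g x'), \<lambda>x'. h (ham_action g x')] x"
    using bivector_affine[OF ham_bivector gx(3) ham_pull(2)[OF f gx(2)] ham_pull(2)[OF h gx(2)],
        of "-1" "f ?y" "-1" "h ?y"] by simp
  moreover have "PiX [\<lambda>y'. f y' - f ?y, \<lambda>y'. h y' - h ?y] ?y = PiX [f, h] ?y"
    using bivector_affine[OF ham_bivector ham_in_X[OF gx(2,3)] f h, of 1 "- f ?y" 1 "- h ?y"] by simp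
  ultimately show "(PiG Q \<oplus>\<^sub>m PiX) [f \<circ> (\<lambda>(g, x). ham_action g x), h \<circ> (\<lambda>(g, x). ham_action g x)] p =
      PiX [f, h] ((\<lambda>(g, x). ham_action g x) p)"
    by (simp add: gx direct_sum_def)
qed

text \<open>One covector of each kind is inserted at the point \<open>((1, J x), x, x)\<close> over a unit.  The first has no
  component on \<open>G\<close> or on the last factor and the second none on \<open>S\<close>; so only \<open>\<Pi>\<^sub>X(J\<^sup>*da, df)\<close> and one
  mixed term remain.\<close>

lemma ham_moment:
  assumes x: "x \<in> points X" and a: "a \<in> Cinf S" and f: "f \<in> Cinf X"
  shows "PiX [a \<circ> J, f] x = - generator (expo Q) ham_action (lambda_S Q (J x) a) [f] x"
proof -
  note X = ham_manifold(2)
  let ?e = "\<one>\<^bsub>Dgrp Q\<^esub>" and ?s = "J x"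
  let ?\<theta> = "\<lambda>g'. f x - f (ham_action g' x)"
  let ?\<xi> = "lambda_S Q ?s a"
  have s: "?s \<in> points S" using ham_J_in_S[OF x] .
  have \<xi>: "?\<xi> \<in> gsub Q" by (rule lambda_S(2)[OF s a])
  have \<theta>: "?\<theta> \<in> Cinf G" by (intro Cinf_diff Cinf_const ham_pull(1)[OF f x])
  have aJ: "(\<lambda>x. a (J x)) \<in> Cinf X" by (rule Cinf_compose[OF X charted_S ham_J a])
  have "triple_bivector PiX [\<lambda>((g, s), x, y). a s - a (J x),
      \<lambda>((g, s), x, y). f y - f (ham_action g x)] ((?e, ?s), x, x) = 0"
    using ham_coisotropic ham_graph_point[OF one_in_G x, unfolded ham_one[OF x]]
      conormal_of_momentum[OF f a] conormal_of_function[OF f]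
    unfolding coisotropic_def by blast
  then have "0 = PiG Q [\<lambda>_. 0, ?\<theta>] ?e
      - generator (expo Q) (act_S Q) (left_pullback Q ?e ?\<theta>) [\<lambda>s'. a s' - a ?s] ?s
      + PiX [\<lambda>x'. a ?s - a (J x'), \<lambda>x'. f x - f (ham_action ?e x')] x
      - PiX [\<lambda>_. 0, \<lambda>y'. f y' - f (ham_action ?e x)] x"
    unfolding triple_bivector_eq by (simp add: PiS_def generator_eq)
  moreover have "PiG Q [\<lambda>_. 0, ?\<theta>] ?e = 0"
    by (rule bivector_const_left[OF bivector_PiG one_in_G \<theta>])
  moreover have "PiX [\<lambda>_. 0, \<lambda>y'. f y' - f (ham_action ?e x)] x = 0"
    by (intro bivector_const_left[OF ham_bivector x] Cinf_diff f Cinf_const)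
  moreover have "generator (expo Q) (act_S Q) (left_pullback Q ?e ?\<theta>) [\<lambda>s'. a s' - a ?s] ?s =
      - generator (expo Q) ham_action ?\<xi> [f] x"
  proof -
    have "generator (expo Q) (act_S Q) (left_pullback Q ?e ?\<theta>) [\<lambda>s'. a s' - a ?s] ?s =
        generator (expo Q) (act_S Q) (left_pullback Q ?e ?\<theta>) [a] ?s"
      by (simp add: generator_eq deriv_minus_const)
    also have "\<dots> = deriv (\<lambda>t. ?\<theta> (expo Q (t *\<^sub>R ?\<xi>))) 0"
      unfolding mixed_term[OF one_in_G \<theta> s a] by (simp add: one_mult expo_in_G[OF \<xi>])
    also have "\<dots> = - deriv (\<lambda>t. f (ham_action (expo Q (t *\<^sub>R ?\<xi>)) x)) 0"
    proof -
      have "(\<lambda>t. expo Q (t *\<^sub>R ?\<xi>)) \<in> curves_at G ?e"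
        using left_translated_curve[OF one_in_G \<xi>] by (simp add: one_mult expo_in_G[OF \<xi>])
      from deriv_lincomb_along_curve[OF charted_G Cinf_const ham_pull(1)[OF f x] this, of 1 "f x" "-1"]
      show ?thesis by simp
    qed
    finally show ?thesis by (simp add: generator_eq)
  qed
  moreover have "PiX [\<lambda>x'. a ?s - a (J x'), \<lambda>x'. f x - f (ham_action ?e x')] x = PiX [a \<circ> J, f] x"
  proof -
    have "PiX [\<lambda>x'. a ?s - a (J x'), \<lambda>x'. f x - f (ham_action ?e x')] x =
        PiX [\<lambda>x'. a (J x'), \<lambda>x'. f (ham_action ?e x')] x"
      using bivector_affine[OF ham_bivector x aJ ham_pull(2)[OF f one_in_G], of "-1" "a ?s" "-1" "f x"] by simp
    also have "\<dots> = PiX [\<lambda>x'. a (J x'), f] x"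
    proof (rule bivector_cong[OF ham_bivector x aJ aJ ham_pull(2)[OF f one_in_G] f])
      show "same_covector X x (\<lambda>x'. a (J x')) (\<lambda>x'. a (J x'))" by (simp add: same_covector_def)
      show "same_covector X x (\<lambda>x'. f (ham_action ?e x')) f"
      proof (rule same_covectorI[OF ham_pull(2)[OF f one_in_G] f])
        fix \<gamma> assume "\<gamma> \<in> curves_at X x"
        from curves_at_points[OF this]
        have "\<forall>\<^sub>F t in nhds 0. f (ham_action ?e (\<gamma> t)) = f (\<gamma> t)"
          by eventually_elim (simp add: ham_one)
        then show "deriv (\<lambda>t. f (ham_action ?e (\<gamma> t))) 0 = deriv (\<lambda>t. f (\<gamma> t)) 0"
          by (rule deriv_cong_ev) simp
      qed
    qed
    finally show ?thesis by (simp add: comp_def)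
  qed
  ultimately show ?thesis by simp
qed

lemma hamiltonian_imp_quasi_hamiltonian: "quasi_hamiltonian_space Q X PiX ham_action J"
  unfolding quasi_hamiltonian_space_def quasi_poisson_action_def
proof (intro conjI ballI)
  fix f1 f2 f3 x assume "f1 \<in> Cinf X" "f2 \<in> Cinf X" "f3 \<in> Cinf X" "x \<in> points X"
  then have "1/2 * schouten 2 2 PiX PiX [f1, f2, f3] x = hat act J (Om3 (Gamma_groupoid Q)) [f1, f2, f3] x"
    using ham by (simp add: hamiltonian_groupoid_space_def)
  then show "1/2 * schouten 2 2 PiX PiX [f1, f2, f3] x =
      ext3 (gdim Q) (Om_coeff Q) (\<lambda>i. generator (expo Q) ham_action (\<ee> i)) [f1, f2, f3] x"
    by (simp only: hat_Om3)
qed (simp_all add: ham_manifold ham_bivector ham_smooth_action ham_pushes_to ham_J ham_equivariant ham_moment)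

end

end

section \<open>Quasi-hamiltonian spaces as Hamiltonian \<open>\<Gamma>\<close>-spaces\<close>

theorem theorem4p27:
  fixes Q :: "('v::real_vector, 'd, 'ed::euclidean_space, 'eg::euclidean_space, 'es::euclidean_space) group_pair"
    and X :: "('x, 'ex::euclidean_space) mfd"
    and PiX :: "'x mv"
    and J :: "'x \<Rightarrow> 'd set"
  assumes "manin_quasi_triple (bracket Q) (form Q) (gsub Q) (hsub Q)"
    and "quasi_lie_bialgebra_data Q"
    and "is_group_pair Q"
    and "is_PiG Q"
  shows "(\<forall>\<Phi>. quasi_hamiltonian_space Q X PiX \<Phi> J \<longrightarrow>
            hamiltonian_groupoid_space (Gamma_groupoid Q) X PiX (\<lambda>(g, s) x. \<Phi> g x) J)
       \<and> (\<forall>act. hamiltonian_groupoid_space (Gamma_groupoid Q) X PiX act J \<longrightarrow>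
            quasi_hamiltonian_space Q X PiX (\<lambda>g x. act (g, J x) x) J)"
proof -
  interpret quasi_triple_group_pair Q using assms by unfold_locales
  show ?thesis using quasi_hamiltonian_imp_hamiltonian hamiltonian_imp_quasi_hamiltonian by blast
qed

end
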